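(* Let $P$ be an abelian left-cancellative semigroup with identity, and let $(\mathcal{A},P,\alpha)$ be an injective semigroup dynamical system whose projections are aligned and such that $\alpha_p(\mathcal{A})$ is hereditary in $\mathcal{A}$ for every $p\in P$. Let $(\pi,V)$ be an isometric covariant representation for $(\mathcal{A},P,\alpha)$. Then $(\pi,V)$ is also an isometric right covariant representation, and $(\pi,V)$ is maximal for $\mathcal{A}\rtimes_\alpha^{iso}P$.
   Context: A semigroup dynamical system is a triple $(\mathcal{A},P,\alpha)$ where $\mathcal{A}$ is a unital $C^*$-algebra, $P$ is a semigroup with identity $e$, and $\alpha$ is an action of $P$ on $\mathcal{A}$ by (not necessarily unital) $*$-endomorphisms $\alpha_p$ ($\alpha_{pq}=\alpha_p\circ\alpha_q$, $\alpha_e=\mathrm{id}$). It is injective if every $\alpha_p$ is injective. Its projections are aligned if $\alpha_p(1)$ and $\alpha_q(1)$ commute for all $p,q\in P$. A subalgebra $\mathcal{B}\subset\mathcal{A}$ is hereditary if $0\le a\le b$ with $a\in\mathcal{A}$, $b\in\mathcal{B}$ implies $a\in\mathcal{B}$. Consider pairs $(\pi,V)$ where $\pi:\mathcal{A}\to\mathcal{B}(\mathcal{H})$ is a unital $*$-homomorphism and $V:P\to\mathcal{B}(\mathcal{H})$ is an isometric representation (each $V(p)$ is an isometry, $V(pq)=V(p)V(q)$) with $V(e)=I$. The pair is an isometric covariant representation if $V(p)\pi(a)V(p)^*=\pi(\alpha_p(a))$ for all $p\in P$, $a\in\mathcal{A}$; it is an isometric right covariant representation if $V(p)\pi(a)=\pi(\alpha_p(a))V(p)$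 for all $p\in P$, $a\in\mathcal{A}$. $c_{00}(P,\mathcal{A})$ is the linear span of symbols $a\otimes\delta_p$ ($a\in\mathcal{A}$, $p\in P$) with product $(a\otimes\delta_p)(b\otimes\delta_q)=a\alpha_p(b)\otimes\delta_{pq}$. Each isometric right covariant representation $(\pi,V)$ gives a homomorphism $\Phi_{\pi,V}(a\otimes\delta_p)=\pi(a)V(p)$. For $x\in \mathcal{M}_n(c_{00}(P,\mathcal{A}))$ put $\|x\|_n=\sup\|\Phi^{(n)}_{\pi,V}(x)\|$ over all isometric right covariant representations. $\mathcal{A}\rtimes_\alpha^{iso}P$ is the operator algebra obtained by completing $c_{00}(P,\mathcal{A})$ with respect to these matrix (semi)norms (elements of seminorm zero are identified with $0$). An isometric right covariant representation $(\pi,V)$ is identified with the completely contractive homomorphism of $\mathcal{A}\rtimes_\alpha^{iso}P$ induced by $\Phi_{\pi,V}$. For an operator algebra $\mathcal{B}$ and a completely contractive homomorphism $\phi:\mathcal{B}\to\mathcal{B}(\mathcal{H})$, a dilation of $\phi$ is a completely contractive homomorphism $\rho:\mathcal{B}\to\mathcal{B}(\mathcal{K})$ on a Hilbert space $\mathcal{K}\supset\mathcal{H}$ with $\phi(b)=P_{\mathcal{H}}\rho(b)|_{\mathcal{H}}$ for all $b\in\mathcal{B}$; $\phi$ is maximal if every dilation $\rho$ of $\phi$ has the form $\phi\oplus\psi$ for some representation $\psi$. *)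

theory Defs
  imports Complex_Main "HOL-Library.FuncSet" "HOL-Library.Poly_Mapping" "HOL-Algebra.Module"
begin

section \<open>Unital C*-algebras and semigroup dynamical systems\<close>

text \<open>The zero algebra is not excluded (the class does not demand \<open>0 \<noteq> 1\<close>).\<close>

class unital_cstar_algebra = banach + real_normed_algebra + monoid_mult +
  fixes scaleC :: "complex \<Rightarrow> 'a \<Rightarrow> 'a" (infixr "*\<^sub>C" 75)
    and star :: "'a \<Rightarrow> 'a"
  assumes scaleC_add_right: "c *\<^sub>C (x + y) = c *\<^sub>C x + c *\<^sub>C y"
    and scaleC_add_left: "(c + d) *\<^sub>C x = c *\<^sub>C x + d *\<^sub>C x"
    and scaleC_scaleC: "c *\<^sub>C d *\<^sub>C x = (c * d) *\<^sub>C x"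
    and scaleC_of_real: "complex_of_real r *\<^sub>C x = r *\<^sub>R x"
    and mult_scaleC_left: "(c *\<^sub>C x) * y = c *\<^sub>C (x * y)"
    and mult_scaleC_right: "x * (c *\<^sub>C y) = c *\<^sub>C (x * y)"
    and norm_scaleC: "norm (c *\<^sub>C x) = cmod c * norm x"
    and star_add: "star (x + y) = star x + star y"
    and star_scaleC: "star (c *\<^sub>C x) = cnj c *\<^sub>C star x"
    and star_mult: "star (x * y) = star y * star x"
    and star_star: "star (star x) = x"
    and cstar_identity: "norm (star x * x) = (norm x)\<^sup>2"

definition star_endomorphism :: "('a::unital_cstar_algebra \<Rightarrow> 'a) \<Rightarrow> bool" where
  "star_endomorphism f \<longleftrightarrow>
     (\<forall>a b. f (a + b) = f a + f b) \<and> (\<forall>c a. f (c *\<^sub>C a) = c *\<^sub>C f a) \<and>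
     (\<forall>a b. f (a * b) = f a * f b) \<and> (\<forall>a. f (star a) = star (f a))"

definition semigroup_dynamical_system ::
    "('p::monoid_mult \<Rightarrow> 'a::unital_cstar_algebra \<Rightarrow> 'a) \<Rightarrow> bool" where
  "semigroup_dynamical_system \<alpha> \<longleftrightarrow>
     (\<forall>p. star_endomorphism (\<alpha> p)) \<and> (\<forall>p q. \<alpha> (p * q) = \<alpha> p \<circ> \<alpha> q) \<and> \<alpha> 1 = id"

definition injective_system :: "('p \<Rightarrow> 'a \<Rightarrow> 'a) \<Rightarrow> bool" where
  "injective_system \<alpha> \<longleftrightarrow> (\<forall>p. inj (\<alpha> p))"

definition aligned_projections :: "('p \<Rightarrow> 'a::unital_cstar_algebra \<Rightarrow> 'a) \<Rightarrow> bool" where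
  "aligned_projections \<alpha> \<longleftrightarrow> (\<forall>p q. \<alpha> p 1 * \<alpha> q 1 = \<alpha> q 1 * \<alpha> p 1)"

definition cstar_le :: "'a::unital_cstar_algebra \<Rightarrow> 'a \<Rightarrow> bool" where
  "cstar_le a b \<longleftrightarrow> (\<exists>c. b - a = star c * c)"

definition hereditary :: "'a::unital_cstar_algebra set \<Rightarrow> bool" where
  "hereditary B \<longleftrightarrow> (\<forall>a b. b \<in> B \<longrightarrow> cstar_le 0 a \<longrightarrow> cstar_le a b \<longrightarrow> a \<in> B)"


section \<open>Complex Hilbert spaces with explicit carriers\<close>

text \<open>
  Hilbert spaces have explicit carriers because the matrix norms below are suprema over all
  Hilbert spaces of a type. The inner product is linear in its first argument. The ring
  multiplication and unit fields inherited from the record of modules play no role here.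
\<close>

record 'h hilbert = "(complex, 'h) module" +
  cinner :: "'h \<Rightarrow> 'h \<Rightarrow> complex"

definition complex_ring :: "complex ring" where
  "complex_ring = \<lparr>carrier = UNIV, mult = (*), one = 1, zero = 0, add = (+)\<rparr>"

definition hnorm :: "'h hilbert \<Rightarrow> 'h \<Rightarrow> real" where
  "hnorm H x = sqrt (Re (cinner H x x))"

locale complex_hilbert_space = Module.module complex_ring H
  for H :: "'h hilbert" (structure) +
  assumes cinner_add_left: "\<lbrakk>x \<in> carrier H; y \<in> carrier H; z \<in> carrier H\<rbrakk> \<Longrightarrow>
      cinner H (x \<oplus> y) z = cinner H x z + cinner H y z"
    and cinner_smult_left: "\<lbrakk>x \<in> carrier H; y \<in> carrier H\<rbrakk> \<Longrightarrow>
      cinner H (c \<odot> x) y = c * cinner H x y"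
    and cinner_commute: "\<lbrakk>x \<in> carrier H; y \<in> carrier H\<rbrakk> \<Longrightarrow>
      cinner H y x = cnj (cinner H x y)"
    and cinner_ge_zero: "x \<in> carrier H \<Longrightarrow> 0 \<le> Re (cinner H x x)"
    and cinner_eq_zero: "\<lbrakk>x \<in> carrier H; cinner H x x = 0\<rbrakk> \<Longrightarrow> x = \<zero>"
    and complete: "\<lbrakk>\<And>k. f k \<in> carrier H;
        \<And>e. e > 0 \<Longrightarrow> \<exists>N. \<forall>k\<ge>N. \<forall>l\<ge>N. hnorm H (f k \<ominus> f l) < e\<rbrakk> \<Longrightarrow>
      \<exists>x \<in> carrier H. (\<lambda>k::nat. hnorm H (f k \<ominus> x)) \<longlonglongrightarrow> 0"

definition hilbert_power :: "'h hilbert \<Rightarrow> nat \<Rightarrow> (nat \<Rightarrow> 'h) hilbert" where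
  "hilbert_power H n =
     \<lparr>carrier = {..<n} \<rightarrow>\<^sub>E carrier H, mult = undefined, one = undefined,
      zero = (\<lambda>i\<in>{..<n}. \<zero>\<^bsub>H\<^esub>), add = (\<lambda>x y. \<lambda>i\<in>{..<n}. x i \<oplus>\<^bsub>H\<^esub> y i),
      smult = (\<lambda>c x. \<lambda>i\<in>{..<n}. c \<odot>\<^bsub>H\<^esub> x i), cinner = (\<lambda>x y. \<Sum>i<n. cinner H (x i) (y i))\<rparr>"

definition orthogonal_complement :: "'h hilbert \<Rightarrow> 'h set \<Rightarrow> 'h hilbert" where
  "orthogonal_complement K S =
     K\<lparr>carrier := {y \<in> carrier K. \<forall>x\<in>S. cinner K x y = 0}\<rparr>"

text \<open>
  Operators are extensional functions on the carrier, so that equality of operators is equality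
  of functions and \<^term>\<open>compose (carrier H) S T\<close> is the product of \<open>S\<close> and \<open>T\<close>.
\<close>

definition bounded_operators :: "'h hilbert \<Rightarrow> 'k hilbert \<Rightarrow> ('h \<Rightarrow> 'k) set" where
  "bounded_operators H K =
     {T \<in> carrier H \<rightarrow>\<^sub>E carrier K.
        (\<forall>x\<in>carrier H. \<forall>y\<in>carrier H. T (x \<oplus>\<^bsub>H\<^esub> y) = T x \<oplus>\<^bsub>K\<^esub> T y) \<and>
        (\<forall>c. \<forall>x\<in>carrier H. T (c \<odot>\<^bsub>H\<^esub> x) = c \<odot>\<^bsub>K\<^esub> T x) \<and>
        (\<exists>C. \<forall>x\<in>carrier H. hnorm K (T x) \<le> C * hnorm H x)}"

definition op_norm :: "'h hilbert \<Rightarrow> 'k hilbert \<Rightarrow> ('h \<Rightarrow> 'k) \<Rightarrow> real" where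
  "op_norm H K T = Sup {hnorm K (T x) | x. x \<in> carrier H \<and> hnorm H x \<le> 1}"

definition adjoint :: "'h hilbert \<Rightarrow> 'k hilbert \<Rightarrow> ('h \<Rightarrow> 'k) \<Rightarrow> 'k \<Rightarrow> 'h" where
  "adjoint H K T = (THE S. S \<in> bounded_operators K H \<and>
     (\<forall>x\<in>carrier H. \<forall>y\<in>carrier K. cinner K (T x) y = cinner H x (S y)))"

definition isometry :: "'h hilbert \<Rightarrow> 'k hilbert \<Rightarrow> ('h \<Rightarrow> 'k) \<Rightarrow> bool" where
  "isometry H K T \<longleftrightarrow>
     T \<in> bounded_operators H K \<and> (\<forall>x\<in>carrier H. hnorm K (T x) = hnorm H x)"

text \<open>The norm of an \<open>n \<times> n\<close> matrix of operators on \<open>H\<close>, acting on the Hilbert space sum of \<open>n\<close>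
  copies of \<open>H\<close>; only the entries \<^term>\<open>T i j\<close> with \<open>i, j < n\<close> matter.\<close>

definition matrix_operator ::
    "'h hilbert \<Rightarrow> nat \<Rightarrow> (nat \<Rightarrow> nat \<Rightarrow> 'h \<Rightarrow> 'h) \<Rightarrow> (nat \<Rightarrow> 'h) \<Rightarrow> (nat \<Rightarrow> 'h)" where
  "matrix_operator H n T =
     (\<lambda>x\<in>carrier (hilbert_power H n). \<lambda>i\<in>{..<n}. \<Oplus>\<^bsub>H\<^esub>j\<in>{..<n}. T i j (x j))"

definition matrix_op_norm :: "'h hilbert \<Rightarrow> nat \<Rightarrow> (nat \<Rightarrow> nat \<Rightarrow> 'h \<Rightarrow> 'h) \<Rightarrow> real" where
  "matrix_op_norm H n T =
     op_norm (hilbert_power H n) (hilbert_power H n) (matrix_operator H n T)"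


section \<open>Covariant representations\<close>

definition unital_star_representation ::
    "'h hilbert \<Rightarrow> ('a::unital_cstar_algebra \<Rightarrow> 'h \<Rightarrow> 'h) \<Rightarrow> bool" where
  "unital_star_representation H \<pi> \<longleftrightarrow>
     (\<forall>a. \<pi> a \<in> bounded_operators H H) \<and>
     (\<forall>a b. \<forall>x\<in>carrier H. \<pi> (a + b) x = \<pi> a x \<oplus>\<^bsub>H\<^esub> \<pi> b x) \<and>
     (\<forall>c a. \<forall>x\<in>carrier H. \<pi> (c *\<^sub>C a) x = c \<odot>\<^bsub>H\<^esub> \<pi> a x) \<and>
     (\<forall>a b. \<pi> (a * b) = compose (carrier H) (\<pi> a) (\<pi> b)) \<and>
     (\<forall>a. \<pi> (star a) = adjoint H H (\<pi> a)) \<and>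
     \<pi> 1 = (\<lambda>x\<in>carrier H. x)"

definition isometric_representation ::
    "'h hilbert \<Rightarrow> ('p::monoid_mult \<Rightarrow> 'h \<Rightarrow> 'h) \<Rightarrow> bool" where
  "isometric_representation H V \<longleftrightarrow>
     (\<forall>p. isometry H H (V p)) \<and>
     (\<forall>p q. V (p * q) = compose (carrier H) (V p) (V q)) \<and>
     V 1 = (\<lambda>x\<in>carrier H. x)"

definition isometric_covariant_rep ::
    "('p::monoid_mult \<Rightarrow> 'a::unital_cstar_algebra \<Rightarrow> 'a) \<Rightarrow> 'h hilbert \<Rightarrow>
     ('a \<Rightarrow> 'h \<Rightarrow> 'h) \<Rightarrow> ('p \<Rightarrow> 'h \<Rightarrow> 'h) \<Rightarrow> bool" where
  "isometric_covariant_rep \<alpha> H \<pi> V \<longleftrightarrow>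
     complex_hilbert_space H \<and> unital_star_representation H \<pi> \<and> isometric_representation H V \<and>
     (\<forall>p a. compose (carrier H) (V p) (compose (carrier H) (\<pi> a) (adjoint H H (V p)))
              = \<pi> (\<alpha> p a))"

definition isometric_right_covariant_rep ::
    "('p::monoid_mult \<Rightarrow> 'a::unital_cstar_algebra \<Rightarrow> 'a) \<Rightarrow> 'h hilbert \<Rightarrow>
     ('a \<Rightarrow> 'h \<Rightarrow> 'h) \<Rightarrow> ('p \<Rightarrow> 'h \<Rightarrow> 'h) \<Rightarrow> bool" where
  "isometric_right_covariant_rep \<alpha> H \<pi> V \<longleftrightarrow>
     complex_hilbert_space H \<and> unital_star_representation H \<pi> \<and> isometric_representation H V \<and>
     (\<forall>p a. compose (carrier H) (V p) (\<pi> a) = compose (carrier H) (\<pi> (\<alpha> p a)) (V p))"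


section \<open>The convolution algebra and its matrix seminorms\<close>

text \<open>
  \<open>c\<^sub>0\<^sub>0(P, A)\<close> is the space \<^typ>\<open>'p \<Rightarrow>\<^sub>0 'a\<close> of finitely supported functions, with
  \<^term>\<open>Poly_Mapping.single p a\<close> in the role of the symbol \<open>a \<otimes> \<delta>\<^sub>p\<close>. Its product
  is not the convolution that \<^theory>\<open>HOL-Library.Poly_Mapping\<close> provides but is twisted by \<open>\<alpha>\<close>.
\<close>

definition c00_mult ::
    "('p::monoid_mult \<Rightarrow> 'a::unital_cstar_algebra \<Rightarrow> 'a) \<Rightarrow> ('p \<Rightarrow>\<^sub>0 'a) \<Rightarrow> ('p \<Rightarrow>\<^sub>0 'a) \<Rightarrow> ('p \<Rightarrow>\<^sub>0 'a)"
  where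
  "c00_mult \<alpha> x y = (\<Sum>p\<in>Poly_Mapping.keys x. \<Sum>q\<in>Poly_Mapping.keys y.
     Poly_Mapping.single (p * q) (Poly_Mapping.lookup x p * \<alpha> p (Poly_Mapping.lookup y q)))"

definition c00_scale :: "complex \<Rightarrow> ('p \<Rightarrow>\<^sub>0 'a::unital_cstar_algebra) \<Rightarrow> ('p \<Rightarrow>\<^sub>0 'a)" where
  "c00_scale c x = Poly_Mapping.map (\<lambda>a. c *\<^sub>C a) x"

definition c00_hom ::
    "'h hilbert \<Rightarrow> ('a::unital_cstar_algebra \<Rightarrow> 'h \<Rightarrow> 'h) \<Rightarrow> ('p \<Rightarrow> 'h \<Rightarrow> 'h) \<Rightarrow> ('p \<Rightarrow>\<^sub>0 'a) \<Rightarrow> 'h \<Rightarrow> 'h"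
  where
  "c00_hom H \<pi> V x =
     (\<lambda>\<xi>\<in>carrier H. \<Oplus>\<^bsub>H\<^esub>p\<in>Poly_Mapping.keys x. \<pi> (Poly_Mapping.lookup x p) (V p \<xi>))"

text \<open>
  HOL cannot quantify over Hilbert spaces of all types inside a formula, so the supremum defining
  the matrix seminorms ranges over all Hilbert spaces with carrier in the following type.
  This is the supremum over all Hilbert spaces whatsoever: for any \<open>(\<pi>, V)\<close> on \<open>H\<close> and any
  \<open>\<xi>\<^sub>0, \<dots>, \<xi>\<^sub>n\<^sub>-\<^sub>1\<close> in \<open>H\<close>, the closure of the set of all \<open>\<Sum>\<^sub>j \<Phi>(x\<^sub>j) \<xi>\<^sub>j\<close> (\<open>x\<^sub>j \<in> c\<^sub>0\<^sub>0(P, A)\<close>)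
  is a subspace containing the \<open>\<xi>\<^sub>j\<close>, and \<open>(\<pi>, V)\<close> restricts to an isometric right covariant
  representation on it; each of its vectors is the limit of such sums for some sequence of tuples
  of elements of \<open>c\<^sub>0\<^sub>0(P, A)\<close>, so the subspace injects into the type, and its Hilbert space
  structure can be transported along the injection.
\<close>

type_synonym ('p, 'a) rep_universe = "nat \<Rightarrow> nat \<Rightarrow> ('p \<Rightarrow>\<^sub>0 'a)"

definition crossed_seminorm ::
    "('p::monoid_mult \<Rightarrow> 'a::unital_cstar_algebra \<Rightarrow> 'a) \<Rightarrow> nat \<Rightarrow> (nat \<Rightarrow> nat \<Rightarrow> ('p \<Rightarrow>\<^sub>0 'a)) \<Rightarrow> real"
  where
  "crossed_seminorm \<alpha> n x = Sup {matrix_op_norm H n (\<lambda>i j. c00_hom H \<pi> V (x i j)) |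
     (H :: ('p, 'a) rep_universe hilbert) \<pi> V. isometric_right_covariant_rep \<alpha> H \<pi> V}"

abbreviation crossed_seminorm1 ::
    "('p::monoid_mult \<Rightarrow> 'a::unital_cstar_algebra \<Rightarrow> 'a) \<Rightarrow> ('p \<Rightarrow>\<^sub>0 'a) \<Rightarrow> real" where
  "crossed_seminorm1 \<alpha> x \<equiv> crossed_seminorm \<alpha> 1 (\<lambda>_ _. x)"


section \<open>Operator algebras, and the completion of the convolution algebra\<close>

text \<open>Algebras with a norm on the \<open>n \<times> n\<close> matrices for each \<open>n\<close>; a matrix norm looks only at the
  entries with indices below \<open>n\<close>.\<close>

record 'b operator_algebra = "(complex, 'b) module" +
  matrix_norm :: "nat \<Rightarrow> (nat \<Rightarrow> nat \<Rightarrow> 'b) \<Rightarrow> real"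

definition crossed_Cauchy ::
    "('p::monoid_mult \<Rightarrow> 'a::unital_cstar_algebra \<Rightarrow> 'a) \<Rightarrow> (nat \<Rightarrow> ('p \<Rightarrow>\<^sub>0 'a)) set" where
  "crossed_Cauchy \<alpha> =
     {x. \<forall>e>0. \<exists>N. \<forall>k\<ge>N. \<forall>l\<ge>N. crossed_seminorm1 \<alpha> (x k - x l) < e}"

definition crossed_rel ::
    "('p::monoid_mult \<Rightarrow> 'a::unital_cstar_algebra \<Rightarrow> 'a) \<Rightarrow> (nat \<Rightarrow> ('p \<Rightarrow>\<^sub>0 'a)) rel" where
  "crossed_rel \<alpha> = {(x, y). x \<in> crossed_Cauchy \<alpha> \<and> y \<in> crossed_Cauchy \<alpha> \<and>
     (\<lambda>k. crossed_seminorm1 \<alpha> (x k - y k)) \<longlonglongrightarrow> 0}"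

text \<open>The element of the completion given by an element of \<open>c\<^sub>0\<^sub>0(P, A)\<close>.\<close>

definition crossed_embed ::
    "('p::monoid_mult \<Rightarrow> 'a::unital_cstar_algebra \<Rightarrow> 'a) \<Rightarrow> ('p \<Rightarrow>\<^sub>0 'a) \<Rightarrow> (nat \<Rightarrow> ('p \<Rightarrow>\<^sub>0 'a)) set"
  where
  "crossed_embed \<alpha> x = crossed_rel \<alpha> `` {\<lambda>_. x}"

text \<open>
  The completion consists of the Cauchy sequences modulo sequences tending to zero. A sequence of
  matrices is Cauchy for the seminorm on \<open>n \<times> n\<close> matrices iff all its entries are Cauchy, so all
  these seminorms extend to this one completion by taking limits.
\<close>

definition iso_crossed_product ::
    "('p::monoid_mult \<Rightarrow> 'a::unital_cstar_algebra \<Rightarrow> 'a) \<Rightarrow>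
     (nat \<Rightarrow> ('p \<Rightarrow>\<^sub>0 'a)) set operator_algebra" where
  "iso_crossed_product \<alpha> =
     \<lparr>carrier = crossed_Cauchy \<alpha> // crossed_rel \<alpha>,
      mult = (\<lambda>X Y. \<Union>x\<in>X. \<Union>y\<in>Y. crossed_rel \<alpha> `` {\<lambda>k. c00_mult \<alpha> (x k) (y k)}),
      one = crossed_embed \<alpha> (Poly_Mapping.single 1 1),
      zero = crossed_embed \<alpha> 0,
      add = (\<lambda>X Y. \<Union>x\<in>X. \<Union>y\<in>Y. crossed_rel \<alpha> `` {\<lambda>k. x k + y k}),
      smult = (\<lambda>c X. \<Union>x\<in>X. crossed_rel \<alpha> `` {\<lambda>k. c00_scale c (x k)}),
      matrix_norm = (\<lambda>n X. lim (\<lambda>k. crossed_seminorm \<alpha> n (\<lambda>i j. (SOME x. x \<in> X i j) k)))\<rparr>"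


section \<open>Dilations and maximality\<close>

text \<open>Homomorphisms need not be unital, and the algebra homomorphism is extensional on the carrier.\<close>

definition cc_homomorphism ::
    "'b operator_algebra \<Rightarrow> 'h hilbert \<Rightarrow> ('b \<Rightarrow> 'h \<Rightarrow> 'h) \<Rightarrow> bool" where
  "cc_homomorphism B H \<phi> \<longleftrightarrow>
     complex_hilbert_space H \<and> \<phi> \<in> carrier B \<rightarrow>\<^sub>E bounded_operators H H \<and>
     (\<forall>b\<in>carrier B. \<forall>c\<in>carrier B. \<forall>x\<in>carrier H. \<phi> (b \<oplus>\<^bsub>B\<^esub> c) x = \<phi> b x \<oplus>\<^bsub>H\<^esub> \<phi> c x) \<and>
     (\<forall>z. \<forall>b\<in>carrier B. \<forall>x\<in>carrier H. \<phi> (z \<odot>\<^bsub>B\<^esub> b) x = z \<odot>\<^bsub>H\<^esub> \<phi> b x) \<and>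
     (\<forall>b\<in>carrier B. \<forall>c\<in>carrier B. \<phi> (b \<otimes>\<^bsub>B\<^esub> c) = compose (carrier H) (\<phi> b) (\<phi> c)) \<and>
     (\<forall>n X. (\<forall>i<n. \<forall>j<n. X i j \<in> carrier B) \<longrightarrow>
        matrix_op_norm H n (\<lambda>i j. \<phi> (X i j)) \<le> matrix_norm B n X)"

text \<open>
  The inclusion of \<open>H\<close> in the larger space \<open>K\<close> is an isometry \<open>J\<close>, which allows \<open>K\<close> to have any
  type. Then \<^term>\<open>adjoint H K J\<close> is the orthogonal projection onto \<open>H\<close>, as a map from \<open>K\<close> to \<open>H\<close>.
\<close>

definition is_dilation ::
    "'b operator_algebra \<Rightarrow> 'h hilbert \<Rightarrow> ('b \<Rightarrow> 'h \<Rightarrow> 'h) \<Rightarrow>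
     'k hilbert \<Rightarrow> ('h \<Rightarrow> 'k) \<Rightarrow> ('b \<Rightarrow> 'k \<Rightarrow> 'k) \<Rightarrow> bool" where
  "is_dilation B H \<phi> K J \<rho> \<longleftrightarrow>
     cc_homomorphism B K \<rho> \<and> isometry H K J \<and>
     (\<forall>b\<in>carrier B. \<phi> b = compose (carrier H) (adjoint H K J) (compose (carrier H) (\<rho> b) J))"

definition is_direct_sum ::
    "'b operator_algebra \<Rightarrow> 'h hilbert \<Rightarrow> ('b \<Rightarrow> 'h \<Rightarrow> 'h) \<Rightarrow>
     'k hilbert \<Rightarrow> ('h \<Rightarrow> 'k) \<Rightarrow> ('b \<Rightarrow> 'k \<Rightarrow> 'k) \<Rightarrow> ('b \<Rightarrow> 'k \<Rightarrow> 'k) \<Rightarrow> bool" where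
  "is_direct_sum B H \<phi> K J \<psi> \<rho> \<longleftrightarrow>
     (\<forall>b\<in>carrier B. \<forall>x\<in>carrier H. \<forall>y\<in>carrier (orthogonal_complement K (J ` carrier H)).
        \<rho> b (J x \<oplus>\<^bsub>K\<^esub> y) = J (\<phi> b x) \<oplus>\<^bsub>K\<^esub> \<psi> b y)"

text \<open>The type argument is the type of the larger Hilbert spaces; a theorem about maximality that
  is polymorphic in it covers all Hilbert spaces.\<close>

definition maximal_rep ::
    "'k itself \<Rightarrow> 'b operator_algebra \<Rightarrow> 'h hilbert \<Rightarrow> ('b \<Rightarrow> 'h \<Rightarrow> 'h) \<Rightarrow> bool" where
  "maximal_rep _ B H \<phi> \<longleftrightarrow>
     cc_homomorphism B H \<phi> \<and>
     (\<forall>(K :: 'k hilbert) J \<rho>. is_dilation B H \<phi> K J \<rho> \<longrightarrow>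
        (\<exists>\<psi>. cc_homomorphism B (orthogonal_complement K (J ` carrier H)) \<psi> \<and>
             is_direct_sum B H \<phi> K J \<psi> \<rho>))"

text \<open>The unique extension of the homomorphism of \<open>c\<^sub>0\<^sub>0(P, A)\<close> given by \<open>(\<pi>, V)\<close>.\<close>

definition induced_hom ::
    "('p::monoid_mult \<Rightarrow> 'a::unital_cstar_algebra \<Rightarrow> 'a) \<Rightarrow> 'h hilbert \<Rightarrow>
     ('a \<Rightarrow> 'h \<Rightarrow> 'h) \<Rightarrow> ('p \<Rightarrow> 'h \<Rightarrow> 'h) \<Rightarrow> (nat \<Rightarrow> ('p \<Rightarrow>\<^sub>0 'a)) set \<Rightarrow> 'h \<Rightarrow> 'h" where
  "induced_hom \<alpha> H \<pi> V = (THE \<phi>. cc_homomorphism (iso_crossed_product \<alpha>) H \<phi> \<and>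
     (\<forall>x. \<phi> (crossed_embed \<alpha> x) = c00_hom H \<pi> V x))"

end

(*
  A dilation rho of (pi, V) on K contains H, and it must be shown that H reduces rho.
  A contraction which restricts to an isometry on H after compression maps H into H, and it
  preserves orthogonality to vectors on which it is isometric. Applied to the unitaries of A this
  shows that H reduces rho(A), because self-adjoint elements are limits of linear combinations of
  Cayley transforms. Applied to W = rho(1 (x) delta_p) it gives W = V_p on H, and W maps the
  complement of H into the complement of V_p H. Covariance identifies V_p V_p^* with
  pi(alpha_p(1)), and (1 - alpha_p(1)) (x) delta_p vanishes in the crossed product, so the
  component in H of a vector W y lies in V_p H; hence it is zero when y is orthogonal to H.

  That (pi, V) extends to the completion requires the matrix seminorms to dominate
  representations on spaces of every type: finitely many vectors generate a cyclic subspace, which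
  is isomorphic to a space of the universe over which the suprema are taken.
*)

theory Submission
  imports Defs "HOL-Analysis.L2_Norm"
begin

section \<open>Hilbert spaces\<close>

text \<open>The difficulty is one-sidedness. A dilation is a homomorphism of an algebra without
  involution, and possibly not unital, so invariance of H says nothing about its orthogonal
  complement; the two are obtained separately. For a contraction whose compression to H is
  isometric, orthogonality says only this: if y is orthogonal to H, the H-component of the image of
  y is orthogonal to the range of the compression. For a unitary that range is all of H and nothing
  is left over. For V_p it may be proper, and the possible leftover lies in the complement of V_p H
  in H. Right covariance only places V_p H inside the range of the projection
  \<open>\<pi> (\<alpha> p 1)\<close>; covariance makes them equal, so the leftover is cut out by an
  element of the algebra, for which H is already known to be reducing. On the analytic side, a real
  \<open>Sup\<close> is informative only for nonempty bounded sets. Hence the proof that star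
  representations are contractive, which bounds every seminorm by the norms of the coefficients
  uniformly over all representations.\<close>

lemma complex_ring_simps [simp]:
  "carrier complex_ring = UNIV" "add complex_ring = (+)" "mult complex_ring = (*)"
  "one complex_ring = 1" "zero complex_ring = 0"
  by (simp_all add: complex_ring_def)

lemma cring_complex_ring: "cring complex_ring"
proof (rule cringI)
  show "abelian_group complex_ring"
    by (rule abelian_groupI) (auto simp: algebra_simps intro: exI[of _ "- x" for x])
  show "Group.comm_monoid complex_ring"
    by (rule comm_monoidI) (auto simp: algebra_simps)
qed (auto simp: algebra_simps)

section \<open>Inner product calculus and norm convergence\<close>

context complex_hilbert_space
begin

lemma smult_closed' [simp, intro]: "x \<in> carrier H \<Longrightarrow> c \<odot> x \<in> carrier H"
  using smult_closed[of c x] by simp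

lemma smult_zero_left [simp]: "x \<in> carrier H \<Longrightarrow> 0 \<odot> x = \<zero>"
  using smult_l_null[of x] by simp

lemma smult_zero_right [simp]: "c \<odot> \<zero> = \<zero>"
  using smult_r_null[of c] by simp

lemma smult_one' [simp]: "x \<in> carrier H \<Longrightarrow> 1 \<odot> x = x"
  using smult_one[of x] by simp

lemma smult_add_left: "x \<in> carrier H \<Longrightarrow> (c + d) \<odot> x = c \<odot> x \<oplus> d \<odot> x"
  using smult_l_distr[of c d x] by simp

lemma smult_add_right: "x \<in> carrier H \<Longrightarrow> y \<in> carrier H \<Longrightarrow> c \<odot> (x \<oplus> y) = c \<odot> x \<oplus> c \<odot> y"
  using smult_r_distr[of c x y] by simp

lemma smult_smult: "x \<in> carrier H \<Longrightarrow> c \<odot> (d \<odot> x) = (c * d) \<odot> x"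
  using smult_assoc1[of c d x] by simp

lemma minus_eq_smult: "x \<in> carrier H \<Longrightarrow> \<ominus> x = (-1) \<odot> x"
  using smult_add_left[of x 1 "-1"] M.add.inv_unique'[of x "(-1) \<odot> x"] by (simp add: M.minus_equality M.a_comm)

lemma cinner_zero_left [simp]: "y \<in> carrier H \<Longrightarrow> cinner H \<zero> y = 0"
  using cinner_smult_left[of \<zero> y 0] by simp

lemma cinner_zero_right [simp]: "y \<in> carrier H \<Longrightarrow> cinner H y \<zero> = 0"
  using cinner_commute[of \<zero> y] by simp

lemma cinner_add_right: "\<lbrakk>x \<in> carrier H; y \<in> carrier H; z \<in> carrier H\<rbrakk> \<Longrightarrow>
    cinner H z (x \<oplus> y) = cinner H z x + cinner H z y"
  using cinner_commute[of "x \<oplus> y" z] cinner_commute[of x z] cinner_commute[of y z]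
  by (simp add: cinner_add_left)

lemma cinner_smult_right: "\<lbrakk>x \<in> carrier H; y \<in> carrier H\<rbrakk> \<Longrightarrow>
    cinner H y (c \<odot> x) = cnj c * cinner H y x"
  using cinner_commute[of "c \<odot> x" y] cinner_commute[of x y]
  by (simp add: cinner_smult_left)

lemma cinner_minus_left: "\<lbrakk>x \<in> carrier H; y \<in> carrier H\<rbrakk> \<Longrightarrow> cinner H (\<ominus> x) y = - cinner H x y"
  by (simp add: minus_eq_smult cinner_smult_left)

lemma cinner_minus_right: "\<lbrakk>x \<in> carrier H; y \<in> carrier H\<rbrakk> \<Longrightarrow> cinner H y (\<ominus> x) = - cinner H y x"
  by (simp add: minus_eq_smult cinner_smult_right)

lemma cinner_diff_left: "\<lbrakk>x \<in> carrier H; y \<in> carrier H; z \<in> carrier H\<rbrakk> \<Longrightarrow>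
    cinner H (x \<ominus> y) z = cinner H x z - cinner H y z"
  by (simp add: M.minus_eq cinner_add_left cinner_minus_left)

lemma cinner_diff_right: "\<lbrakk>x \<in> carrier H; y \<in> carrier H; z \<in> carrier H\<rbrakk> \<Longrightarrow>
    cinner H z (x \<ominus> y) = cinner H z x - cinner H z y"
  by (simp add: M.minus_eq cinner_add_right cinner_minus_right)

lemmas cinner_simps = cinner_add_left cinner_add_right cinner_smult_left cinner_smult_right
  cinner_minus_left cinner_minus_right cinner_diff_left cinner_diff_right

lemma diff_eq_zero_iff: "x \<in> carrier H \<Longrightarrow> y \<in> carrier H \<Longrightarrow> x \<ominus> y = \<zero> \<longleftrightarrow> x = y"
  by (metis M.a_assoc M.a_inv_closed M.l_neg M.l_zero M.minus_eq M.r_neg M.r_zero)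

lemma diff_self [simp]: "x \<in> carrier H \<Longrightarrow> x \<ominus> x = \<zero>"
  by (simp add: diff_eq_zero_iff)

text \<open>Nondegeneracy, tested at z = x \<ominus> y. It turns linear identities between vectors
  into identities of complex numbers, which \<open>cinner_simps\<close> and arithmetic settle; many
  vector equations below are proved in this way.\<close>

lemma vec_eqI:
  assumes "x \<in> carrier H" "y \<in> carrier H" "\<And>z. z \<in> carrier H \<Longrightarrow> cinner H x z = cinner H y z"
  shows "x = y"
proof -
  have "x \<ominus> y = \<zero>"
    by (rule cinner_eq_zero) (use assms in \<open>simp_all add: cinner_diff_left\<close>)
  then show ?thesis
    using assms by (simp add: diff_eq_zero_iff)
qed

lemma hnorm_ge_zero [simp]: "x \<in> carrier H \<Longrightarrow> 0 \<le> hnorm H x"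
  by (simp add: hnorm_def cinner_ge_zero)

lemma hnorm_square: "x \<in> carrier H \<Longrightarrow> (hnorm H x)\<^sup>2 = Re (cinner H x x)"
  by (simp add: hnorm_def cinner_ge_zero)

lemma cinner_self: "x \<in> carrier H \<Longrightarrow> cinner H x x = complex_of_real ((hnorm H x)\<^sup>2)"
  using cinner_commute[of x x] by (simp add: hnorm_square complex_eq_iff)

lemma hnorm_eq_zero [simp]: "x \<in> carrier H \<Longrightarrow> hnorm H x = 0 \<longleftrightarrow> x = \<zero>"
  using cinner_self[of x] cinner_eq_zero[of x] by (auto simp: hnorm_def)

lemma hnorm_zero [simp]: "hnorm H \<zero> = 0"
  by simp

lemma hnorm_smult: "x \<in> carrier H \<Longrightarrow> hnorm H (c \<odot> x) = cmod c * hnorm H x"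
proof -
  assume x: "x \<in> carrier H"
  have "complex_of_real ((hnorm H (c \<odot> x))\<^sup>2) = cinner H (c \<odot> x) (c \<odot> x)"
    using x by (intro cinner_self[symmetric]) simp
  also have "\<dots> = c * cnj c * complex_of_real ((hnorm H x)\<^sup>2)"
    using x by (simp add: cinner_smult_left cinner_smult_right cinner_self[of x])
  also have "\<dots> = complex_of_real ((cmod c * hnorm H x)\<^sup>2)"
    by (simp only: power_mult_distrib of_real_mult complex_norm_square)
  finally have "complex_of_real ((hnorm H (c \<odot> x))\<^sup>2) = complex_of_real ((cmod c * hnorm H x)\<^sup>2)" .
  then have "(hnorm H (c \<odot> x))\<^sup>2 = (cmod c * hnorm H x)\<^sup>2"
    by (simp only: of_real_eq_iff)
  then show ?thesis
    by (rule power2_eq_imp_eq) (simp_all add: x)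
qed

lemma Cauchy_Schwarz:
  assumes x: "x \<in> carrier H" and y: "y \<in> carrier H"
  shows "cmod (cinner H x y) \<le> hnorm H x * hnorm H y"
proof (cases "y = \<zero>")
  case False
  define n where "n = (hnorm H y)\<^sup>2"
  have n: "n > 0" using False y by (simp add: n_def)
  \<comment> \<open>The coefficient of the projection of x onto y:
    \<open>x \<ominus> c \<odot> y\<close> is the part of x orthogonal to y. Nonnegativity of its
    square norm, multiplied by \<open>n\<close>, is the squared claim.\<close>
  define c where "c = cinner H x y / n"
  define m where "m = (cmod (cinner H x y))\<^sup>2"
  have yx: "cinner H y x = cnj (cinner H x y)" using x y by (rule cinner_commute)
  have mm: "cnj c * cinner H x y = complex_of_real (m / n)" "c * cnj (cinner H x y) = complex_of_real (m / n)"
    "c * cnj c * complex_of_real n = complex_of_real (m / n)"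
    using n complex_norm_square[of "cinner H x y"] by (simp_all add: c_def m_def mult.commute)
  have "cinner H (x \<ominus> c \<odot> y) (x \<ominus> c \<odot> y) =
      complex_of_real ((hnorm H x)\<^sup>2) - cnj c * cinner H x y - c * cnj (cinner H x y) + c * cnj c * complex_of_real n"
    using x y by (simp add: cinner_simps yx cinner_self[of x] cinner_self[of y] n_def algebra_simps)
  also have "Re \<dots> = (hnorm H x)\<^sup>2 - m / n"
    unfolding mm by simp
  finally have "0 \<le> (hnorm H x)\<^sup>2 - m / n"
    using x y cinner_ge_zero[of "x \<ominus> c \<odot> y"] by simp
  then have "m \<le> (hnorm H x)\<^sup>2 * n"
    using n by (simp add: field_simps)
  then have "(cmod (cinner H x y))\<^sup>2 \<le> (hnorm H x * hnorm H y)\<^sup>2"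
    by (simp add: m_def n_def power_mult_distrib)
  then show ?thesis
    using x y by (auto intro: power2_le_imp_le)
qed (use x in simp)

lemma hnorm_add_square: "x \<in> carrier H \<Longrightarrow> y \<in> carrier H \<Longrightarrow>
    (hnorm H (x \<oplus> y))\<^sup>2 = (hnorm H x)\<^sup>2 + (hnorm H y)\<^sup>2 + 2 * Re (cinner H x y)"
  using cinner_commute[of x y] by (simp add: hnorm_square cinner_simps)

lemma hnorm_triangle:
  assumes x: "x \<in> carrier H" and y: "y \<in> carrier H"
  shows "hnorm H (x \<oplus> y) \<le> hnorm H x + hnorm H y"
proof (rule power2_le_imp_le)
  show "(hnorm H (x \<oplus> y))\<^sup>2 \<le> (hnorm H x + hnorm H y)\<^sup>2"
    using Cauchy_Schwarz[OF x y] complex_Re_le_cmod[of "cinner H x y"]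
    by (simp add: hnorm_add_square x y power2_sum)
  show "0 \<le> hnorm H x + hnorm H y"
    using x y by (intro add_nonneg_nonneg hnorm_ge_zero)
qed

lemma hnorm_minus: "x \<in> carrier H \<Longrightarrow> hnorm H (\<ominus> x) = hnorm H x"
  by (simp add: minus_eq_smult hnorm_smult)

lemma hnorm_diff_commute: "x \<in> carrier H \<Longrightarrow> y \<in> carrier H \<Longrightarrow> hnorm H (x \<ominus> y) = hnorm H (y \<ominus> x)"
  by (simp add: hnorm_def cinner_simps algebra_simps)

lemma hnorm_diff_triangle:
  assumes "x \<in> carrier H" "y \<in> carrier H" "z \<in> carrier H"
  shows "hnorm H (x \<ominus> z) \<le> hnorm H (x \<ominus> y) + hnorm H (y \<ominus> z)"
proof -
  have "x \<ominus> z = (x \<ominus> y) \<oplus> (y \<ominus> z)"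
    by (rule vec_eqI) (use assms in \<open>simp_all add: cinner_simps\<close>)
  then show ?thesis
    using hnorm_triangle[of "x \<ominus> y" "y \<ominus> z"] assms by simp
qed

lemma hnorm_le_diff:
  assumes "x \<in> carrier H" "y \<in> carrier H"
  shows "hnorm H x \<le> hnorm H y + hnorm H (x \<ominus> y)"
proof -
  have "x = y \<oplus> (x \<ominus> y)"
    by (rule vec_eqI) (use assms in \<open>simp_all add: cinner_simps\<close>)
  then show ?thesis
    using hnorm_triangle[of y "x \<ominus> y"] assms by simp
qed

lemma hnorm_finsum:
  assumes "finite A" "\<And>i. i \<in> A \<Longrightarrow> f i \<in> carrier H"
  shows "hnorm H (\<Oplus>i\<in>A. f i) \<le> (\<Sum>i\<in>A. hnorm H (f i))"
  using assms
proof (induction A rule: finite_induct)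
  case (insert i A)
  then show ?case
    using hnorm_triangle[of "f i" "\<Oplus>i\<in>A. f i"] by (fastforce simp: Pi_def)
qed simp

text \<open>Membership in the carrier is part of the notion, since off the carrier the operations
  mean nothing; every limit thus brings the closure facts needed to calculate with it.\<close>

definition converges_to :: "(nat \<Rightarrow> 'h) \<Rightarrow> 'h \<Rightarrow> bool" where
  "converges_to f x \<longleftrightarrow> (\<forall>k. f k \<in> carrier H) \<and> x \<in> carrier H \<and> (\<lambda>k. hnorm H (f k \<ominus> x)) \<longlonglongrightarrow> 0"

lemma converges_to_const: "x \<in> carrier H \<Longrightarrow> converges_to (\<lambda>_. x) x"
  by (simp add: converges_to_def diff_eq_zero_iff)

lemma converges_toI:
  assumes "\<And>k. f k \<in> carrier H" "x \<in> carrier H" "\<And>k. hnorm H (f k \<ominus> x) \<le> e k" "e \<longlonglongrightarrow> 0"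
  shows "converges_to f x"
  unfolding converges_to_def
  using assms by (auto intro!: tendsto_sandwich[OF _ _ tendsto_const \<open>e \<longlonglongrightarrow> 0\<close>] always_eventually)

lemma converges_to_unique:
  assumes "converges_to f x" "converges_to f y"
  shows "x = y"
proof -
  have c: "\<And>k. f k \<in> carrier H" "x \<in> carrier H" "y \<in> carrier H"
    using assms by (auto simp: converges_to_def)
  have "(\<lambda>k. hnorm H (f k \<ominus> x) + hnorm H (f k \<ominus> y)) \<longlonglongrightarrow> 0 + 0"
    using assms unfolding converges_to_def by (intro tendsto_add) auto
  moreover have "hnorm H (x \<ominus> y) \<le> hnorm H (f k \<ominus> x) + hnorm H (f k \<ominus> y)" for k
    using hnorm_diff_triangle[of x "f k" y] c by (simp add: hnorm_diff_commute)
  ultimately have "hnorm H (x \<ominus> y) \<le> 0"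
    using LIMSEQ_le_const[of _ 0 "hnorm H (x \<ominus> y)"] by auto
  then have "hnorm H (x \<ominus> y) = 0"
    using c by (intro antisym) auto
  then show ?thesis
    using c by (simp add: diff_eq_zero_iff)
qed

lemma converges_to_add:
  assumes "converges_to f x" "converges_to g y"
  shows "converges_to (\<lambda>k. f k \<oplus> g k) (x \<oplus> y)"
proof (rule converges_toI)
  have c: "\<And>k. f k \<in> carrier H" "\<And>k. g k \<in> carrier H" "x \<in> carrier H" "y \<in> carrier H"
    using assms by (auto simp: converges_to_def)
  then show "\<And>k. f k \<oplus> g k \<in> carrier H" "x \<oplus> y \<in> carrier H" by auto
  show "hnorm H (f k \<oplus> g k \<ominus> (x \<oplus> y)) \<le> hnorm H (f k \<ominus> x) + hnorm H (g k \<ominus> y)" for k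
  proof -
    have "f k \<oplus> g k \<ominus> (x \<oplus> y) = (f k \<ominus> x) \<oplus> (g k \<ominus> y)"
      by (rule vec_eqI) (use c in \<open>simp_all add: cinner_simps\<close>)
    then show ?thesis
      using hnorm_triangle[of "f k \<ominus> x" "g k \<ominus> y"] c by simp
  qed
  show "(\<lambda>k. hnorm H (f k \<ominus> x) + hnorm H (g k \<ominus> y)) \<longlonglongrightarrow> 0"
    using assms unfolding converges_to_def by (auto intro!: tendsto_add_zero)
qed

lemma converges_to_smult:
  assumes "converges_to f x"
  shows "converges_to (\<lambda>k. c \<odot> f k) (c \<odot> x)"
proof (rule converges_toI)
  have c: "\<And>k. f k \<in> carrier H" "x \<in> carrier H"
    using assms by (auto simp: converges_to_def)
  then show "\<And>k. c \<odot> f k \<in> carrier H" "c \<odot> x \<in> carrier H" by auto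
  show "hnorm H (c \<odot> f k \<ominus> c \<odot> x) \<le> cmod c * hnorm H (f k \<ominus> x)" for k
  proof -
    have "c \<odot> f k \<ominus> c \<odot> x = c \<odot> (f k \<ominus> x)"
      by (rule vec_eqI) (use c in \<open>simp_all add: cinner_simps algebra_simps\<close>)
    then show ?thesis
      using c by (simp add: hnorm_smult)
  qed
  show "(\<lambda>k. cmod c * hnorm H (f k \<ominus> x)) \<longlonglongrightarrow> 0"
    using assms unfolding converges_to_def by (auto intro!: tendsto_mult_right_zero)
qed

lemma converges_to_cinner:
  assumes f: "converges_to f x" and y: "y \<in> carrier H"
  shows "(\<lambda>k. cinner H (f k) y) \<longlonglongrightarrow> cinner H x y"
proof (rule metric_tendsto_imp_tendsto[of "\<lambda>k. hnorm H (f k \<ominus> x) * hnorm H y" 0])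
  have c: "\<And>k. f k \<in> carrier H" "x \<in> carrier H"
    using f by (auto simp: converges_to_def)
  show "(\<lambda>k. hnorm H (f k \<ominus> x) * hnorm H y) \<longlonglongrightarrow> 0"
    using f unfolding converges_to_def by (auto intro!: tendsto_mult_left_zero)
  show "\<forall>\<^sub>F k in sequentially. dist (cinner H (f k) y) (cinner H x y)
      \<le> dist (hnorm H (f k \<ominus> x) * hnorm H y) 0"
    using Cauchy_Schwarz[of "f k \<ominus> x" y for k] c y
    by (auto intro!: always_eventually simp: dist_norm cinner_simps)
qed

lemma converges_to_hnorm:
  assumes f: "converges_to f x"
  shows "(\<lambda>k. hnorm H (f k)) \<longlonglongrightarrow> hnorm H x"
proof (rule metric_tendsto_imp_tendsto[of "\<lambda>k. hnorm H (f k \<ominus> x)" 0])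
  have c: "\<And>k. f k \<in> carrier H" "x \<in> carrier H"
    using f by (auto simp: converges_to_def)
  show "(\<lambda>k. hnorm H (f k \<ominus> x)) \<longlonglongrightarrow> 0"
    using f unfolding converges_to_def by auto
  have "\<bar>hnorm H (f k) - hnorm H x\<bar> \<le> hnorm H (f k \<ominus> x)" for k
    using hnorm_le_diff[of "f k" x] hnorm_le_diff[of x "f k"] c hnorm_diff_commute[of "f k" x]
    by (simp add: abs_le_iff)
  then show "\<forall>\<^sub>F k in sequentially. dist (hnorm H (f k)) (hnorm H x) \<le> dist (hnorm H (f k \<ominus> x)) 0"
    using c by (auto intro!: always_eventually simp: dist_norm)
qed

lemma Cauchy_converges_to:
  assumes "\<And>k. f k \<in> carrier H" "\<And>e. e > 0 \<Longrightarrow> \<exists>N. \<forall>k\<ge>N. \<forall>l\<ge>N. hnorm H (f k \<ominus> f l) < e"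
  obtains x where "converges_to f x"
  using complete[of f] assms unfolding converges_to_def by blast

end

text \<open>Near 0 a quadratic term cannot compensate a linear one. With c = -t * cnj d the form
  equals t * |d|^2 * (t * N - 2), and t = 1 / (N + 1) gives t * N < 1 and hence a negative value
  unless d = 0. The lemma plays the part of a first-order condition at a minimum.\<close>

lemma quadratic_form_zero:
  fixes d :: complex
  assumes N: "N \<ge> 0" and q: "\<And>c. 0 \<le> 2 * Re (c * d) + (cmod c)\<^sup>2 * N"
  shows "d = 0"
proof (rule ccontr)
  assume "d \<noteq> 0"
  define t where "t = 1 / (N + 1)"
  have t: "t > 0" "t * N < 1"
    using N by (auto simp: t_def field_simps)
  have "0 \<le> 2 * Re (- (t * cnj d) * d) + (cmod (- (t * cnj d)))\<^sup>2 * N"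
    using q .
  also have "Re (- (t * cnj d) * d) = - t * (cmod d)\<^sup>2"
    by (simp add: cmod_power2) (simp add: power2_eq_square algebra_simps)
  also have "(cmod (- (t * cnj d)))\<^sup>2 = t\<^sup>2 * (cmod d)\<^sup>2"
    using t by (simp add: norm_mult power_mult_distrib)
  finally have "0 \<le> t * (cmod d)\<^sup>2 * (t * N - 2)"
    by (simp add: algebra_simps power2_eq_square)
  moreover have "t * (cmod d)\<^sup>2 * (t * N - 2) < 0"
    using t \<open>d \<noteq> 0\<close> by (intro mult_pos_neg) auto
  ultimately show False by simp
qed

context complex_hilbert_space
begin

lemma hnorm_add_smult_square: "x \<in> carrier H \<Longrightarrow> y \<in> carrier H \<Longrightarrow>
    (hnorm H (x \<oplus> c \<odot> y))\<^sup>2 = (hnorm H x)\<^sup>2 + 2 * Re (c * cinner H y x) + (cmod c)\<^sup>2 * (hnorm H y)\<^sup>2"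
  using cinner_commute[of "c \<odot> y" x]
  by (simp add: hnorm_add_square hnorm_smult cinner_smult_left power_mult_distrib)

lemma hnorm_diff_square: "x \<in> carrier H \<Longrightarrow> y \<in> carrier H \<Longrightarrow>
    (hnorm H (x \<ominus> y))\<^sup>2 = (hnorm H x)\<^sup>2 + (hnorm H y)\<^sup>2 - 2 * Re (cinner H x y)"
  by (simp add: M.minus_eq hnorm_add_square hnorm_minus cinner_minus_right)

text \<open>If z represents f, then \<open>G x\<close> is ||x - z||^2 - ||z||^2, so z has to be the
  minimiser of \<open>G\<close>. The parallelogram law makes a minimising sequence Cauchy, and the
  first variation at its limit vanishes, which is the representation formula.\<close>

lemma Riesz:
  assumes f_add: "\<And>x y. x \<in> carrier H \<Longrightarrow> y \<in> carrier H \<Longrightarrow> f (x \<oplus> y) = f x + f y"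
    and f_smult: "\<And>c x. x \<in> carrier H \<Longrightarrow> f (c \<odot> x) = c * f x"
    and f_bound: "\<And>x. x \<in> carrier H \<Longrightarrow> cmod (f x) \<le> C * hnorm H x"
  obtains z where "z \<in> carrier H" "\<And>x. x \<in> carrier H \<Longrightarrow> f x = cinner H x z"
proof -
  define G where "G x = (hnorm H x)\<^sup>2 - 2 * Re (f x)" for x
  define m where "m = Inf (G ` carrier H)"
  have lower: "- C\<^sup>2 \<le> G x" if "x \<in> carrier H" for x
  proof -
    have "Re (f x) \<le> C * hnorm H x"
      using f_bound[OF that] complex_Re_le_cmod[of "f x"] by linarith
    moreover have "0 \<le> (hnorm H x - C)\<^sup>2" by simp
    ultimately show ?thesis
      by (simp add: G_def power2_diff mult.commute)
  qed
  then have bdd: "bdd_below (G ` carrier H)"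
    by (auto simp: bdd_below_def)
  have m_le: "m \<le> G x" if "x \<in> carrier H" for x
    unfolding m_def using bdd that by (simp add: cInf_lower)
  have "\<exists>x. x \<in> carrier H \<and> G x < m + inverse (real (Suc k))" for k
  proof -
    have "G ` carrier H \<noteq> {}" by auto
    then have "\<exists>v\<in>G ` carrier H. v < m + inverse (real (Suc k))"
      using cInf_less_iff[OF _ bdd, of "m + inverse (real (Suc k))"] m_def by simp
    then show ?thesis by auto
  qed
  then obtain x where x: "\<And>k. x k \<in> carrier H" "\<And>k. G (x k) < m + inverse (real (Suc k))"
    by metis
  \<comment> \<open>The midpoint of y and z has \<open>G\<close>-value at least m; by the
    parallelogram law this bounds the distance of y and z in terms of their excesses over m.\<close>
  have gap: "(hnorm H (y \<ominus> z))\<^sup>2 \<le> 2 * (G y - m) + 2 * (G z - m)"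
    if yz: "y \<in> carrier H" "z \<in> carrier H" for y z
  proof -
    have "4 * m \<le> 4 * G ((1/2) \<odot> (y \<oplus> z))"
      using m_le yz by simp
    also have "\<dots> = 2 * G y + 2 * G z - (hnorm H (y \<ominus> z))\<^sup>2"
      using yz by (simp add: G_def f_add f_smult hnorm_add_square hnorm_diff_square hnorm_smult power_divide)
          (simp add: field_simps)
    finally show ?thesis by simp
  qed
  have "\<exists>N. \<forall>k\<ge>N. \<forall>l\<ge>N. hnorm H (x k \<ominus> x l) < e" if e: "e > 0" for e
  proof -
    obtain N where N: "inverse (real (Suc N)) < e\<^sup>2 / 4"
      using reals_Archimedean[of "e\<^sup>2 / 4"] e by auto
    have "hnorm H (x k \<ominus> x l) < e" if "k \<ge> N" "l \<ge> N" for k l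
    proof (rule power2_less_imp_less)
      have "inverse (real (Suc k)) \<le> inverse (real (Suc N))" "inverse (real (Suc l)) \<le> inverse (real (Suc N))"
        using that by (auto intro: le_imp_inverse_le)
      then show "(hnorm H (x k \<ominus> x l))\<^sup>2 < e\<^sup>2"
        using gap[OF x(1)[of k] x(1)[of l]] x(2)[of k] x(2)[of l] N
        by (simp only: less_divide_eq_numeral1) argo
    qed (use e in simp)
    then show ?thesis by blast
  qed
  then obtain z where lim: "converges_to x z"
    using Cauchy_converges_to[of x] x(1) by blast
  then have z: "z \<in> carrier H" by (simp add: converges_to_def)
  have f_diff: "f (a \<ominus> b) = f a - f b" if "a \<in> carrier H" "b \<in> carrier H" for a b
    using f_add[of a "\<ominus> b"] f_smult[of b "-1"] that by (simp add: M.minus_eq minus_eq_smult)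
  have "(\<lambda>k. f (x k)) \<longlonglongrightarrow> f z"
  proof (rule metric_tendsto_imp_tendsto[of "\<lambda>k. C * hnorm H (x k \<ominus> z)" 0])
    show "(\<lambda>k. C * hnorm H (x k \<ominus> z)) \<longlonglongrightarrow> 0"
      using lim unfolding converges_to_def by (auto intro!: tendsto_mult_right_zero)
    have "cmod (f (x k) - f z) \<le> C * hnorm H (x k \<ominus> z)" for k
      using f_bound[of "x k \<ominus> z"] x(1)[of k] z by (simp add: f_diff)
    then show "\<forall>\<^sub>F k in sequentially. dist (f (x k)) (f z) \<le> dist (C * hnorm H (x k \<ominus> z)) 0"
      by (intro always_eventually) (simp add: dist_norm order_trans[OF _ abs_ge_self])
  qed
  then have "(\<lambda>k. G (x k)) \<longlonglongrightarrow> G z"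
    unfolding G_def by (intro tendsto_intros converges_to_hnorm lim)
  moreover have "(\<lambda>k. m + inverse (real (Suc k))) \<longlonglongrightarrow> m + 0"
    by (intro tendsto_intros LIMSEQ_inverse_real_of_nat)
  ultimately have "G z \<le> m"
    using LIMSEQ_le[of "\<lambda>k. G (x k)" "G z" "\<lambda>k. m + inverse (real (Suc k))" "m + 0"] x(2)
    by (force intro: less_imp_le)
  \<comment> \<open>First variation of \<open>G\<close> at the minimiser in direction y: the
    coefficient of c is \<open>cinner H y z - f y\<close>.\<close>
  have "f y = cinner H y z" if y: "y \<in> carrier H" for y
  proof -
    have "cinner H y z - f y = 0"
    proof (rule quadratic_form_zero)
      show "0 \<le> (hnorm H y)\<^sup>2" by simp
      show "0 \<le> 2 * Re (c * (cinner H y z - f y)) + (cmod c)\<^sup>2 * (hnorm H y)\<^sup>2" for c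
        using m_le[of "z \<oplus> c \<odot> y"] \<open>G z \<le> m\<close> y z
        by (simp add: G_def hnorm_add_smult_square f_add f_smult algebra_simps)
    qed
    then show ?thesis by simp
  qed
  then show thesis using that z by blast
qed

end

text \<open>Stated for a bare additive map, so that it covers bounded operators, multiplication by a
  scalar and the embeddings of subspaces alike.\<close>

lemma finsum_additive:
  assumes "complex_hilbert_space H" "complex_hilbert_space K"
    and "\<And>x. x \<in> carrier H \<Longrightarrow> g x \<in> carrier K"
    and "\<And>x y. x \<in> carrier H \<Longrightarrow> y \<in> carrier H \<Longrightarrow> g (x \<oplus>\<^bsub>H\<^esub> y) = g x \<oplus>\<^bsub>K\<^esub> g y"
    and g0: "g \<zero>\<^bsub>H\<^esub> = \<zero>\<^bsub>K\<^esub>"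
    and "finite A" "\<And>i. i \<in> A \<Longrightarrow> f i \<in> carrier H"
  shows "g (finsum H f A) = finsum K (\<lambda>i. g (f i)) A"
proof -
  interpret H: complex_hilbert_space H by fact
  interpret K: complex_hilbert_space K by fact
  from \<open>finite A\<close> show ?thesis
    using assms(7)
  proof (induction A rule: finite_induct)
    case empty
    then show ?case using g0 by simp
  next
    case (insert i A)
    then have "finsum H f (insert i A) = f i \<oplus>\<^bsub>H\<^esub> finsum H f A"
      by (intro H.M.finsum_insert) auto
    moreover have "finsum K (\<lambda>i. g (f i)) (insert i A) = g (f i) \<oplus>\<^bsub>K\<^esub> finsum K (\<lambda>i. g (f i)) A"
      using insert assms(3) by (intro K.M.finsum_insert) auto
    moreover have "finsum H f A \<in> carrier H"
      using insert by (intro H.M.finsum_closed) auto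
    ultimately show ?case
      using insert assms(4) by simp
  qed
qed

subsection \<open>Bounded operators\<close>

lemma bounded_operators_closed:
  "T \<in> bounded_operators H K \<Longrightarrow> x \<in> carrier H \<Longrightarrow> T x \<in> carrier K"
  by (auto simp: bounded_operators_def)

lemma bounded_operators_add:
  "\<lbrakk>T \<in> bounded_operators H K; x \<in> carrier H; y \<in> carrier H\<rbrakk> \<Longrightarrow> T (x \<oplus>\<^bsub>H\<^esub> y) = T x \<oplus>\<^bsub>K\<^esub> T y"
  by (auto simp: bounded_operators_def)

lemma bounded_operators_smult:
  "\<lbrakk>T \<in> bounded_operators H K; x \<in> carrier H\<rbrakk> \<Longrightarrow> T (c \<odot>\<^bsub>H\<^esub> x) = c \<odot>\<^bsub>K\<^esub> T x"
  by (auto simp: bounded_operators_def)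

lemma bounded_operators_bound:
  assumes "complex_hilbert_space H" "T \<in> bounded_operators H K"
  obtains C where "C \<ge> 0" "\<And>x. x \<in> carrier H \<Longrightarrow> hnorm K (T x) \<le> C * hnorm H x"
proof -
  interpret complex_hilbert_space H by fact
  obtain C where C: "\<forall>x\<in>carrier H. hnorm K (T x) \<le> C * hnorm H x"
    using assms by (auto simp: bounded_operators_def)
  show thesis
  proof (rule that[of "\<bar>C\<bar>"])
    fix x assume x: "x \<in> carrier H"
    then have "C * hnorm H x \<le> \<bar>C\<bar> * hnorm H x"
      by (intro mult_right_mono) auto
    then show "hnorm K (T x) \<le> \<bar>C\<bar> * hnorm H x"
      using C x by force
  qed simp
qed

lemma bounded_operatorsI:
  assumes "T \<in> extensional (carrier H)"
    and "\<And>x. x \<in> carrier H \<Longrightarrow> T x \<in> carrier K"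
    and "\<And>x y. x \<in> carrier H \<Longrightarrow> y \<in> carrier H \<Longrightarrow> T (x \<oplus>\<^bsub>H\<^esub> y) = T x \<oplus>\<^bsub>K\<^esub> T y"
    and "\<And>c x. x \<in> carrier H \<Longrightarrow> T (c \<odot>\<^bsub>H\<^esub> x) = c \<odot>\<^bsub>K\<^esub> T x"
    and "\<And>x. x \<in> carrier H \<Longrightarrow> hnorm K (T x) \<le> C * hnorm H x"
  shows "T \<in> bounded_operators H K"
  using assms unfolding bounded_operators_def PiE_def by blast

lemma bounded_operators_eqI:
  assumes "T \<in> bounded_operators H K" "S \<in> bounded_operators H K" "\<And>x. x \<in> carrier H \<Longrightarrow> T x = S x"
  shows "T = S"
  using assms unfolding bounded_operators_def PiE_def by (auto intro: extensionalityI)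

lemma bounded_operators_extensional:
  "T \<in> bounded_operators H K \<Longrightarrow> T \<in> extensional (carrier H)"
  by (auto simp: bounded_operators_def PiE_def)

lemma bounded_operators_zero:
  assumes "complex_hilbert_space H" "complex_hilbert_space K" "T \<in> bounded_operators H K"
  shows "T \<zero>\<^bsub>H\<^esub> = \<zero>\<^bsub>K\<^esub>"
proof -
  interpret H: complex_hilbert_space H by fact
  interpret K: complex_hilbert_space K by fact
  have "T \<zero>\<^bsub>H\<^esub> = T (0 \<odot>\<^bsub>H\<^esub> \<zero>\<^bsub>H\<^esub>)" by simp
  also have "\<dots> = 0 \<odot>\<^bsub>K\<^esub> T \<zero>\<^bsub>H\<^esub>"
    using assms(3) by (intro bounded_operators_smult) auto
  also have "\<dots> = \<zero>\<^bsub>K\<^esub>"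
    using bounded_operators_closed[OF assms(3)] by simp
  finally show ?thesis .
qed

lemma bounded_operators_diff:
  assumes "complex_hilbert_space H" "complex_hilbert_space K" "T \<in> bounded_operators H K"
    and "x \<in> carrier H" "y \<in> carrier H"
  shows "T (x \<ominus>\<^bsub>H\<^esub> y) = T x \<ominus>\<^bsub>K\<^esub> T y"
proof -
  interpret H: complex_hilbert_space H by fact
  interpret K: complex_hilbert_space K by fact
  note T = assms(3) and c = bounded_operators_closed[OF assms(3)]
  have "T (x \<ominus>\<^bsub>H\<^esub> y) = T (x \<oplus>\<^bsub>H\<^esub> (-1) \<odot>\<^bsub>H\<^esub> y)"
    by (simp only: H.M.minus_eq H.minus_eq_smult assms(5))
  also have "\<dots> = T x \<oplus>\<^bsub>K\<^esub> (-1) \<odot>\<^bsub>K\<^esub> T y"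
    using assms(4,5) by (simp only: bounded_operators_add[OF T] bounded_operators_smult[OF T] H.smult_closed')
  also have "\<dots> = T x \<ominus>\<^bsub>K\<^esub> T y"
    by (simp only: K.M.minus_eq K.minus_eq_smult c assms(5))
  finally show ?thesis .
qed

lemma bounded_operators_finsum:
  assumes "complex_hilbert_space H" "complex_hilbert_space K" "T \<in> bounded_operators H K"
    and "finite A" "\<And>i. i \<in> A \<Longrightarrow> f i \<in> carrier H"
  shows "T (finsum H f A) = finsum K (\<lambda>i. T (f i)) A"
  using assms(4,5)
  by (intro finsum_additive[OF assms(1,2) bounded_operators_closed[OF assms(3)]
        bounded_operators_add[OF assms(3)] bounded_operators_zero[OF assms(1-3)]]) auto

lemma bounded_operators_compose:
  assumes "complex_hilbert_space H" "complex_hilbert_space K" "complex_hilbert_space L"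
    and T: "T \<in> bounded_operators K L" and S: "S \<in> bounded_operators H K"
  shows "compose (carrier H) T S \<in> bounded_operators H L"
proof -
  obtain C where C: "C \<ge> 0" "\<And>x. x \<in> carrier K \<Longrightarrow> hnorm L (T x) \<le> C * hnorm K x"
    using bounded_operators_bound[OF assms(2) T] by blast
  obtain D where D: "D \<ge> 0" "\<And>x. x \<in> carrier H \<Longrightarrow> hnorm K (S x) \<le> D * hnorm H x"
    using bounded_operators_bound[OF assms(1) S] by blast
  interpret H: complex_hilbert_space H by fact
  note cl = bounded_operators_closed[OF S] bounded_operators_closed[OF T]
  show ?thesis
  proof (rule bounded_operatorsI[where C = "C * D"])
    fix x assume x: "x \<in> carrier H"
    have "hnorm L (T (S x)) \<le> C * hnorm K (S x)" using C(2) cl x by blast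
    also have "\<dots> \<le> C * (D * hnorm H x)" using C(1) D(2)[OF x] by (rule mult_left_mono[rotated])
    finally show "hnorm L (compose (carrier H) T S x) \<le> C * D * hnorm H x"
      using x by (simp add: compose_eq mult.assoc)
  qed (use cl in \<open>auto simp: compose_eq bounded_operators_add[OF S] bounded_operators_add[OF T]
        bounded_operators_smult[OF S] bounded_operators_smult[OF T]\<close>)
qed

lemma bounded_operators_converges_to:
  assumes "complex_hilbert_space H" "complex_hilbert_space K" "T \<in> bounded_operators H K"
    and "complex_hilbert_space.converges_to H f x"
  shows "complex_hilbert_space.converges_to K (\<lambda>k. T (f k)) (T x)"
proof -
  interpret H: complex_hilbert_space H by fact
  interpret K: complex_hilbert_space K by fact
  have c: "\<And>k. f k \<in> carrier H" "x \<in> carrier H" and lim: "(\<lambda>k. hnorm H (f k \<ominus>\<^bsub>H\<^esub> x)) \<longlonglongrightarrow> 0"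
    using assms(4) by (auto simp: H.converges_to_def)
  obtain C where C: "\<And>x. x \<in> carrier H \<Longrightarrow> hnorm K (T x) \<le> C * hnorm H x"
    using bounded_operators_bound[OF assms(1,3)] by blast
  show ?thesis
  proof (rule K.converges_toI)
    show "(\<lambda>k. C * hnorm H (f k \<ominus>\<^bsub>H\<^esub> x)) \<longlonglongrightarrow> 0"
      using lim by (rule tendsto_mult_right_zero)
    show "hnorm K (T (f k) \<ominus>\<^bsub>K\<^esub> T x) \<le> C * hnorm H (f k \<ominus>\<^bsub>H\<^esub> x)" for k
      using C[of "f k \<ominus>\<^bsub>H\<^esub> x"] c bounded_operators_diff[OF assms(1-3)] by simp
  qed (use c bounded_operators_closed[OF assms(3)] in auto)
qed

text \<open>Evaluates the definite description in \<open>adjoint\<close>: two candidates have the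
  same inner products with every vector, so uniqueness is nondegeneracy.\<close>

lemma adjoint_eqI:
  assumes "complex_hilbert_space H" "complex_hilbert_space K" 
    and S: "S \<in> bounded_operators K H" and T: "T \<in> carrier H \<rightarrow> carrier K"
    and adj: "\<And>x y. x \<in> carrier H \<Longrightarrow> y \<in> carrier K \<Longrightarrow> cinner K (T x) y = cinner H x (S y)"
  shows "adjoint H K T = S"
  unfolding adjoint_def
proof (rule the_equality)
  interpret H: complex_hilbert_space H by fact
  fix S' assume S': "S' \<in> bounded_operators K H \<and>
    (\<forall>x\<in>carrier H. \<forall>y\<in>carrier K. cinner K (T x) y = cinner H x (S' y))"
  show "S' = S"
  proof (rule bounded_operators_eqI)
    fix y assume y: "y \<in> carrier K"
    note cl = bounded_operators_closed[OF S y] bounded_operators_closed[of S' K H, OF _ y]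
    show "S' y = S y"
    proof (rule H.vec_eqI)
      show "cinner H (S' y) z = cinner H (S y) z" if "z \<in> carrier H" for z
        using that S' adj[of z y] y cl H.cinner_commute[of z "S' y"] H.cinner_commute[of z "S y"] by auto
    qed (use cl S' in auto)
  qed (use S S' in auto)
qed (use assms in auto)

text \<open>The value at y is the Riesz vector of the functional sending x to
  \<open>cinner K (T x) y\<close>. Linearity in y follows by testing against all vectors, and the
  bound of T carries over by taking x = S y and cancelling one factor ||S y||.\<close>

lemma adjoint_exists:
  assumes "complex_hilbert_space H" "complex_hilbert_space K" and T: "T \<in> bounded_operators H K"
  obtains S where "S \<in> bounded_operators K H"
    "\<And>x y. x \<in> carrier H \<Longrightarrow> y \<in> carrier K \<Longrightarrow> cinner K (T x) y = cinner H x (S y)"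
proof -
  interpret H: complex_hilbert_space H by fact
  interpret K: complex_hilbert_space K by fact
  note cl = bounded_operators_closed[OF T]
  obtain C where C: "C \<ge> 0" "\<And>x. x \<in> carrier H \<Longrightarrow> hnorm K (T x) \<le> C * hnorm H x"
    using bounded_operators_bound[OF assms(1) T] by blast
  have CS: "cmod (cinner K (T x) y) \<le> C * hnorm K y * hnorm H x" if "x \<in> carrier H" "y \<in> carrier K" for x y
  proof -
    have "cmod (cinner K (T x) y) \<le> hnorm K (T x) * hnorm K y"
      using that cl by (intro K.Cauchy_Schwarz) auto
    also have "\<dots> \<le> C * hnorm H x * hnorm K y"
      using C that by (intro mult_right_mono) auto
    finally show ?thesis by (simp add: mult_ac)
  qed
  have "\<exists>z\<in>carrier H. \<forall>x\<in>carrier H. cinner K (T x) y = cinner H x z" if y: "y \<in> carrier K" for y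
    by (rule H.Riesz[of "\<lambda>x. cinner K (T x) y" "C * hnorm K y"])
      (use y CS cl in \<open>auto simp: bounded_operators_add[OF T] bounded_operators_smult[OF T] K.cinner_simps\<close>)
  then obtain S where S: "\<And>y. y \<in> carrier K \<Longrightarrow> S y \<in> carrier H"
    "\<And>x y. x \<in> carrier H \<Longrightarrow> y \<in> carrier K \<Longrightarrow> cinner K (T x) y = cinner H x (S y)"
    by metis
  have S': "cinner H (S y) x = cinner K y (T x)" if "x \<in> carrier H" "y \<in> carrier K" for x y
    using S(2)[OF that] S(1) cl that H.cinner_commute[of x "S y"] K.cinner_commute[of "T x" y] by simp
  show thesis
  proof (rule that[of "\<lambda>y\<in>carrier K. S y"])
    show "(\<lambda>y\<in>carrier K. S y) \<in> bounded_operators K H"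
    proof (rule bounded_operatorsI[where C = C])
      fix x y assume xy: "x \<in> carrier K" "y \<in> carrier K"
      have "S (x \<oplus>\<^bsub>K\<^esub> y) = S x \<oplus>\<^bsub>H\<^esub> S y"
        by (rule H.vec_eqI) (use xy S cl in \<open>auto simp: S' H.cinner_simps K.cinner_simps\<close>)
      then show "(\<lambda>y\<in>carrier K. S y) (x \<oplus>\<^bsub>K\<^esub> y) = (\<lambda>y\<in>carrier K. S y) x \<oplus>\<^bsub>H\<^esub> (\<lambda>y\<in>carrier K. S y) y"
        using xy by simp
    next
      fix c x assume x: "x \<in> carrier K"
      have "S (c \<odot>\<^bsub>K\<^esub> x) = c \<odot>\<^bsub>H\<^esub> S x"
        by (rule H.vec_eqI) (use x S cl in \<open>auto simp: S' H.cinner_simps K.cinner_simps\<close>)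
      then show "(\<lambda>y\<in>carrier K. S y) (c \<odot>\<^bsub>K\<^esub> x) = c \<odot>\<^bsub>H\<^esub> (\<lambda>y\<in>carrier K. S y) x"
        using x by simp
    next
      fix y assume y: "y \<in> carrier K"
      have "hnorm H (S y) * hnorm H (S y) = cmod (cinner K (T (S y)) y)"
        using S y by (simp add: H.cinner_self power2_eq_square norm_mult)
      also have "\<dots> \<le> C * hnorm K y * hnorm H (S y)"
        using CS S y by simp
      finally have "hnorm H (S y) \<le> C * hnorm K y"
        using S(1)[OF y] y C by (cases "hnorm H (S y) = 0") (auto simp: mult_le_cancel_right less_le)
      then show "hnorm H ((\<lambda>y\<in>carrier K. S y) y) \<le> C * hnorm K y" using y by simp
    qed (use S in auto)
  qed (use S in simp)
qed

lemma adjoint: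
  assumes "complex_hilbert_space H" "complex_hilbert_space K" and T: "T \<in> bounded_operators H K"
  shows adjoint_bounded: "adjoint H K T \<in> bounded_operators K H"
    and cinner_adjoint: "\<And>x y. x \<in> carrier H \<Longrightarrow> y \<in> carrier K \<Longrightarrow>
      cinner K (T x) y = cinner H x (adjoint H K T y)"
proof -
  obtain S where S: "S \<in> bounded_operators K H"
    "\<And>x y. x \<in> carrier H \<Longrightarrow> y \<in> carrier K \<Longrightarrow> cinner K (T x) y = cinner H x (S y)"
    using adjoint_exists[OF assms] by blast
  then have "adjoint H K T = S"
    using adjoint_eqI[OF assms(1,2) S(1)] bounded_operators_closed[OF T] by blast
  then show "adjoint H K T \<in> bounded_operators K H" "\<And>x y. x \<in> carrier H \<Longrightarrow> y \<in> carrier K \<Longrightarrow>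
      cinner K (T x) y = cinner H x (adjoint H K T y)"
    using S by auto
qed

subsection \<open>Matrix norms\<close>

text \<open>Through this formula estimates for matrices of operators become estimates of
  \<open>L2_set\<close> over coordinate norms, and \<open>hilbert_power H n\<close> is never treated
  as a Hilbert space in its own right.\<close>

lemma hnorm_hilbert_power:
  fixes H :: "'h hilbert" (structure)
  assumes "complex_hilbert_space H" "\<And>i. i < n \<Longrightarrow> x i \<in> carrier H"
  shows "hnorm (hilbert_power H n) x = L2_set (\<lambda>i. hnorm H (x i)) {..<n}"
  using assms by (simp add: hnorm_def hilbert_power_def L2_set_def complex_hilbert_space.cinner_ge_zero)

lemma hnorm_matrix_operator:
  fixes H :: "'h hilbert" (structure)
  assumes "complex_hilbert_space H" "\<And>i j. i < n \<Longrightarrow> j < n \<Longrightarrow> T i j \<in> bounded_operators H H"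
    and x: "x \<in> carrier (hilbert_power H n)"
  shows "hnorm (hilbert_power H n) (matrix_operator H n T x) =
    L2_set (\<lambda>i. hnorm H (\<Oplus>\<^bsub>H\<^esub>j\<in>{..<n}. T i j (x j))) {..<n}"
proof -
  interpret complex_hilbert_space H by fact
  have c: "(\<Oplus>j\<in>{..<n}. T i j (x j)) \<in> carrier H" if "i < n" for i
    using x that by (intro M.finsum_closed) (auto simp: hilbert_power_def intro!: bounded_operators_closed[OF assms(2)])
  have "hnorm (hilbert_power H n) (matrix_operator H n T x) =
      L2_set (\<lambda>i. hnorm H (matrix_operator H n T x i)) {..<n}"
    by (rule hnorm_hilbert_power) (use assms(1) x c in \<open>auto simp: matrix_operator_def\<close>)
  also have "\<dots> = L2_set (\<lambda>i. hnorm H (\<Oplus>j\<in>{..<n}. T i j (x j))) {..<n}"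
    by (rule L2_set_cong) (use x in \<open>auto simp: matrix_operator_def\<close>)
  finally show ?thesis .
qed

lemma matrix_op_norm_le:
  fixes H :: "'h hilbert" (structure)
  assumes H: "complex_hilbert_space H" and T: "\<And>i j. i < n \<Longrightarrow> j < n \<Longrightarrow> T i j \<in> bounded_operators H H"
    and c: "c \<ge> 0"
    and bound: "\<And>x. (\<And>i. i < n \<Longrightarrow> x i \<in> carrier H) \<Longrightarrow>
      L2_set (\<lambda>i. hnorm H (\<Oplus>\<^bsub>H\<^esub>j\<in>{..<n}. T i j (x j))) {..<n} \<le> c * L2_set (\<lambda>i. hnorm H (x i)) {..<n}"
  shows "matrix_op_norm H n T \<le> c"
  unfolding matrix_op_norm_def op_norm_def
proof (rule cSup_least)
  interpret complex_hilbert_space H by fact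
  have "(\<lambda>i\<in>{..<n}. \<zero>) \<in> carrier (hilbert_power H n)"
    by (auto simp: hilbert_power_def)
  moreover have "hnorm (hilbert_power H n) (\<lambda>i\<in>{..<n}. \<zero>) \<le> 1"
    by (subst hnorm_hilbert_power[OF H]) (auto simp: L2_set_def)
  ultimately show "{hnorm (hilbert_power H n) (matrix_operator H n T x) | x.
      x \<in> carrier (hilbert_power H n) \<and> hnorm (hilbert_power H n) x \<le> 1} \<noteq> {}" by blast
next
  fix v assume "v \<in> {hnorm (hilbert_power H n) (matrix_operator H n T x) | x.
      x \<in> carrier (hilbert_power H n) \<and> hnorm (hilbert_power H n) x \<le> 1}"
  then obtain x where v: "v = hnorm (hilbert_power H n) (matrix_operator H n T x)"
    and x: "x \<in> carrier (hilbert_power H n)" "hnorm (hilbert_power H n) x \<le> 1" by blast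
  have xi: "\<And>i. i < n \<Longrightarrow> x i \<in> carrier H" using x by (auto simp: hilbert_power_def)
  have "v \<le> c * L2_set (\<lambda>i. hnorm H (x i)) {..<n}"
    unfolding v using H T x xi by (subst hnorm_matrix_operator) (auto intro: bound)
  also have "\<dots> \<le> c * 1"
    using x c hnorm_hilbert_power[OF H xi] by (intro mult_left_mono) auto
  finally show "v \<le> c" by simp
qed

text \<open>A deliberately crude estimate: the Euclidean norm is at most the sum of the coordinates,
  and each coordinate is at most the Euclidean norm. It yields finiteness of matrix norms and their
  continuity in the entries, for which the size of the constant does not matter.\<close>

lemma L2_set_operator_sum:
  fixes H :: "'h hilbert" (structure) and n :: nat
  assumes H: "complex_hilbert_space H" and C: "\<And>i j. i < n \<Longrightarrow> j < n \<Longrightarrow> C i j \<ge> 0"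
    and v: "\<And>i j. i < n \<Longrightarrow> j < n \<Longrightarrow> v i j \<in> carrier H"
    and bound: "\<And>i j. i < n \<Longrightarrow> j < n \<Longrightarrow> hnorm H (v i j) \<le> C i j * hnorm H (y j)"
  shows "L2_set (\<lambda>i. hnorm H (\<Oplus>j\<in>{..<n}. v i j)) {..<n} \<le> (\<Sum>i<n. \<Sum>j<n. C i j) * L2_set (\<lambda>i. hnorm H (y i)) {..<n}"
proof -
  interpret complex_hilbert_space H by fact
  have "L2_set (\<lambda>i. hnorm H (\<Oplus>j\<in>{..<n}. v i j)) {..<n} \<le> (\<Sum>i<n. hnorm H (\<Oplus>j\<in>{..<n}. v i j))"
    using v by (intro L2_set_le_sum) (auto intro!: hnorm_ge_zero M.finsum_closed)
  also have "\<dots> \<le> (\<Sum>i<n. \<Sum>j<n. hnorm H (v i j))"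
    using v by (intro sum_mono hnorm_finsum) auto
  also have "\<dots> \<le> (\<Sum>i<n. \<Sum>j<n. C i j * L2_set (\<lambda>i. hnorm H (y i)) {..<n})"
  proof (intro sum_mono)
    fix i j assume ij: "i \<in> {..<n}" "j \<in> {..<n}"
    have "hnorm H (v i j) \<le> C i j * hnorm H (y j)"
      using bound ij by auto
    also have "\<dots> \<le> C i j * L2_set (\<lambda>i. hnorm H (y i)) {..<n}"
      using C[of i j] ij by (intro mult_left_mono member_le_L2_set) auto
    finally show "hnorm H (v i j) \<le> C i j * L2_set (\<lambda>i. hnorm H (y i)) {..<n}" .
  qed
  also have "\<dots> = (\<Sum>i<n. \<Sum>j<n. C i j) * L2_set (\<lambda>i. hnorm H (y i)) {..<n}"
    by (simp add: sum_distrib_right)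
  finally show ?thesis .
qed

lemma matrix_operator_bound:
  fixes H :: "'h hilbert" (structure) and n :: nat and T :: "nat \<Rightarrow> nat \<Rightarrow> 'h \<Rightarrow> 'h"
  assumes H: "complex_hilbert_space H" and T: "\<And>i j. i < n \<Longrightarrow> j < n \<Longrightarrow> T i j \<in> bounded_operators H H"
  shows "\<exists>C\<ge>0. \<forall>y. (\<forall>i<n. y i \<in> carrier H) \<longrightarrow>
    L2_set (\<lambda>i. hnorm H (\<Oplus>j\<in>{..<n}. T i j (y j))) {..<n} \<le> C * L2_set (\<lambda>i. hnorm H (y i)) {..<n}"
proof -
  interpret complex_hilbert_space H by fact
  define C where "C i j = (SOME C. C \<ge> 0 \<and> (\<forall>x\<in>carrier H. hnorm H (T i j x) \<le> C * hnorm H x))" for i j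
  have C_ex: "\<exists>C. C \<ge> 0 \<and> (\<forall>x\<in>carrier H. hnorm H (T i j x) \<le> C * hnorm H x)" if "i < n" "j < n" for i j
    by (rule bounded_operators_bound[OF H T[OF that]]) blast
  have C: "C i j \<ge> 0" "\<And>x. x \<in> carrier H \<Longrightarrow> hnorm H (T i j x) \<le> C i j * hnorm H x" if "i < n" "j < n" for i j
    using someI_ex[OF C_ex[OF that]] by (auto simp: C_def[symmetric])
  have crude: "L2_set (\<lambda>i. hnorm H (\<Oplus>j\<in>{..<n}. T i j (y j))) {..<n} \<le> (\<Sum>i<n. \<Sum>j<n. C i j) * L2_set (\<lambda>i. hnorm H (y i)) {..<n}"
    if "\<forall>i<n. y i \<in> carrier H" for y
    by (rule L2_set_operator_sum[OF H C(1)]) (use C that in \<open>auto intro: bounded_operators_closed[OF T]\<close>)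
  have sumC: "(\<Sum>i<n. \<Sum>j<n. C i j) \<ge> 0"
    using C(1) by (intro sum_nonneg) auto
  show ?thesis
    using sumC crude by blast
qed

text \<open>A real \<open>Sup\<close> dominates the elements of its set only when the set is bounded
  above; the crude constant from \<open>matrix_operator_bound\<close> provides the bound.\<close>

lemma matrix_op_norm_upper:
  fixes H :: "'h hilbert" (structure)
  assumes H: "complex_hilbert_space H" and T: "\<And>i j. i < n \<Longrightarrow> j < n \<Longrightarrow> T i j \<in> bounded_operators H H"
    and y: "y \<in> carrier (hilbert_power H n)" "hnorm (hilbert_power H n) y \<le> 1"
  shows "hnorm (hilbert_power H n) (matrix_operator H n T y) \<le> matrix_op_norm H n T"
proof -
  interpret complex_hilbert_space H by fact
  obtain C where C: "C \<ge> 0" "\<And>y. (\<And>i. i < n \<Longrightarrow> y i \<in> carrier H) \<Longrightarrow>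
    L2_set (\<lambda>i. hnorm H (\<Oplus>j\<in>{..<n}. T i j (y j))) {..<n} \<le> C * L2_set (\<lambda>i. hnorm H (y i)) {..<n}"
    using matrix_operator_bound[of H n T, OF H T] by auto
  define S where "S = {hnorm (hilbert_power H n) (matrix_operator H n T x) | x.
      x \<in> carrier (hilbert_power H n) \<and> hnorm (hilbert_power H n) x \<le> 1}"
  have "bdd_above S"
  proof (rule bdd_aboveI)
    fix v assume "v \<in> S"
    then obtain y where v: "v = hnorm (hilbert_power H n) (matrix_operator H n T y)"
      and y: "y \<in> carrier (hilbert_power H n)" "hnorm (hilbert_power H n) y \<le> 1"
      by (auto simp: S_def)
    have yi: "\<And>i. i < n \<Longrightarrow> y i \<in> carrier H" using y by (auto simp: hilbert_power_def)
    have "v \<le> C * L2_set (\<lambda>i. hnorm H (y i)) {..<n}"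
      unfolding v using H T y C(2)[of y] yi by (subst hnorm_matrix_operator) auto
    also have "\<dots> \<le> C * 1"
      using y C(1) hnorm_hilbert_power[OF H yi] by (intro mult_left_mono) auto
    finally show "v \<le> C" by simp
  qed
  then show ?thesis
    unfolding matrix_op_norm_def op_norm_def S_def[symmetric]
    by (intro cSup_upper) (use y in \<open>auto simp: S_def\<close>)
qed

lemma matrix_op_norm_nonneg:
  fixes H :: "'h hilbert" (structure)
  assumes H: "complex_hilbert_space H" and T: "\<And>i j. i < n \<Longrightarrow> j < n \<Longrightarrow> T i j \<in> bounded_operators H H"
  shows "0 \<le> matrix_op_norm H n T"
proof -
  interpret complex_hilbert_space H by fact
  have z: "(\<lambda>i\<in>{..<n}. \<zero>) \<in> carrier (hilbert_power H n)"
    by (auto simp: hilbert_power_def)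
  have "0 \<le> hnorm (hilbert_power H n) (matrix_operator H n T (\<lambda>i\<in>{..<n}. \<zero>))"
    using H T z by (subst hnorm_matrix_operator) auto
  also have "\<dots> \<le> matrix_op_norm H n T"
  proof (rule matrix_op_norm_upper[OF H T z])
    show "hnorm (hilbert_power H n) (\<lambda>i\<in>{..<n}. \<zero>) \<le> 1"
      by (subst hnorm_hilbert_power[OF H]) (auto simp: L2_set_def)
  qed
  finally show ?thesis .
qed

lemma matrix_op_norm_bound:
  fixes H :: "'h hilbert" (structure)
  assumes H: "complex_hilbert_space H" and T: "\<And>i j. i < n \<Longrightarrow> j < n \<Longrightarrow> T i j \<in> bounded_operators H H"
    and x: "\<And>i. i < n \<Longrightarrow> x i \<in> carrier H"
  shows "L2_set (\<lambda>i. hnorm H (\<Oplus>\<^bsub>H\<^esub>j\<in>{..<n}. T i j (x j))) {..<n}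
    \<le> matrix_op_norm H n T * L2_set (\<lambda>i. hnorm H (x i)) {..<n}"
proof -
  interpret complex_hilbert_space H by fact
  note Tc = bounded_operators_closed[OF T]
  define r where "r = L2_set (\<lambda>i. hnorm H (x i)) {..<n}"
  show ?thesis
  proof (cases "r = 0")
    \<comment> \<open>A tuple of norm zero cannot be normalised; here the crude bound already forces
      the left side to vanish.\<close>
    case True
    then show ?thesis using matrix_operator_bound[of H n T, OF H T] x
      by (auto simp: r_def dest!: spec[of _ x])
  next
    case False
    then have r: "r > 0" by (simp add: r_def less_le)
    define y where "y = (\<lambda>i\<in>{..<n}. complex_of_real (1 / r) \<odot> x i)"
    have y: "y \<in> carrier (hilbert_power H n)" "\<And>i. i < n \<Longrightarrow> y i \<in> carrier H"
      using x by (auto simp: hilbert_power_def y_def)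
    have "L2_set (\<lambda>i. hnorm H (y i)) {..<n} = L2_set (\<lambda>i. (1 / r) * hnorm H (x i)) {..<n}"
      using x r by (intro L2_set_cong) (auto simp: y_def hnorm_smult norm_divide)
    also have "\<dots> = (1 / r) * r"
      unfolding r_def using r by (intro L2_set_right_distrib[symmetric]) (simp add: r_def)
    also have "\<dots> = 1"
      using r by simp
    finally have ny: "hnorm (hilbert_power H n) y = 1"
      using hnorm_hilbert_power[OF H y(2)] by simp
    have "hnorm (hilbert_power H n) (matrix_operator H n T y) \<le> matrix_op_norm H n T"
      using matrix_op_norm_upper[OF H T y(1)] ny by simp
    also have "hnorm (hilbert_power H n) (matrix_operator H n T y) =
        L2_set (\<lambda>i. hnorm H (\<Oplus>j\<in>{..<n}. T i j (y j))) {..<n}"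
      using H T y by (intro hnorm_matrix_operator) auto
    also have "\<dots> = L2_set (\<lambda>i. (1 / r) * hnorm H (\<Oplus>j\<in>{..<n}. T i j (x j))) {..<n}"
    proof (rule L2_set_cong)
      fix i assume i: "i \<in> {..<n}"
      have c: "(\<Oplus>j\<in>{..<n}. T i j (x j)) \<in> carrier H"
        using Tc x i by (intro M.finsum_closed) auto
      have "(\<Oplus>j\<in>{..<n}. T i j (y j)) = (\<Oplus>j\<in>{..<n}. complex_of_real (1 / r) \<odot> T i j (x j))"
        using Tc x i by (intro M.finsum_cong') (auto simp: y_def bounded_operators_smult[OF T])
      also have "\<dots> = complex_of_real (1 / r) \<odot> (\<Oplus>j\<in>{..<n}. T i j (x j))"
        using Tc x i
        by (intro finsum_additive[OF H H, where g = "\<lambda>v. complex_of_real (1 / r) \<odot> v", symmetric])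
          (auto simp: smult_add_right)
      finally show "hnorm H (\<Oplus>j\<in>{..<n}. T i j (y j)) = (1 / r) * hnorm H (\<Oplus>j\<in>{..<n}. T i j (x j))"
        using c r by (simp add: hnorm_smult norm_divide)
    qed simp
    also have "\<dots> = (1 / r) * L2_set (\<lambda>i. hnorm H (\<Oplus>j\<in>{..<n}. T i j (x j))) {..<n}"
      using r by (intro L2_set_right_distrib[symmetric]) simp
    finally show ?thesis
      using r by (simp add: r_def[symmetric] field_simps)
  qed
qed

lemma lessThan_1: "{..<1::nat} = {0}" "{..<Suc 0} = {0}"
  by auto

lemma op_bound_matrix_norm1:
  fixes H :: "'h hilbert" (structure)
  assumes "complex_hilbert_space H" "T \<in> bounded_operators H H" "x \<in> carrier H"
  shows "hnorm H (T x) \<le> matrix_op_norm H 1 (\<lambda>_ _. T) * hnorm H x"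
proof -
  interpret complex_hilbert_space H by fact
  have "(\<Oplus>j\<in>{..<1::nat}. T x) = T x"
    using bounded_operators_closed[OF assms(2,3)] by (simp add: lessThan_1)
  then show ?thesis
    using matrix_op_norm_bound[of H 1 "\<lambda>_ _. T" "\<lambda>_. x"] assms bounded_operators_closed[OF assms(2,3)]
    by (simp add: lessThan_1)
qed

lemma matrix_norm1_le:
  fixes H :: "'h hilbert" (structure)
  assumes "complex_hilbert_space H" "T \<in> bounded_operators H H" "c \<ge> 0"
    and "\<And>x. x \<in> carrier H \<Longrightarrow> hnorm H (T x) \<le> c * hnorm H x"
  shows "matrix_op_norm H 1 (\<lambda>_ _. T) \<le> c"
proof (rule matrix_op_norm_le)
  interpret complex_hilbert_space H by fact
  fix x :: "nat \<Rightarrow> _" assume x: "\<And>i. i < 1 \<Longrightarrow> x i \<in> carrier H"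
  from x[of 0] have x: "x 0 \<in> carrier H" by simp
  have "(\<Oplus>j\<in>{..<1::nat}. T (x j)) = T (x 0)"
    using bounded_operators_closed[OF assms(2) x] by (simp add: lessThan_1)
  then show "L2_set (\<lambda>i. hnorm H (\<Oplus>j\<in>{..<1}. T (x j))) {..<1::nat} \<le> c * L2_set (\<lambda>i. hnorm H (x i)) {..<1}"
    using assms(4)[OF x] bounded_operators_closed[OF assms(2) x] x by (simp add: lessThan_1)
qed (use assms in auto)

subsection \<open>Isometric embeddings onto closed subspaces\<close>

text \<open>Nothing is assumed of G beyond closure under its operations: the vector space laws, the
  inner product axioms and completeness are all pulled back along the injection j, completeness from
  closedness of its range. The two instances are the inclusion of an orthogonal complement and the
  copy of a cyclic subspace inside the universe type.\<close>

locale hilbert_embedding = complex_hilbert_space H for H :: "'h hilbert" (structure) +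
  fixes G :: "'g hilbert" and j :: "'g \<Rightarrow> 'h"
  assumes emb_zero_closed: "\<zero>\<^bsub>G\<^esub> \<in> carrier G"
    and emb_add_closed: "\<And>x y. x \<in> carrier G \<Longrightarrow> y \<in> carrier G \<Longrightarrow> x \<oplus>\<^bsub>G\<^esub> y \<in> carrier G"
    and emb_smult_closed: "\<And>c x. x \<in> carrier G \<Longrightarrow> c \<odot>\<^bsub>G\<^esub> x \<in> carrier G"
    and emb_closed: "\<And>x. x \<in> carrier G \<Longrightarrow> j x \<in> carrier H"
    and emb_inj: "inj_on j (carrier G)"
    and emb_zero: "j \<zero>\<^bsub>G\<^esub> = \<zero>"
    and emb_add: "\<And>x y. x \<in> carrier G \<Longrightarrow> y \<in> carrier G \<Longrightarrow> j (x \<oplus>\<^bsub>G\<^esub> y) = j x \<oplus> j y"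
    and emb_smult: "\<And>c x. x \<in> carrier G \<Longrightarrow> j (c \<odot>\<^bsub>G\<^esub> x) = c \<odot> j x"
    and emb_cinner: "\<And>x y. x \<in> carrier G \<Longrightarrow> y \<in> carrier G \<Longrightarrow> cinner G x y = cinner H (j x) (j y)"
    and emb_range_closed: "\<And>f x. (\<And>k. f k \<in> j ` carrier G) \<Longrightarrow> converges_to f x \<Longrightarrow> x \<in> j ` carrier G"
begin

lemma emb_eqI: "x \<in> carrier G \<Longrightarrow> y \<in> carrier G \<Longrightarrow> j x = j y \<Longrightarrow> x = y"
  using emb_inj by (auto dest: inj_onD)

lemma hnorm_emb: "x \<in> carrier G \<Longrightarrow> hnorm H (j x) = hnorm G x"
  by (simp add: hnorm_def emb_cinner)

lemma module_G: "Module.module complex_ring G"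
proof (rule moduleI)
  note s = emb_zero_closed emb_add_closed emb_smult_closed emb_closed emb_zero emb_add emb_smult
  show "abelian_group G"
  proof (rule abelian_groupI)
    show "\<exists>y\<in>carrier G. y \<oplus>\<^bsub>G\<^esub> x = \<zero>\<^bsub>G\<^esub>" if x: "x \<in> carrier G" for x
    proof (rule bexI[of _ "(-1) \<odot>\<^bsub>G\<^esub> x"])
      show "(-1) \<odot>\<^bsub>G\<^esub> x \<oplus>\<^bsub>G\<^esub> x = \<zero>\<^bsub>G\<^esub>"
        by (rule emb_eqI) (use x s minus_eq_smult[symmetric] in \<open>simp_all add: M.l_neg\<close>)
    qed (use x s in simp)
    show "x \<oplus>\<^bsub>G\<^esub> y \<oplus>\<^bsub>G\<^esub> z = x \<oplus>\<^bsub>G\<^esub> (y \<oplus>\<^bsub>G\<^esub> z)"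
      if "x \<in> carrier G" "y \<in> carrier G" "z \<in> carrier G" for x y z
      by (rule emb_eqI) (use that s in \<open>simp_all add: M.a_assoc\<close>)
    show "x \<oplus>\<^bsub>G\<^esub> y = y \<oplus>\<^bsub>G\<^esub> x" if "x \<in> carrier G" "y \<in> carrier G" for x y
      by (rule emb_eqI) (use that s in \<open>simp_all add: M.a_comm\<close>)
    show "\<zero>\<^bsub>G\<^esub> \<oplus>\<^bsub>G\<^esub> x = x" if "x \<in> carrier G" for x
      by (rule emb_eqI) (use that s in simp_all)
  qed (use s in simp_all)
  show "(a \<oplus>\<^bsub>complex_ring\<^esub> b) \<odot>\<^bsub>G\<^esub> x = a \<odot>\<^bsub>G\<^esub> x \<oplus>\<^bsub>G\<^esub> b \<odot>\<^bsub>G\<^esub> x" if "x \<in> carrier G" for a b x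
    by (rule emb_eqI) (use that s in \<open>simp_all add: smult_add_left\<close>)
  show "a \<odot>\<^bsub>G\<^esub> (x \<oplus>\<^bsub>G\<^esub> y) = a \<odot>\<^bsub>G\<^esub> x \<oplus>\<^bsub>G\<^esub> a \<odot>\<^bsub>G\<^esub> y" if "x \<in> carrier G" "y \<in> carrier G" for a x y
    by (rule emb_eqI) (use that s in \<open>simp_all add: smult_add_right\<close>)
  show "(a \<otimes>\<^bsub>complex_ring\<^esub> b) \<odot>\<^bsub>G\<^esub> x = a \<odot>\<^bsub>G\<^esub> (b \<odot>\<^bsub>G\<^esub> x)" if "x \<in> carrier G" for a b x
    by (rule emb_eqI) (use that s in \<open>simp_all add: smult_smult\<close>)
  show "\<one>\<^bsub>complex_ring\<^esub> \<odot>\<^bsub>G\<^esub> x = x" if "x \<in> carrier G" for x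
    by (rule emb_eqI) (use that s in simp_all)
qed (use cring_complex_ring emb_smult_closed in auto)

lemma emb_diff_pre:
  assumes xy: "x \<in> carrier G" "y \<in> carrier G"
  shows "x \<ominus>\<^bsub>G\<^esub> y \<in> carrier G" "j (x \<ominus>\<^bsub>G\<^esub> y) = j x \<ominus> j y"
proof -
  interpret G: Module.module complex_ring G by (rule module_G)
  note s = emb_zero_closed emb_add_closed emb_smult_closed emb_closed emb_zero emb_add emb_smult
  have "(-1) \<odot>\<^bsub>G\<^esub> y \<oplus>\<^bsub>G\<^esub> y = \<zero>\<^bsub>G\<^esub>"
    by (rule emb_eqI) (use xy s minus_eq_smult[symmetric] in \<open>simp_all add: M.l_neg\<close>)
  then have "\<ominus>\<^bsub>G\<^esub> y = (-1) \<odot>\<^bsub>G\<^esub> y"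
    using xy s by (intro G.minus_equality) auto
  then show "x \<ominus>\<^bsub>G\<^esub> y \<in> carrier G" "j (x \<ominus>\<^bsub>G\<^esub> y) = j x \<ominus> j y"
    using xy s by (simp_all add: G.minus_eq M.minus_eq minus_eq_smult)
qed

lemma hilbert_space_G: "complex_hilbert_space G"
proof (intro complex_hilbert_space.intro complex_hilbert_space_axioms.intro module_G)
  note s = emb_zero_closed emb_add_closed emb_smult_closed emb_closed emb_zero emb_add emb_smult emb_cinner
  fix x y z c
  show "x \<in> carrier G \<Longrightarrow> y \<in> carrier G \<Longrightarrow> z \<in> carrier G \<Longrightarrow>
      cinner G (x \<oplus>\<^bsub>G\<^esub> y) z = cinner G x z + cinner G y z"
    "x \<in> carrier G \<Longrightarrow> y \<in> carrier G \<Longrightarrow> cinner G (c \<odot>\<^bsub>G\<^esub> x) y = c * cinner G x y"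
    "x \<in> carrier G \<Longrightarrow> 0 \<le> Re (cinner G x x)"
    using s by (auto simp: cinner_simps cinner_ge_zero)
  show "cinner G y x = cnj (cinner G x y)" if "x \<in> carrier G" "y \<in> carrier G"
    using s that by (simp add: cinner_commute[of "j x" "j y"])
  show "x = \<zero>\<^bsub>G\<^esub>" if "x \<in> carrier G" "cinner G x x = 0"
    using that s cinner_eq_zero[of "j x"] by (intro emb_eqI) auto
next
  fix f :: "nat \<Rightarrow> 'g"
  assume f: "\<And>k. f k \<in> carrier G"
    and cauchy: "\<And>e. e > 0 \<Longrightarrow> \<exists>N. \<forall>k\<ge>N. \<forall>l\<ge>N. hnorm G (f k \<ominus>\<^bsub>G\<^esub> f l) < e"
  have "hnorm G (f k \<ominus>\<^bsub>G\<^esub> f l) = hnorm H (j (f k) \<ominus> j (f l))" for k l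
    using emb_diff_pre f by (simp add: hnorm_emb[symmetric])
  then obtain y where y: "converges_to (\<lambda>k. j (f k)) y"
    using Cauchy_converges_to[of "\<lambda>k. j (f k)"] cauchy f emb_closed by auto
  then obtain x where x: "x \<in> carrier G" "y = j x"
    using emb_range_closed[of "\<lambda>k. j (f k)" y] f by blast
  have "hnorm H (j (f k) \<ominus> j x) = hnorm G (f k \<ominus>\<^bsub>G\<^esub> x)" for k
    using emb_diff_pre f x by (simp add: hnorm_emb[symmetric])
  then show "\<exists>x\<in>carrier G. (\<lambda>k. hnorm G (f k \<ominus>\<^bsub>G\<^esub> x)) \<longlonglongrightarrow> 0"
    using y x by (auto simp: converges_to_def)
qed

sublocale G: complex_hilbert_space G
  by (rule hilbert_space_G)

lemma emb_finsum:
  assumes "finite A" "\<And>i. i \<in> A \<Longrightarrow> f i \<in> carrier G"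
  shows "j (finsum G f A) = (\<Oplus>i\<in>A. j (f i))"
  using assms
  by (intro finsum_additive[OF hilbert_space_G complex_hilbert_space_axioms emb_closed emb_add emb_zero]) auto

text \<open>The restriction of T to the subspace, read in G. It is meaningful only if T maps the
  range of j into itself, since \<open>inv_into\<close> is arbitrary elsewhere; hence the invariance
  assumptions in the lemmas about it.\<close>

definition pull :: "('h \<Rightarrow> 'h) \<Rightarrow> 'g \<Rightarrow> 'g" where
  "pull T = (\<lambda>x\<in>carrier G. inv_into (carrier G) j (T (j x)))"

lemma emb_pull:
  assumes "\<And>x. x \<in> carrier G \<Longrightarrow> T (j x) \<in> j ` carrier G" "x \<in> carrier G"
  shows "pull T x \<in> carrier G" "j (pull T x) = T (j x)"
  using assms(1)[OF assms(2)] assms(2) by (auto simp: pull_def inv_into_into f_inv_into_f)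

lemma pull_bounded:
  assumes T: "T \<in> bounded_operators H H"
    and inv: "\<And>x. x \<in> carrier G \<Longrightarrow> T (j x) \<in> j ` carrier G"
  shows "pull T \<in> bounded_operators G G"
proof -
  obtain C where C: "\<And>x. x \<in> carrier H \<Longrightarrow> hnorm H (T x) \<le> C * hnorm H x"
    using bounded_operators_bound[OF complex_hilbert_space_axioms T] by blast
  note p = emb_pull[of T, OF inv]
  note s = emb_add emb_smult emb_closed bounded_operators_add[OF T] bounded_operators_smult[OF T]
  show ?thesis
  proof (rule bounded_operatorsI[where C = C])
    show "pull T (x \<oplus>\<^bsub>G\<^esub> y) = pull T x \<oplus>\<^bsub>G\<^esub> pull T y" if "x \<in> carrier G" "y \<in> carrier G" for x y
      by (rule emb_eqI) (use that p s in simp_all)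
    show "pull T (c \<odot>\<^bsub>G\<^esub> x) = c \<odot>\<^bsub>G\<^esub> pull T x" if "x \<in> carrier G" for c x
      by (rule emb_eqI) (use that p s in simp_all)
    show "hnorm G (pull T x) \<le> C * hnorm G x" if "x \<in> carrier G" for x
      using that C[of "j x"] p emb_closed by (simp add: hnorm_emb[symmetric])
  qed (use p in \<open>auto simp: pull_def\<close>)
qed

text \<open>Passing to a common invariant subspace only shrinks the set of tuples on which the norm
  is tested.\<close>

lemma pull_matrix_op_norm:
  assumes T: "\<And>i k. i < n \<Longrightarrow> k < n \<Longrightarrow> T i k \<in> bounded_operators H H"
    and inv: "\<And>i k x. i < n \<Longrightarrow> k < n \<Longrightarrow> x \<in> carrier G \<Longrightarrow> T i k (j x) \<in> j ` carrier G"
  shows "matrix_op_norm G n (\<lambda>i k. pull (T i k)) \<le> matrix_op_norm H n T"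
proof (rule matrix_op_norm_le[OF hilbert_space_G])
  fix x assume x: "\<And>i. i < n \<Longrightarrow> x i \<in> carrier G"
  have p: "pull (T i k) y \<in> carrier G" "j (pull (T i k) y) = T i k (j y)" if "i < n" "k < n" "y \<in> carrier G" for i k y
    using emb_pull[of "T i k" y] inv that by auto
  have eq: "hnorm G (\<Oplus>\<^bsub>G\<^esub>k\<in>{..<n}. pull (T i k) (x k)) = hnorm H (\<Oplus>k\<in>{..<n}. T i k (j (x k)))" if i: "i < n" for i
  proof -
    have "(\<Oplus>\<^bsub>G\<^esub>k\<in>{..<n}. pull (T i k) (x k)) \<in> carrier G"
      using p x i by (intro G.M.finsum_closed) auto
    moreover have "j (\<Oplus>\<^bsub>G\<^esub>k\<in>{..<n}. pull (T i k) (x k)) = (\<Oplus>k\<in>{..<n}. j (pull (T i k) (x k)))"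
      using p x i by (intro emb_finsum) auto
    moreover have "\<dots> = (\<Oplus>k\<in>{..<n}. T i k (j (x k)))"
      using p x i by (intro M.finsum_cong') (auto intro!: bounded_operators_closed[OF T] emb_closed)
    ultimately show ?thesis by (simp add: hnorm_emb[symmetric])
  qed
  have "L2_set (\<lambda>i. hnorm G (\<Oplus>\<^bsub>G\<^esub>k\<in>{..<n}. pull (T i k) (x k))) {..<n}
      = L2_set (\<lambda>i. hnorm H (\<Oplus>k\<in>{..<n}. T i k (j (x k)))) {..<n}"
    by (rule L2_set_cong) (simp_all add: eq)
  also have "\<dots> \<le> matrix_op_norm H n T * L2_set (\<lambda>i. hnorm H (j (x i))) {..<n}"
    by (rule matrix_op_norm_bound[of H n T, OF complex_hilbert_space_axioms T]) (use x emb_closed in auto)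
  also have "L2_set (\<lambda>i. hnorm H (j (x i))) {..<n} = L2_set (\<lambda>i. hnorm G (x i)) {..<n}"
    by (rule L2_set_cong) (simp_all add: x hnorm_emb)
  finally show "L2_set (\<lambda>i. hnorm G (\<Oplus>\<^bsub>G\<^esub>k\<in>{..<n}. pull (T i k) (x k))) {..<n}
      \<le> matrix_op_norm H n T * L2_set (\<lambda>i. hnorm G (x i)) {..<n}" .
next
  show "0 \<le> matrix_op_norm H n T"
    by (rule matrix_op_norm_nonneg[of H n T, OF complex_hilbert_space_axioms T])
next
  show "pull (T i k) \<in> bounded_operators G G" if "i < n" "k < n" for i k
    by (rule pull_bounded[OF T[OF that] inv[OF that]])
qed

text \<open>Restriction commutes with taking adjoints only on a reducing subspace, which is why
  invariance is required of both T and its adjoint S.\<close>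

lemma pull_adjoint:
  assumes T: "T \<in> bounded_operators H H" and S: "S \<in> bounded_operators H H"
    and invT: "\<And>x. x \<in> carrier G \<Longrightarrow> T (j x) \<in> j ` carrier G"
    and invS: "\<And>x. x \<in> carrier G \<Longrightarrow> S (j x) \<in> j ` carrier G"
    and adj: "\<And>x y. x \<in> carrier H \<Longrightarrow> y \<in> carrier H \<Longrightarrow> cinner H (T x) y = cinner H x (S y)"
  shows "adjoint G G (pull T) = pull S"
proof (rule adjoint_eqI)
  note p = emb_pull[of T, OF invT] emb_pull[of S, OF invS]
  show "cinner G (pull T x) y = cinner G x (pull S y)" if "x \<in> carrier G" "y \<in> carrier G" for x y
    using that p emb_closed by (simp add: emb_cinner adj)
  show "pull T \<in> carrier G \<rightarrow> carrier G" using p by auto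
qed (use S invS in \<open>auto intro: pull_bounded hilbert_space_G\<close>)

lemma pull_compose:
  assumes "\<And>x. x \<in> carrier G \<Longrightarrow> T (j x) \<in> j ` carrier G"
    and "\<And>x. x \<in> carrier G \<Longrightarrow> S (j x) \<in> j ` carrier G"
  shows "pull (compose (carrier H) T S) = compose (carrier G) (pull T) (pull S)"
proof
  fix x
  note p = emb_pull[of T, OF assms(1)] emb_pull[of S, OF assms(2)]
  have TS: "compose (carrier H) T S (j x) \<in> j ` carrier G" if "x \<in> carrier G" for x
    using assms(2)[OF that] assms(1) emb_closed that by (auto simp: compose_eq)
  show "pull (compose (carrier H) T S) x = compose (carrier G) (pull T) (pull S) x"
  proof (cases "x \<in> carrier G")
    case True
    then show ?thesis
      using p emb_pull[of "compose (carrier H) T S", OF TS] emb_closed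
      by (intro emb_eqI) (auto simp: compose_eq)
  qed (simp add: pull_def compose_def)
qed

end

lemma hilbert_embedding_subspace:
  assumes "complex_hilbert_space K" and sub: "L \<subseteq> carrier K" and "\<zero>\<^bsub>K\<^esub> \<in> L"
    and "\<And>x y. x \<in> L \<Longrightarrow> y \<in> L \<Longrightarrow> x \<oplus>\<^bsub>K\<^esub> y \<in> L" and "\<And>c x. x \<in> L \<Longrightarrow> c \<odot>\<^bsub>K\<^esub> x \<in> L"
    and "\<And>f x. (\<And>k. f k \<in> L) \<Longrightarrow> complex_hilbert_space.converges_to K f x \<Longrightarrow> x \<in> L"
  shows "hilbert_embedding K (K\<lparr>carrier := L\<rparr>) (\<lambda>x. x)"
proof (intro hilbert_embedding.intro hilbert_embedding_axioms.intro)
  fix f x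
  assume "\<And>k. f k \<in> (\<lambda>x. x) ` carrier (K\<lparr>carrier := L\<rparr>)" "complex_hilbert_space.converges_to K f x"
  then show "x \<in> (\<lambda>x. x) ` carrier (K\<lparr>carrier := L\<rparr>)"
    using assms(6)[of f x] by simp
qed (use assms in auto)

text \<open>The complement of any set of vectors is closed by continuity of the inner product, and
  therefore a Hilbert space.\<close>

lemma hilbert_embedding_complement:
  assumes "complex_hilbert_space K" and S: "S \<subseteq> carrier K"
  shows "hilbert_embedding K (orthogonal_complement K S) (\<lambda>x. x)"
  unfolding orthogonal_complement_def
proof (rule hilbert_embedding_subspace)
  interpret complex_hilbert_space K by fact
  fix f x assume f: "\<And>k. f k \<in> {y \<in> carrier K. \<forall>x\<in>S. cinner K x y = 0}" and lim: "converges_to f x"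
  have x: "x \<in> carrier K" using lim by (simp add: converges_to_def)
  have "cinner K s x = 0" if s: "s \<in> S" for s
  proof -
    have "cinner K (f k) s = 0" for k
      using f[of k] s S cinner_commute[of s "f k"] by auto
    then have "(\<lambda>k. 0) \<longlonglongrightarrow> cinner K x s"
      using converges_to_cinner[OF lim, of s] s S by auto
    then have "cinner K x s = 0" by (simp add: LIMSEQ_const_iff)
    then show ?thesis using s S x cinner_commute[of x s] by auto
  qed
  then show "x \<in> {y \<in> carrier K. \<forall>x\<in>S. cinner K x y = 0}" using x by blast
next
  interpret complex_hilbert_space K by fact
  show "\<zero>\<^bsub>K\<^esub> \<in> {y \<in> carrier K. \<forall>x\<in>S. cinner K x y = 0}"
    using S by auto
  show "x \<oplus>\<^bsub>K\<^esub> y \<in> {y \<in> carrier K. \<forall>x\<in>S. cinner K x y = 0}"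
    if "x \<in> {y \<in> carrier K. \<forall>x\<in>S. cinner K x y = 0}" "y \<in> {y \<in> carrier K. \<forall>x\<in>S. cinner K x y = 0}" for x y
    using that S by (auto simp: cinner_simps subset_eq)
  show "c \<odot>\<^bsub>K\<^esub> x \<in> {y \<in> carrier K. \<forall>x\<in>S. cinner K x y = 0}"
    if "x \<in> {y \<in> carrier K. \<forall>x\<in>S. cinner K x y = 0}" for c x
    using that S by (auto simp: cinner_simps subset_eq)
qed (use assms in auto)

section \<open>C*-algebras\<close>

lemma scaleC_zero_left [simp]: "0 *\<^sub>C (x::'a::unital_cstar_algebra) = 0"
  using scaleC_of_real[of 0 x] by simp

lemma scaleC_zero_right [simp]: "c *\<^sub>C (0::'a::unital_cstar_algebra) = 0"
  using scaleC_add_right[of c 0 0] by simp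

lemma scaleC_one [simp]: "1 *\<^sub>C (x::'a::unital_cstar_algebra) = x"
  using scaleC_of_real[of 1 x] by simp

lemma scaleC_minus_one: "(-1) *\<^sub>C (x::'a::unital_cstar_algebra) = - x"
  using scaleC_of_real[of "-1" x] by simp

lemma scaleC_minus_left: "(- c) *\<^sub>C (x::'a::unital_cstar_algebra) = - (c *\<^sub>C x)"
  using scaleC_add_left[of "-c" c x] by (simp add: eq_neg_iff_add_eq_0)

lemma star_zero [simp]: "star (0::'a::unital_cstar_algebra) = 0"
  using star_add[of "0::'a" 0] by simp

lemma star_minus: "star (- x) = - star (x::'a::unital_cstar_algebra)"
  using star_add[of "-x" x] by (simp add: eq_neg_iff_add_eq_0)

lemma star_diff: "star (x - y) = star x - star (y::'a::unital_cstar_algebra)"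
  using star_add[of x "-y"] by (simp add: star_minus)

lemma star_one [simp]: "star (1::'a::unital_cstar_algebra) = 1"
  by (metis mult_1_left mult_1_right star_mult star_star)

lemma norm_one_le: "norm (1::'a::unital_cstar_algebra) \<le> 1"
proof -
  have "norm (1::'a) = norm (1::'a) * norm (1::'a)"
    using cstar_identity[of "1::'a"] by (simp add: power2_eq_square)
  then show ?thesis
    by (metis dual_order.refl mult_cancel_left2 norm_zero zero_le_one norm_eq_zero)
qed

lemma isometric_norm_le:
  assumes "star u * u = (1::'a::unital_cstar_algebra)"
  shows "norm u \<le> 1"
proof -
  have "(norm u)\<^sup>2 \<le> 1\<^sup>2"
    using cstar_identity[of u] assms norm_one_le[where 'a='a] by simp
  then show ?thesis
    by (rule power2_le_imp_le) simp
qed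

text \<open>The inverse is the geometric series. Its terms are estimated from exponent one onwards,
  so that the norm of the unit does not enter.\<close>

lemma Neumann_inverse:
  fixes x :: "'a::unital_cstar_algebra"
  assumes x: "norm x < 1"
  obtains y where "(1 - x) * y = 1" "y * (1 - x) = 1"
proof -
  have "norm (x ^ Suc n) \<le> norm x ^ Suc n" for n
  proof (induction n)
    case (Suc n)
    have "norm (x ^ Suc (Suc n)) \<le> norm x * norm (x ^ Suc n)"
      by (simp only: power_Suc[of x "Suc n"] norm_mult_ineq)
    also have "\<dots> \<le> norm x * norm x ^ Suc n"
      using Suc by (intro mult_left_mono) auto
    finally show ?case by simp
  qed simp
  note le = this
  have "summable (\<lambda>n. norm x ^ Suc n)"
    using x by (simp only: summable_Suc_iff) (simp add: summable_geometric)
  then have "summable (\<lambda>n. x ^ Suc n)"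
    by (rule summable_comparison_test'[where N = 0]) (rule le)
  then have s: "summable (\<lambda>n. x ^ n)"
    by (simp only: summable_Suc_iff)
  define y where "y = suminf (\<lambda>n. x ^ n)"
  have y: "y - 1 = suminf (\<lambda>n. x ^ Suc n)"
    using suminf_split_head[OF s] by (simp add: y_def)
  have "x * y = suminf (\<lambda>n. x * x ^ n)"
    unfolding y_def using s by (rule suminf_mult[symmetric])
  moreover have "y * x = suminf (\<lambda>n. x ^ n * x)"
    unfolding y_def using s by (rule suminf_mult2)
  moreover have "(\<lambda>n. x ^ n * x) = (\<lambda>n. x ^ Suc n)"
    by (simp add: power_commutes)
  ultimately have "x * y = y - 1" "y * x = y - 1"
    using y by simp_all
  then show thesis
    by (intro that[of y]) (simp_all add: left_diff_distrib right_diff_distrib)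
qed

section \<open>Representations of C*-algebras\<close>

locale cstar_rep = complex_hilbert_space H for H :: "'h hilbert" (structure) +
  fixes \<pi> :: "'a::unital_cstar_algebra \<Rightarrow> 'h \<Rightarrow> 'h"
  assumes unital_star_representation: "unital_star_representation H \<pi>"
begin

lemma rep_bounded: "\<pi> a \<in> bounded_operators H H"
  using unital_star_representation unfolding unital_star_representation_def by blast

lemma rep_closed [simp]: "x \<in> carrier H \<Longrightarrow> \<pi> a x \<in> carrier H"
  using rep_bounded by (rule bounded_operators_closed)

lemma rep_add: "x \<in> carrier H \<Longrightarrow> \<pi> (a + b) x = \<pi> a x \<oplus> \<pi> b x"
  using unital_star_representation unfolding unital_star_representation_def by blast

lemma rep_scaleC: "x \<in> carrier H \<Longrightarrow> \<pi> (c *\<^sub>C a) x = c \<odot> \<pi> a x"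
  using unital_star_representation unfolding unital_star_representation_def by blast

lemma rep_compose: "\<pi> (a * b) = compose (carrier H) (\<pi> a) (\<pi> b)"
  using unital_star_representation unfolding unital_star_representation_def by blast

lemma rep_mult: "x \<in> carrier H \<Longrightarrow> \<pi> (a * b) x = \<pi> a (\<pi> b x)"
  by (simp add: rep_compose compose_eq)

lemma rep_id: "\<pi> 1 = (\<lambda>x\<in>carrier H. x)"
  using unital_star_representation unfolding unital_star_representation_def by blast

lemma rep_one [simp]: "x \<in> carrier H \<Longrightarrow> \<pi> 1 x = x"
  by (simp add: rep_id)

lemma rep_adjoint: "\<pi> (star a) = adjoint H H (\<pi> a)"
  using unital_star_representation unfolding unital_star_representation_def by blast

lemma rep_zero [simp]: "x \<in> carrier H \<Longrightarrow> \<pi> 0 x = \<zero>"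
  using rep_scaleC[of x 0 0] by simp

lemma rep_diff: "x \<in> carrier H \<Longrightarrow> \<pi> (a - b) x = \<pi> a x \<ominus> \<pi> b x"
  using rep_add[of x a "- b"] rep_scaleC[of x "-1" b]
  by (simp add: M.minus_eq minus_eq_smult scaleC_minus_one)

lemma rep_star: "x \<in> carrier H \<Longrightarrow> y \<in> carrier H \<Longrightarrow> cinner H (\<pi> a x) y = cinner H x (\<pi> (star a) y)"
  using cinner_adjoint[OF complex_hilbert_space_axioms complex_hilbert_space_axioms rep_bounded]
    by (simp add: rep_adjoint)

text \<open>If \<open>M\<close> is the least constant with \<open>\<parallel>\<pi>(a)x\<parallel>\<^sup>2 \<le> M\<parallel>x\<parallel>\<^sup>2\<close>, then \<open>M\<close> is an approximate eigenvalue
  of \<open>\<pi>(a\<^sup>*a)\<close>, so that \<open>M - a\<^sup>*a\<close> cannot be invertible; hence \<open>M \<le> \<parallel>a\<^sup>*a\<parallel>\<close>.\<close>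

theorem rep_contractive:
  assumes x: "x \<in> carrier H"
  shows "hnorm H (\<pi> a x) \<le> norm a * hnorm H x"
proof -
  define B where "B = {C. C \<ge> 0 \<and> (\<forall>x\<in>carrier H. (hnorm H (\<pi> a x))\<^sup>2 \<le> C * (hnorm H x)\<^sup>2)}"
  define M where "M = Inf B"
  obtain C where C: "C \<ge> 0" "\<And>x. x \<in> carrier H \<Longrightarrow> hnorm H (\<pi> a x) \<le> C * hnorm H x"
    using bounded_operators_bound[OF complex_hilbert_space_axioms rep_bounded[of a]] by blast
  have "C\<^sup>2 \<in> B"
    using C by (auto simp: B_def power_mult_distrib[symmetric] intro!: power_mono)
  then have ne: "B \<noteq> {}" by blast
  have bdd: "bdd_below B" by (auto simp: B_def bdd_below_def)
  have M0: "M \<ge> 0"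
    unfolding M_def by (rule cInf_greatest[OF ne]) (simp add: B_def)
  have M: "(hnorm H (\<pi> a x))\<^sup>2 \<le> M * (hnorm H x)\<^sup>2" if x: "x \<in> carrier H" for x
  proof (cases "x = \<zero>")
    case True
    then show ?thesis
      using bounded_operators_zero[OF complex_hilbert_space_axioms complex_hilbert_space_axioms rep_bounded[of a]] by simp
  next
    case False
    then have n: "(hnorm H x)\<^sup>2 > 0" using x by simp
    have "(hnorm H (\<pi> a x))\<^sup>2 / (hnorm H x)\<^sup>2 \<le> M"
      unfolding M_def by (rule cInf_greatest[OF ne]) (use n x in \<open>auto simp: B_def pos_divide_le_eq\<close>)
    then show ?thesis using n by (simp add: pos_divide_le_eq)
  qed
  have "M \<le> (norm a)\<^sup>2"
  proof (rule ccontr)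
    assume "\<not> M \<le> (norm a)\<^sup>2"
    then have less: "(norm a)\<^sup>2 < M" by simp
    then have Mpos: "M > 0" by (smt (verit) zero_le_power2)
    define s where "s = star a * a"
    have "norm ((1 / M) *\<^sub>R s) < 1"
      using less Mpos cstar_identity[of a] by (simp add: s_def)
    then obtain b where b: "b * (1 - (1 / M) *\<^sub>R s) = 1"
      using Neumann_inverse by blast
    obtain D where D: "D \<ge> 0" "\<And>x. x \<in> carrier H \<Longrightarrow> hnorm H (\<pi> b x) \<le> D * hnorm H x"
      using bounded_operators_bound[OF complex_hilbert_space_axioms rep_bounded[of b]] by blast
    \<comment> \<open>\<open>D\<close> bounds the left inverse b of 1 - s/M, so that this operator
      shrinks square norms at most by the factor \<open>E\<close>. The added 1 keeps
      \<open>E\<close> positive for the division by it.\<close>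
    define E where "E = D\<^sup>2 + 1"
    have E: "E > 0" using zero_le_power2[of D] by (simp add: E_def add_nonneg_pos)
    \<comment> \<open>The argument below improves the constant M to M - M/E. The maximum with 0
      keeps it in \<open>B\<close>, whose elements are nonnegative, and it is still smaller than the
      infimum M.\<close>
    define C' where "C' = max 0 (M - M / E)"
    have "(hnorm H (\<pi> a x))\<^sup>2 \<le> C' * (hnorm H x)\<^sup>2" if x: "x \<in> carrier H" for x
    proof -
      have sc: "(1 / M) *\<^sub>R s = complex_of_real (1 / M) *\<^sub>C s"
        by (rule scaleC_of_real[symmetric])
      define y where "y = \<pi> (1 - (1 / M) *\<^sub>R s) x"
      have yc: "y \<in> carrier H" using x by (simp add: y_def)
      have y: "y = x \<ominus> complex_of_real (1 / M) \<odot> \<pi> s x"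
        unfolding y_def sc using x by (simp add: rep_diff rep_scaleC)
      have "\<pi> b y = x"
        unfolding y_def using x b by (simp add: rep_mult[symmetric])
      then have "(hnorm H x)\<^sup>2 \<le> (D * hnorm H y)\<^sup>2"
        using D(2)[OF yc] x by (intro power_mono) auto
      also have "\<dots> \<le> E * (hnorm H y)\<^sup>2"
        by (simp add: power_mult_distrib E_def mult_right_mono)
      finally have xy: "(hnorm H x)\<^sup>2 \<le> E * (hnorm H y)\<^sup>2" .
      have ax: "Re (cinner H x (\<pi> s x)) = (hnorm H (\<pi> a x))\<^sup>2"
        using x rep_star[of x "\<pi> a x" a] by (simp add: hnorm_square s_def rep_mult)
      \<comment> \<open>Cauchy-Schwarz for ||sx||^2 = <ax, asx>, with the bound M applied at the
        vector sx. After squaring, a factor ||sx||^2 cancels, so the case sx = 0 is treated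
        apart.\<close>
      have "(hnorm H (\<pi> s x))\<^sup>2 \<le> M * (hnorm H (\<pi> a x))\<^sup>2"
      proof (cases "\<pi> s x = \<zero>")
        case True
        then show ?thesis using M0 by simp
      next
        case False
        have "(hnorm H (\<pi> s x))\<^sup>2 = Re (cinner H (\<pi> (star a) (\<pi> a x)) (\<pi> s x))"
          using x by (simp add: hnorm_square s_def rep_mult)
        also have "\<dots> = Re (cinner H (\<pi> a x) (\<pi> a (\<pi> s x)))"
          using x by (simp add: rep_star star_star)
        also have "\<dots> \<le> hnorm H (\<pi> a x) * hnorm H (\<pi> a (\<pi> s x))"
          using Cauchy_Schwarz[of "\<pi> a x" "\<pi> a (\<pi> s x)"] x by (intro order_trans[OF complex_Re_le_cmod]) auto
        finally have "((hnorm H (\<pi> s x))\<^sup>2)\<^sup>2 \<le> (hnorm H (\<pi> a x) * hnorm H (\<pi> a (\<pi> s x)))\<^sup>2"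
          by (intro power_mono) auto
        also have "\<dots> \<le> (hnorm H (\<pi> a x))\<^sup>2 * (M * (hnorm H (\<pi> s x))\<^sup>2)"
          unfolding power_mult_distrib using M[of "\<pi> s x"] x by (intro mult_left_mono) auto
        finally have "(hnorm H (\<pi> s x))\<^sup>2 * (hnorm H (\<pi> s x))\<^sup>2 \<le> (M * (hnorm H (\<pi> a x))\<^sup>2) * (hnorm H (\<pi> s x))\<^sup>2"
          by (simp add: power2_eq_square mult_ac)
        moreover have "(hnorm H (\<pi> s x))\<^sup>2 > 0"
          using False x by simp
        ultimately show ?thesis
          by (simp only: mult_le_cancel_right_pos)
      qed
      moreover have "(hnorm H y)\<^sup>2 = (hnorm H x)\<^sup>2 - 2 / M * (hnorm H (\<pi> a x))\<^sup>2 + (1 / M)\<^sup>2 * (hnorm H (\<pi> s x))\<^sup>2"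
        unfolding y using x Mpos
        by (simp add: hnorm_diff_square cinner_smult_right ax hnorm_smult norm_divide power_divide)
      ultimately have "(hnorm H y)\<^sup>2 \<le> (hnorm H x)\<^sup>2 - 2 / M * (hnorm H (\<pi> a x))\<^sup>2 + (1 / M)\<^sup>2 * (M * (hnorm H (\<pi> a x))\<^sup>2)"
        by (simp add: mult_left_mono)
      also have "\<dots> = (hnorm H x)\<^sup>2 - (hnorm H (\<pi> a x))\<^sup>2 / M"
        using Mpos by (simp add: power2_eq_square field_simps)
      finally have "(hnorm H x)\<^sup>2 \<le> E * ((hnorm H x)\<^sup>2 - (hnorm H (\<pi> a x))\<^sup>2 / M)"
        using xy E by (meson less_imp_le mult_left_mono order_trans)
      then have "(hnorm H (\<pi> a x))\<^sup>2 \<le> (M - M / E) * (hnorm H x)\<^sup>2"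
        using E Mpos by (simp add: field_simps)
      also have "\<dots> \<le> C' * (hnorm H x)\<^sup>2"
        unfolding C'_def by (intro mult_right_mono) auto
      finally show ?thesis .
    qed
    then have "C' \<in> B" by (simp add: B_def C'_def)
    then have "M \<le> C'" unfolding M_def using bdd by (rule cInf_lower)
    moreover have "C' < M" using Mpos E by (simp add: C'_def)
    ultimately show False by simp
  qed
  then have "(hnorm H (\<pi> a x))\<^sup>2 \<le> (norm a)\<^sup>2 * (hnorm H x)\<^sup>2"
    using M[OF x] by (meson mult_right_mono order_trans zero_le_power2)
  then show ?thesis
    unfolding power_mult_distrib[symmetric] by (rule power2_le_imp_le) (simp add: x)
qed

end

section \<open>Right covariant representations and the convolution algebra\<close>

locale dynamical_system =
  fixes \<alpha> :: "'p::monoid_mult \<Rightarrow> 'a::unital_cstar_algebra \<Rightarrow> 'a"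
  assumes system: "semigroup_dynamical_system \<alpha>"
begin

lemma endomorphism: "star_endomorphism (\<alpha> p)"
  using system unfolding semigroup_dynamical_system_def by blast

lemma action_add: "\<alpha> p (a + b) = \<alpha> p a + \<alpha> p b"
  using endomorphism[of p] unfolding star_endomorphism_def by blast

lemma action_zero [simp]: "\<alpha> p 0 = 0"
  using action_add[of p 0 0] by simp

lemma action_one [simp]: "\<alpha> 1 a = a"
  using system unfolding semigroup_dynamical_system_def by (metis id_apply)

end

locale right_covariant_rep = dynamical_system \<alpha>
  for \<alpha> :: "'p::monoid_mult \<Rightarrow> 'a::unital_cstar_algebra \<Rightarrow> 'a" +
  fixes H :: "'h hilbert" (structure) and \<pi> :: "'a \<Rightarrow> 'h \<Rightarrow> 'h" and V :: "'p \<Rightarrow> 'h \<Rightarrow> 'h"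
  assumes right_covariant: "isometric_right_covariant_rep \<alpha> H \<pi> V"
begin

lemma hilbert_space: "complex_hilbert_space H"
  using right_covariant unfolding isometric_right_covariant_rep_def by blast

sublocale cstar_rep H \<pi>
proof (intro cstar_rep.intro cstar_rep_axioms.intro hilbert_space)
  show "unital_star_representation H \<pi>"
    using right_covariant unfolding isometric_right_covariant_rep_def by blast
qed

lemma isometric_rep: "isometric_representation H V"
  using right_covariant unfolding isometric_right_covariant_rep_def by blast

lemma V_isometry: "isometry H H (V p)"
  using isometric_rep unfolding isometric_representation_def by blast

lemma V_bounded: "V p \<in> bounded_operators H H"
  using V_isometry[of p] unfolding isometry_def by blast

lemma V_closed [simp]: "x \<in> carrier H \<Longrightarrow> V p x \<in> carrier H"
  using V_bounded by (rule bounded_operators_closed)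

lemma V_norm [simp]: "x \<in> carrier H \<Longrightarrow> hnorm H (V p x) = hnorm H x"
  using V_isometry[of p] unfolding isometry_def by blast

lemma V_compose: "V (p * q) = compose (carrier H) (V p) (V q)"
  using isometric_rep unfolding isometric_representation_def by blast

lemma V_mult: "x \<in> carrier H \<Longrightarrow> V (p * q) x = V p (V q x)"
  by (simp add: V_compose compose_eq)

lemma V_id: "V 1 = (\<lambda>x\<in>carrier H. x)"
  using isometric_rep unfolding isometric_representation_def by blast

lemma V_one [simp]: "x \<in> carrier H \<Longrightarrow> V 1 x = x"
  by (simp add: V_id)

lemma covariance_compose: "compose (carrier H) (V p) (\<pi> a) = compose (carrier H) (\<pi> (\<alpha> p a)) (V p)"
  using right_covariant unfolding isometric_right_covariant_rep_def by blast

lemma covariance: "x \<in> carrier H \<Longrightarrow> V p (\<pi> a x) = \<pi> (\<alpha> p a) (V p x)"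
  using fun_cong[OF covariance_compose[of p a], of x] by (simp add: compose_eq)

abbreviation "\<Phi> \<equiv> c00_hom H \<pi> V"

lemma hom_eq: "x \<in> carrier H \<Longrightarrow> \<Phi> f x = (\<Oplus>p\<in>Poly_Mapping.keys f. \<pi> (Poly_Mapping.lookup f p) (V p x))"
  by (simp add: c00_hom_def)

text \<open>The support of a sum or of a multiple can shrink by cancellation; comparing two elements
  needs a common finite index set that may be larger than either support.\<close>

lemma hom_eq_superset:
  assumes x: "x \<in> carrier H" and A: "finite A" "Poly_Mapping.keys f \<subseteq> A"
  shows "\<Phi> f x = (\<Oplus>p\<in>A. \<pi> (Poly_Mapping.lookup f p) (V p x))"
  unfolding hom_eq[OF x]
  by (rule M.add.finprod_mono_neutral_cong_left) (use x A in \<open>auto simp: in_keys_iff\<close>)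

lemma hom_closed [simp]: "x \<in> carrier H \<Longrightarrow> \<Phi> f x \<in> carrier H"
  unfolding hom_eq by (rule M.finsum_closed) simp

lemma hom_add: 
  assumes x: "x \<in> carrier H"
  shows "\<Phi> (f + g) x = \<Phi> f x \<oplus> \<Phi> g x"
proof -
  let ?A = "Poly_Mapping.keys f \<union> Poly_Mapping.keys g"
  have "\<Phi> (f + g) x = (\<Oplus>p\<in>?A. \<pi> (Poly_Mapping.lookup (f + g) p) (V p x))"
    using keys_add[of f g] by (intro hom_eq_superset[OF x]) auto
  also have "\<dots> = (\<Oplus>p\<in>?A. \<pi> (Poly_Mapping.lookup f p) (V p x) \<oplus> \<pi> (Poly_Mapping.lookup g p) (V p x))"
    using x by (intro M.finsum_cong') (auto simp: lookup_add rep_add)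
  also have "\<dots> = (\<Oplus>p\<in>?A. \<pi> (Poly_Mapping.lookup f p) (V p x)) \<oplus> (\<Oplus>p\<in>?A. \<pi> (Poly_Mapping.lookup g p) (V p x))"
    using x by (intro M.finsum_addf) auto
  also have "(\<Oplus>p\<in>?A. \<pi> (Poly_Mapping.lookup f p) (V p x)) = \<Phi> f x"
    by (rule hom_eq_superset[OF x, symmetric]) auto
  also have "(\<Oplus>p\<in>?A. \<pi> (Poly_Mapping.lookup g p) (V p x)) = \<Phi> g x"
    by (rule hom_eq_superset[OF x, symmetric]) auto
  finally show ?thesis .
qed

lemma hom_zero [simp]: "x \<in> carrier H \<Longrightarrow> \<Phi> 0 x = \<zero>"
  by (simp add: hom_eq)

lemma lookup_c00_scale: "Poly_Mapping.lookup (c00_scale c f) p = c *\<^sub>C Poly_Mapping.lookup f p"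
  unfolding c00_scale_def by (transfer fixing: c) (simp add: when_def)

lemma hom_scale:
  assumes x: "x \<in> carrier H"
  shows "\<Phi> (c00_scale c f) x = c \<odot> \<Phi> f x"
proof -
  let ?A = "Poly_Mapping.keys f"
  have sub: "Poly_Mapping.keys (c00_scale c f) \<subseteq> ?A"
    by (auto simp: in_keys_iff lookup_c00_scale)
  have "\<Phi> (c00_scale c f) x = (\<Oplus>p\<in>?A. \<pi> (Poly_Mapping.lookup (c00_scale c f) p) (V p x))"
    by (rule hom_eq_superset[OF x _ sub]) simp
  also have "\<dots> = (\<Oplus>p\<in>?A. c \<odot> \<pi> (Poly_Mapping.lookup f p) (V p x))"
    using x by (intro M.finsum_cong') (auto simp: lookup_c00_scale rep_scaleC)
  also have "\<dots> = c \<odot> (\<Oplus>p\<in>?A. \<pi> (Poly_Mapping.lookup f p) (V p x))"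
    using x by (intro finsum_additive[OF hilbert_space hilbert_space, where g = "\<lambda>v. c \<odot> v", symmetric])
      (auto simp: smult_add_right)
  finally show ?thesis by (simp add: hom_eq x)
qed

lemma c00_scale_minus_one: "c00_scale (-1) f = - f"
  by (rule poly_mapping_eqI) (simp add: lookup_c00_scale scaleC_minus_one)

lemma hom_uminus: "x \<in> carrier H \<Longrightarrow> \<Phi> (- f) x = \<ominus> \<Phi> f x"
  using hom_scale[of x "-1" f] by (simp add: c00_scale_minus_one minus_eq_smult)

lemma hom_diff: "x \<in> carrier H \<Longrightarrow> \<Phi> (f - g) x = \<Phi> f x \<ominus> \<Phi> g x"
  using hom_add[of x f "- g"] by (simp add: hom_uminus M.minus_eq)

lemma hom_single: 
  assumes x: "x \<in> carrier H"
  shows "\<Phi> (Poly_Mapping.single p a) x = \<pi> a (V p x)"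
proof -
  have "\<Phi> (Poly_Mapping.single p a) x = (\<Oplus>q\<in>{p}. \<pi> (Poly_Mapping.lookup (Poly_Mapping.single p a) q) (V q x))"
    by (rule hom_eq_superset[OF x]) auto
  also have "\<dots> = \<pi> a (V p x)"
    using x by (simp add: M.finsum_insert)
  finally show ?thesis .
qed

lemma hom_sum:
  assumes x: "x \<in> carrier H" and "finite A"
  shows "\<Phi> (sum f A) x = (\<Oplus>i\<in>A. \<Phi> (f i) x)"
  using assms(2)
proof (induction A rule: finite_induct)
  case (insert i A)
  then have "(\<Oplus>i\<in>insert i A. \<Phi> (f i) x) = \<Phi> (f i) x \<oplus> (\<Oplus>i\<in>A. \<Phi> (f i) x)"
    using x by (intro M.finsum_insert) auto
  then show ?case
    using insert x by (simp add: hom_add)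
qed (use x in simp)

text \<open>Since \<open>\<pi>\<close> is contractive and V_p is isometric, the constant depends on
  f alone and not on the representation.\<close>

lemma hom_bound:
  assumes x: "x \<in> carrier H"
  shows "hnorm H (\<Phi> f x) \<le> (\<Sum>p\<in>Poly_Mapping.keys f. norm (Poly_Mapping.lookup f p)) * hnorm H x"
proof -
  have "hnorm H (\<Phi> f x) \<le> (\<Sum>p\<in>Poly_Mapping.keys f. hnorm H (\<pi> (Poly_Mapping.lookup f p) (V p x)))"
    unfolding hom_eq[OF x] using x by (intro hnorm_finsum) auto
  also have "\<dots> \<le> (\<Sum>p\<in>Poly_Mapping.keys f. norm (Poly_Mapping.lookup f p) * hnorm H x)"
  proof (rule sum_mono)
    fix p
    show "hnorm H (\<pi> (Poly_Mapping.lookup f p) (V p x)) \<le> norm (Poly_Mapping.lookup f p) * hnorm H x"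
      using rep_contractive[of "V p x" "Poly_Mapping.lookup f p"] x by simp
  qed
  finally show ?thesis by (simp add: sum_distrib_right)
qed

text \<open>Right covariance moves V_p past \<open>\<pi> b\<close> at the price of turning b into
  \<open>\<alpha> p b\<close>, which is exactly the twist in \<open>c00_mult\<close>.\<close>

lemma hom_mult:
  assumes x: "x \<in> carrier H"
  shows "\<Phi> (c00_mult \<alpha> f g) x = \<Phi> f (\<Phi> g x)"
proof -
  let ?F = "Poly_Mapping.keys f" and ?G = "Poly_Mapping.keys g"
  let ?f = "Poly_Mapping.lookup f" and ?g = "Poly_Mapping.lookup g"
  have "\<Phi> (c00_mult \<alpha> f g) x =
      (\<Oplus>p\<in>?F. \<Phi> (\<Sum>q\<in>?G. Poly_Mapping.single (p * q) (?f p * \<alpha> p (?g q))) x)"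
    unfolding c00_mult_def by (rule hom_sum[OF x]) simp
  also have "\<dots> = (\<Oplus>p\<in>?F. \<pi> (?f p) (V p (\<Phi> g x)))"
  proof (rule M.finsum_cong')
    fix p assume "p \<in> ?F"
    have "\<Phi> (\<Sum>q\<in>?G. Poly_Mapping.single (p * q) (?f p * \<alpha> p (?g q))) x =
        (\<Oplus>q\<in>?G. \<Phi> (Poly_Mapping.single (p * q) (?f p * \<alpha> p (?g q))) x)"
      by (rule hom_sum[OF x]) simp
    also have "\<dots> = (\<Oplus>q\<in>?G. \<pi> (?f p) (V p (\<pi> (?g q) (V q x))))"
      using x by (intro M.finsum_cong') (auto simp: hom_single V_mult rep_mult covariance)
    also have "\<dots> = \<pi> (?f p) (\<Oplus>q\<in>?G. V p (\<pi> (?g q) (V q x)))"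
      using x by (intro bounded_operators_finsum[symmetric, OF hilbert_space hilbert_space rep_bounded]) auto
    also have "(\<Oplus>q\<in>?G. V p (\<pi> (?g q) (V q x))) = V p (\<Oplus>q\<in>?G. \<pi> (?g q) (V q x))"
      using x by (intro bounded_operators_finsum[symmetric, OF hilbert_space hilbert_space V_bounded]) auto
    finally show "\<Phi> (\<Sum>q\<in>?G. Poly_Mapping.single (p * q) (?f p * \<alpha> p (?g q))) x = \<pi> (?f p) (V p (\<Phi> g x))"
      by (simp add: hom_eq x)
  qed (use x in auto)
  also have "\<dots> = \<Phi> f (\<Phi> g x)"
    using x by (simp add: hom_eq[of "\<Phi> g x"])
  finally show ?thesis .
qed

lemma hom_add_vec:
  assumes "x \<in> carrier H" "y \<in> carrier H"
  shows "\<Phi> f (x \<oplus> y) = \<Phi> f x \<oplus> \<Phi> f y"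
proof -
  have "\<Phi> f (x \<oplus> y) = (\<Oplus>p\<in>Poly_Mapping.keys f.
      \<pi> (Poly_Mapping.lookup f p) (V p x) \<oplus> \<pi> (Poly_Mapping.lookup f p) (V p y))"
    unfolding hom_eq[OF M.a_closed[OF assms]] using assms
    by (intro M.finsum_cong') (auto simp: bounded_operators_add[OF V_bounded] bounded_operators_add[OF rep_bounded])
  also have "\<dots> = \<Phi> f x \<oplus> \<Phi> f y"
    unfolding hom_eq[OF assms(1)] hom_eq[OF assms(2)] using assms by (intro M.finsum_addf) auto
  finally show ?thesis .
qed

lemma hom_smult_vec:
  assumes "x \<in> carrier H"
  shows "\<Phi> f (c \<odot> x) = c \<odot> \<Phi> f x"
proof -
  have "\<Phi> f (c \<odot> x) = (\<Oplus>p\<in>Poly_Mapping.keys f. c \<odot> \<pi> (Poly_Mapping.lookup f p) (V p x))"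
    unfolding hom_eq[OF smult_closed'[OF assms]] using assms
    by (intro M.finsum_cong') (auto simp: bounded_operators_smult[OF V_bounded] bounded_operators_smult[OF rep_bounded])
  also have "\<dots> = c \<odot> \<Phi> f x"
    unfolding hom_eq[OF assms] using assms
    by (intro finsum_additive[OF hilbert_space hilbert_space, where g = "\<lambda>v. c \<odot> v", symmetric])
      (auto simp: smult_add_right)
  finally show ?thesis .
qed

lemma hom_bounded: "\<Phi> f \<in> bounded_operators H H"
  by (rule bounded_operatorsI[OF _ hom_closed hom_add_vec hom_smult_vec hom_bound])
    (simp_all add: c00_hom_def extensional_def)

end

section \<open>Restriction of right covariant representations to invariant subspaces\<close>

context right_covariant_rep
begin

text \<open>A subspace invariant under \<open>\<pi>\<close> reduces it, because the adjoints are
  again values of \<open>\<pi>\<close>; so the restriction is still a star representation. For V_p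
  invariance is enough, as the restriction of an isometry is an isometry. The second claim says that
  j intertwines the two homomorphisms of the convolution algebra.\<close>

lemma pull_right_covariant:
  assumes emb: "hilbert_embedding H G j"
    and inv_rep: "\<And>a x. x \<in> carrier G \<Longrightarrow> \<pi> a (j x) \<in> j ` carrier G"
    and inv_V: "\<And>p x. x \<in> carrier G \<Longrightarrow> V p (j x) \<in> j ` carrier G"
  defines "P \<equiv> hilbert_embedding.pull G j"
  shows "right_covariant_rep \<alpha> G (\<lambda>a. P (\<pi> a)) (\<lambda>p. P (V p))"
    and "x \<in> carrier G \<Longrightarrow> j (c00_hom G (\<lambda>a. P (\<pi> a)) (\<lambda>p. P (V p)) f x) = \<Phi> f (j x)"
proof -
  interpret E: hilbert_embedding H G j by (rule emb)
  have pr: "E.pull (\<pi> a) x \<in> carrier G" "j (E.pull (\<pi> a) x) = \<pi> a (j x)" if "x \<in> carrier G" for a x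
    using E.emb_pull[of "\<pi> a" x] inv_rep that by auto
  have pv: "E.pull (V p) x \<in> carrier G" "j (E.pull (V p) x) = V p (j x)" if "x \<in> carrier G" for p x
    using E.emb_pull[of "V p" x] inv_V that by auto
  have rep: "unital_star_representation G (\<lambda>a. P (\<pi> a))"
    unfolding unital_star_representation_def P_def
  proof (intro conjI allI ballI)
    show "E.pull (\<pi> a) \<in> bounded_operators G G" for a
      by (rule E.pull_bounded[OF rep_bounded inv_rep])
    show "E.pull (\<pi> (a + b)) x = E.pull (\<pi> a) x \<oplus>\<^bsub>G\<^esub> E.pull (\<pi> b) x" if "x \<in> carrier G" for a b x
      by (rule E.emb_eqI) (use that pr E.emb_closed in \<open>simp_all add: E.emb_add rep_add\<close>)
    show "E.pull (\<pi> (c *\<^sub>C a)) x = c \<odot>\<^bsub>G\<^esub> E.pull (\<pi> a) x" if "x \<in> carrier G" for c a x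
      by (rule E.emb_eqI) (use that pr E.emb_closed in \<open>simp_all add: E.emb_smult rep_scaleC\<close>)
    show "E.pull (\<pi> (a * b)) = compose (carrier G) (E.pull (\<pi> a)) (E.pull (\<pi> b))" for a b
      unfolding rep_compose by (rule E.pull_compose) (rule inv_rep, assumption)+
    show "E.pull (\<pi> (star a)) = adjoint G G (E.pull (\<pi> a))" for a
      by (rule E.pull_adjoint[OF rep_bounded rep_bounded inv_rep inv_rep rep_star, symmetric])
    show "E.pull (\<pi> 1) = (\<lambda>x\<in>carrier G. x)"
      unfolding E.pull_def using E.emb_closed E.emb_inj by (intro restrict_ext) simp
  qed
  have iso: "isometric_representation G (\<lambda>p. P (V p))"
    unfolding isometric_representation_def isometry_def P_def
  proof (intro conjI allI ballI)
    show "E.pull (V p) \<in> bounded_operators G G" for p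
      by (rule E.pull_bounded[OF V_bounded inv_V])
    show "hnorm G (E.pull (V p) x) = hnorm G x" if "x \<in> carrier G" for p x
      using that pv E.emb_closed by (simp add: E.hnorm_emb[symmetric])
    show "E.pull (V (p * q)) = compose (carrier G) (E.pull (V p)) (E.pull (V q))" for p q
      unfolding V_compose by (rule E.pull_compose) (rule inv_V, assumption)+
    show "E.pull (V 1) = (\<lambda>x\<in>carrier G. x)"
      unfolding E.pull_def using E.emb_closed E.emb_inj by (intro restrict_ext) simp
  qed
  have cov: "compose (carrier G) (P (V p)) (P (\<pi> a)) = compose (carrier G) (P (\<pi> (\<alpha> p a))) (P (V p))" for p a
    unfolding P_def using E.pull_compose[of "V p" "\<pi> a"] E.pull_compose[of "\<pi> (\<alpha> p a)" "V p"] inv_rep inv_V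
    by (simp add: covariance_compose)
  show G: "right_covariant_rep \<alpha> G (\<lambda>a. P (\<pi> a)) (\<lambda>p. P (V p))"
  proof (intro right_covariant_rep.intro right_covariant_rep_axioms.intro dynamical_system_axioms)
    show "isometric_right_covariant_rep \<alpha> G (\<lambda>a. P (\<pi> a)) (\<lambda>p. P (V p))"
      unfolding isometric_right_covariant_rep_def
      using E.hilbert_space_G rep iso cov by blast
  qed
  show "j (c00_hom G (\<lambda>a. P (\<pi> a)) (\<lambda>p. P (V p)) f x) = \<Phi> f (j x)" if x: "x \<in> carrier G"
  proof -
    interpret G: right_covariant_rep \<alpha> G "\<lambda>a. P (\<pi> a)" "\<lambda>p. P (V p)" by (rule G)
    have jx: "j x \<in> carrier H" using x by (rule E.emb_closed)
    have "j (c00_hom G (\<lambda>a. P (\<pi> a)) (\<lambda>p. P (V p)) f x) =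
        (\<Oplus>p\<in>Poly_Mapping.keys f. j (P (\<pi> (Poly_Mapping.lookup f p)) (P (V p) x)))"
      unfolding G.hom_eq[OF x] by (rule E.emb_finsum) (use x in auto)
    also have "\<dots> = (\<Oplus>p\<in>Poly_Mapping.keys f. \<pi> (Poly_Mapping.lookup f p) (V p (j x)))"
    proof (rule M.finsum_cong')
      fix p
      show "j (P (\<pi> (Poly_Mapping.lookup f p)) (P (V p) x)) = \<pi> (Poly_Mapping.lookup f p) (V p (j x))"
        unfolding P_def using x pr(2)[OF pv(1)[OF x]] pv(2)[OF x] by simp
    qed (use jx in auto)
    finally show ?thesis by (simp add: hom_eq jx)
  qed
qed

end

section \<open>Cyclic subspaces and their copies in the universe type\<close>

locale cyclic_subspace = right_covariant_rep \<alpha> H \<pi> V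
  for \<alpha> :: "'p::monoid_mult \<Rightarrow> 'a::unital_cstar_algebra \<Rightarrow> 'a"
    and H :: "'h hilbert" (structure) and \<pi> :: "'a \<Rightarrow> 'h \<Rightarrow> 'h" and V :: "'p \<Rightarrow> 'h \<Rightarrow> 'h" +
  fixes n :: nat and \<xi> :: "nat \<Rightarrow> 'h"
  assumes \<xi>: "\<And>i. i < n \<Longrightarrow> \<xi> i \<in> carrier H"
begin

definition comb :: "(nat \<Rightarrow> 'p \<Rightarrow>\<^sub>0 'a) \<Rightarrow> 'h" where
  "comb s = (\<Oplus>i\<in>{..<n}. \<Phi> (s i) (\<xi> i))"

text \<open>The closed invariant subspace generated by the \<open>\<xi> i\<close>. Describing the
  closure by sequences gives every vector a name of type \<open>rep_universe\<close>.\<close>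

definition cyclic_span :: "'h set" where
  "cyclic_span = {x. \<exists>s. converges_to (\<lambda>k. comb (s k)) x}"

lemma comb_closed [simp]: "comb s \<in> carrier H"
  unfolding comb_def by (rule M.finsum_closed) (use \<xi> in auto)

lemma comb_add: "comb (\<lambda>i. s i + t i) = comb s \<oplus> comb t"
proof -
  have "comb (\<lambda>i. s i + t i) = (\<Oplus>i\<in>{..<n}. \<Phi> (s i) (\<xi> i) \<oplus> \<Phi> (t i) (\<xi> i))"
    unfolding comb_def using \<xi> by (intro M.finsum_cong') (auto simp: hom_add)
  then show ?thesis
    unfolding comb_def using M.finsum_addf[of "\<lambda>i. \<Phi> (s i) (\<xi> i)" "{..<n}" "\<lambda>i. \<Phi> (t i) (\<xi> i)"] \<xi>
    by auto
qed

lemma comb_operator: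
  assumes T: "T \<in> bounded_operators H H" and eq: "\<And>i. i < n \<Longrightarrow> \<Phi> (t i) (\<xi> i) = T (\<Phi> (s i) (\<xi> i))"
  shows "comb t = T (comb s)"
proof -
  have "comb t = (\<Oplus>i\<in>{..<n}. T (\<Phi> (s i) (\<xi> i)))"
    unfolding comb_def using \<xi> by (intro M.finsum_cong') (auto simp: eq intro!: bounded_operators_closed[OF T])
  also have "\<dots> = T (comb s)"
    unfolding comb_def using \<xi> by (intro bounded_operators_finsum[symmetric, OF hilbert_space hilbert_space T]) auto
  finally show ?thesis .
qed

lemma span_closed: "x \<in> cyclic_span \<Longrightarrow> x \<in> carrier H"
  by (auto simp: cyclic_span_def converges_to_def)

lemma comb_in_span: "comb s \<in> cyclic_span"
  unfolding cyclic_span_def using converges_to_const[OF comb_closed[of s]] by auto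

lemma span_add: "x \<in> cyclic_span \<Longrightarrow> y \<in> cyclic_span \<Longrightarrow> x \<oplus> y \<in> cyclic_span"
proof -
  assume "x \<in> cyclic_span" "y \<in> cyclic_span"
  then obtain s t where "converges_to (\<lambda>k. comb (s k)) x" "converges_to (\<lambda>k. comb (t k)) y"
    by (auto simp: cyclic_span_def)
  from converges_to_add[OF this] have "converges_to (\<lambda>k. comb (\<lambda>i. s k i + t k i)) (x \<oplus> y)"
    by (simp add: comb_add)
  then show ?thesis unfolding cyclic_span_def by (intro CollectI exI[of _ "\<lambda>k i. s k i + t k i"])
qed

text \<open>An operator that acts on the vectors \<open>\<Phi> s (\<xi> i)\<close> through a map t
  of the coefficients carries approximating sequences to approximating sequences. It is applied with
  t the left multiplication by \<open>Poly_Mapping.single 1 a\<close> and by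
  \<open>Poly_Mapping.single p 1\<close>.\<close>

lemma span_operator:
  assumes T: "T \<in> bounded_operators H H" and t: "\<And>s i. i < n \<Longrightarrow> \<Phi> (t s) (\<xi> i) = T (\<Phi> s (\<xi> i))"
    and x: "x \<in> cyclic_span"
  shows "T x \<in> cyclic_span"
proof -
  obtain s where "converges_to (\<lambda>k. comb (s k)) x"
    using x by (auto simp: cyclic_span_def)
  from bounded_operators_converges_to[OF hilbert_space hilbert_space T this]
  have "converges_to (\<lambda>k. T (comb (s k))) (T x)" .
  moreover have "T (comb (s k)) = comb (\<lambda>i. t (s k i))" for k
    by (rule comb_operator[OF T, symmetric]) (simp add: t)
  ultimately have "converges_to (\<lambda>k. comb (\<lambda>i. t (s k i))) (T x)" by simp
  then show ?thesis unfolding cyclic_span_def by (intro CollectI exI[of _ "\<lambda>k i. t (s k i)"])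
qed

lemma span_smult:
  assumes "x \<in> cyclic_span"
  shows "c \<odot> x \<in> cyclic_span"
proof -
  obtain s where "converges_to (\<lambda>k. comb (s k)) x"
    using assms by (auto simp: cyclic_span_def)
  from converges_to_smult[OF this] have "converges_to (\<lambda>k. c \<odot> comb (s k)) (c \<odot> x)" .
  moreover have "c \<odot> comb (s k) = comb (\<lambda>i. c00_scale c (s k i))" for k
  proof -
    have "comb (\<lambda>i. c00_scale c (s k i)) = (\<Oplus>i\<in>{..<n}. c \<odot> \<Phi> (s k i) (\<xi> i))"
      unfolding comb_def using \<xi> by (intro M.finsum_cong') (auto simp: hom_scale)
    also have "\<dots> = c \<odot> comb (s k)"
      unfolding comb_def using \<xi>
      by (intro finsum_additive[OF hilbert_space hilbert_space, where g = "\<lambda>v. c \<odot> v", symmetric])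
        (auto simp: smult_add_right)
    finally show ?thesis by simp
  qed
  ultimately have "converges_to (\<lambda>k. comb (\<lambda>i. c00_scale c (s k i))) (c \<odot> x)" by simp
  then show ?thesis unfolding cyclic_span_def by (intro CollectI exI[of _ "\<lambda>k i. c00_scale c (s k i)"])
qed

lemma span_rep: "x \<in> cyclic_span \<Longrightarrow> \<pi> a x \<in> cyclic_span"
  by (rule span_operator[OF rep_bounded, where t = "c00_mult \<alpha> (Poly_Mapping.single 1 a)"])
    (simp_all add: hom_mult hom_single \<xi>)

lemma span_V: "x \<in> cyclic_span \<Longrightarrow> V p x \<in> cyclic_span"
  by (rule span_operator[OF V_bounded, where t = "c00_mult \<alpha> (Poly_Mapping.single p 1)"])
    (simp_all add: hom_mult hom_single \<xi>)

lemma span_vec: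
  assumes i: "i < n"
  shows "\<xi> i \<in> cyclic_span"
proof -
  have "comb (\<lambda>k. if i = k then Poly_Mapping.single 1 1 else 0) = (\<Oplus>k\<in>{..<n}. if i = k then \<xi> k else \<zero>)"
    unfolding comb_def by (rule M.finsum_cong') (use \<xi> in \<open>auto simp: hom_single\<close>)
  also have "\<dots> = \<xi> i"
    by (rule M.finsum_singleton) (use i \<xi> in auto)
  finally show ?thesis
    using comb_in_span by metis
qed

lemma span_zero: "\<zero> \<in> cyclic_span"
proof -
  have "comb (\<lambda>_. 0) = (\<Oplus>i\<in>{..<n}. \<zero>)"
    unfolding comb_def by (rule M.finsum_cong') (use \<xi> in auto)
  then have "comb (\<lambda>_. 0) = \<zero>" by (simp add: M.finsum_zero)
  then show ?thesis using comb_in_span by metis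
qed

text \<open>A diagonal argument: the k-th member of the sequence is replaced by a combination within
  1/(k+1) of it, and the replacements have the same limit.\<close>

lemma span_limit:
  assumes f: "\<And>k. f k \<in> cyclic_span" and lim: "converges_to f x"
  shows "x \<in> cyclic_span"
proof -
  have "\<exists>s. hnorm H (comb s \<ominus> f k) < inverse (real (Suc k))" for k
  proof -
    obtain s where "converges_to (\<lambda>m. comb (s m)) (f k)"
      using f[of k] by (auto simp: cyclic_span_def)
    then have "(\<lambda>m. hnorm H (comb (s m) \<ominus> f k)) \<longlonglongrightarrow> 0" by (simp add: converges_to_def)
    then have "\<forall>\<^sub>F m in sequentially. hnorm H (comb (s m) \<ominus> f k) < inverse (real (Suc k))"
      by (rule order_tendstoD) simp
    then show ?thesis
      unfolding eventually_sequentially by blast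
  qed
  then obtain s where s: "\<And>k. hnorm H (comb (s k) \<ominus> f k) < inverse (real (Suc k))"
    by metis
  have x: "x \<in> carrier H" using lim by (simp add: converges_to_def)
  have "converges_to (\<lambda>k. comb (s k)) x"
  proof (rule converges_toI)
    show "hnorm H (comb (s k) \<ominus> x) \<le> inverse (real (Suc k)) + hnorm H (f k \<ominus> x)" for k
      using hnorm_diff_triangle[of "comb (s k)" "f k" x] s[of k] x span_closed[OF f[of k]] by simp
    show "(\<lambda>k. inverse (real (Suc k)) + hnorm H (f k \<ominus> x)) \<longlonglongrightarrow> 0"
      using lim by (intro tendsto_add_zero LIMSEQ_inverse_real_of_nat) (simp add: converges_to_def)
  qed (use x in auto)
  then show ?thesis by (auto simp: cyclic_span_def)
qed

definition code :: "'h \<Rightarrow> ('p, 'a) rep_universe" where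
  "code x = (SOME s. converges_to (\<lambda>k. comb (s k)) x)"

definition decode :: "('p, 'a) rep_universe \<Rightarrow> 'h" where
  "decode s = (THE x. converges_to (\<lambda>k. comb (s k)) x)"

lemma decode_code [simp]:
  assumes "x \<in> cyclic_span"
  shows "decode (code x) = x"
proof -
  obtain s where "converges_to (\<lambda>k. comb (s k)) x"
    using assms by (auto simp: cyclic_span_def)
  then have lim: "converges_to (\<lambda>k. comb (code x k)) x"
    unfolding code_def by (rule someI[where P = "\<lambda>s. converges_to (\<lambda>k. comb (s k)) x"])
  show ?thesis
    unfolding decode_def using lim
    by (rule the_equality[where P = "\<lambda>y. converges_to (\<lambda>k. comb (code x k)) y"])
      (rule converges_to_unique[OF _ lim])
qed

text \<open>A vector has many names. The carrier keeps only the one selected by \<open>code\<close>,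
  which makes \<open>decode\<close> injective on it; the Hilbert space operations are transported
  through \<open>decode\<close>.\<close>

definition coded :: "('p, 'a) rep_universe hilbert" where
  "coded = \<lparr>carrier = code ` cyclic_span, mult = undefined, one = undefined, zero = code \<zero>,
     add = (\<lambda>x y. code (decode x \<oplus> decode y)), smult = (\<lambda>c x. code (c \<odot> decode x)),
     cinner = (\<lambda>x y. cinner H (decode x) (decode y))\<rparr>"

lemma decode_range: "decode ` carrier coded = cyclic_span"
  by (force simp: coded_def image_image)

lemma embedding: "hilbert_embedding H coded decode"
proof (intro hilbert_embedding.intro hilbert_embedding_axioms.intro hilbert_space)
  show "x \<in> decode ` carrier coded" if "\<And>k. f k \<in> decode ` carrier coded" "converges_to f x" for f x
    using span_limit[of f x] that unfolding decode_range by blast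
  show "inj_on decode (carrier coded)"
    by (rule inj_onI) (auto simp: coded_def)
qed (auto simp: coded_def span_add span_smult span_zero span_closed)

lemma coded_rep:
  obtains \<pi>' V' where "right_covariant_rep \<alpha> coded \<pi>' V'"
    "\<forall>f. \<forall>x\<in>carrier coded. decode (c00_hom coded \<pi>' V' f x) = \<Phi> f (decode x)"
proof -
  have 1: "\<pi> a (decode x) \<in> decode ` carrier coded" if "x \<in> carrier coded" for a x
    unfolding decode_range using that decode_range span_rep by blast
  have 2: "V p (decode x) \<in> decode ` carrier coded" if "x \<in> carrier coded" for p x
    unfolding decode_range using that decode_range span_V by blast
  show thesis
    by (rule that[OF pull_right_covariant(1)[OF embedding 1 2]]) (auto intro!: pull_right_covariant(2)[OF embedding 1 2])
qed

end

section \<open>The matrix seminorms\<close>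

lemma matrix_op_norm_cong:
  fixes H :: "'h hilbert" (structure) and n :: nat
  assumes H: "complex_hilbert_space H" and T: "\<And>i j. i < n \<Longrightarrow> j < n \<Longrightarrow> T i j \<in> bounded_operators H H"
    and eq: "\<And>i j. i < n \<Longrightarrow> j < n \<Longrightarrow> S i j = T i j"
  shows "matrix_op_norm H n S = matrix_op_norm H n T"
proof -
  interpret complex_hilbert_space H by fact
  have sum: "(\<Oplus>j\<in>{..<n}. S i j (x j)) = (\<Oplus>j\<in>{..<n}. T i j (x j))"
    if "i < n" "x \<in> carrier (hilbert_power H n)" for i x
    by (rule M.finsum_cong')
      (use that eq in \<open>auto simp: hilbert_power_def intro!: bounded_operators_closed[OF T]\<close>)
  have "matrix_operator H n S = matrix_operator H n T"
    unfolding matrix_operator_def by (rule restrict_ext, rule restrict_ext) (simp add: sum)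
  then show ?thesis by (simp add: matrix_op_norm_def)
qed

definition coefficient_norm :: "('p \<Rightarrow>\<^sub>0 'a::unital_cstar_algebra) \<Rightarrow> real" where
  "coefficient_norm f = (\<Sum>p\<in>Poly_Mapping.keys f. norm (Poly_Mapping.lookup f p))"

lemma coefficient_norm_nonneg: "coefficient_norm f \<ge> 0"
  unfolding coefficient_norm_def by (rule sum_nonneg) simp

lemma (in right_covariant_rep) matrix_hom_le:
  "matrix_op_norm H n (\<lambda>i j. \<Phi> (f i j)) \<le> (\<Sum>i<n. \<Sum>j<n. coefficient_norm (f i j))"
proof (rule matrix_op_norm_le[OF hilbert_space hom_bounded])
  show "0 \<le> (\<Sum>i<n. \<Sum>j<n. coefficient_norm (f i j))"
    by (intro sum_nonneg coefficient_norm_nonneg)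
  show "L2_set (\<lambda>i. hnorm H (\<Oplus>j\<in>{..<n}. \<Phi> (f i j) (x j))) {..<n}
      \<le> (\<Sum>i<n. \<Sum>j<n. coefficient_norm (f i j)) * L2_set (\<lambda>i. hnorm H (x i)) {..<n}"
    if x: "\<And>i. i < n \<Longrightarrow> x i \<in> carrier H" for x
  proof (rule L2_set_operator_sum[OF hilbert_space coefficient_norm_nonneg])
    show "hnorm H (\<Phi> (f i j) (x j)) \<le> coefficient_norm (f i j) * hnorm H (x j)" if "j < n" for i j
      unfolding coefficient_norm_def by (rule hom_bound[OF x[OF that]])
  qed (use x in simp)
qed

context dynamical_system
begin

text \<open>The set under the \<open>Sup\<close> is bounded because \<open>matrix_hom_le\<close>
  gives a single constant, in terms of the coefficients, for all representations.\<close>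

lemma crossed_seminorm_upper:
  fixes G :: "('p, 'a) rep_universe hilbert"
  assumes "right_covariant_rep \<alpha> G \<sigma> W"
  shows "matrix_op_norm G n (\<lambda>i j. c00_hom G \<sigma> W (f i j)) \<le> crossed_seminorm \<alpha> n f"
  unfolding crossed_seminorm_def
proof (rule cSup_upper)
  interpret G: right_covariant_rep \<alpha> G \<sigma> W by fact
  show "matrix_op_norm G n (\<lambda>i j. c00_hom G \<sigma> W (f i j)) \<in>
    {matrix_op_norm H n (\<lambda>i j. c00_hom H \<pi> V (f i j)) |
      (H :: ('p, 'a) rep_universe hilbert) \<pi> V. isometric_right_covariant_rep \<alpha> H \<pi> V}"
    by (intro CollectI exI[of _ G] exI[of _ \<sigma>] exI[of _ W] conjI refl G.right_covariant)
  show "bdd_above {matrix_op_norm H n (\<lambda>i j. c00_hom H \<pi> V (f i j)) |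
      (H :: ('p, 'a) rep_universe hilbert) \<pi> V. isometric_right_covariant_rep \<alpha> H \<pi> V}"
  proof (rule bdd_aboveI, elim CollectE exE conjE)
    fix v \<pi> V and H :: "('p, 'a) rep_universe hilbert"
    assume v: "v = matrix_op_norm H n (\<lambda>i j. c00_hom H \<pi> V (f i j))"
      and "isometric_right_covariant_rep \<alpha> H \<pi> V"
    then interpret H: right_covariant_rep \<alpha> H \<pi> V
      by (intro right_covariant_rep.intro right_covariant_rep_axioms.intro dynamical_system_axioms)
    show "v \<le> (\<Sum>i<n. \<Sum>j<n. coefficient_norm (f i j))"
      unfolding v by (rule H.matrix_hom_le)
  qed
qed

lemma crossed_seminorm_cong:
  assumes "\<And>i j. i < n \<Longrightarrow> j < n \<Longrightarrow> f i j = g i j"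
  shows "crossed_seminorm \<alpha> n f = crossed_seminorm \<alpha> n g"
proof -
  have "matrix_op_norm H n (\<lambda>i j. c00_hom H \<pi> V (f i j)) = matrix_op_norm H n (\<lambda>i j. c00_hom H \<pi> V (g i j))"
    if "isometric_right_covariant_rep \<alpha> H \<pi> V" for H :: "('p, 'a) rep_universe hilbert" and \<pi> V
  proof -
    interpret H: right_covariant_rep \<alpha> H \<pi> V
      by (intro right_covariant_rep.intro right_covariant_rep_axioms.intro dynamical_system_axioms that)
    show ?thesis
      by (rule matrix_op_norm_cong[OF H.hilbert_space]) (simp_all add: assms H.hom_bounded)
  qed
  then have "(v = matrix_op_norm H n (\<lambda>i j. c00_hom H \<pi> V (f i j)) \<and> isometric_right_covariant_rep \<alpha> H \<pi> V) =
      (v = matrix_op_norm H n (\<lambda>i j. c00_hom H \<pi> V (g i j)) \<and> isometric_right_covariant_rep \<alpha> H \<pi> V)"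
    for v and H :: "('p, 'a) rep_universe hilbert" and \<pi> V
    by (cases "isometric_right_covariant_rep \<alpha> H \<pi> V") simp_all
  then show ?thesis
    unfolding crossed_seminorm_def by (simp only:)
qed

end

context right_covariant_rep
begin

text \<open>The cyclic subspace generated by no vectors at all is the zero space. Its copy shows
  that the set over which the seminorms are suprema is nonempty, as upper bounds and nonnegativity
  of the supremum require.\<close>

lemma universe_rep:
  obtains G :: "('p, 'a) rep_universe hilbert" and \<sigma> W where "right_covariant_rep \<alpha> G \<sigma> W"
proof -
  interpret cyclic_subspace \<alpha> H \<pi> V 0 "\<lambda>_. undefined"
    by unfold_locales simp
  show thesis by (rule coded_rep) (rule that)
qed

lemma crossed_seminorm_le:
  assumes "\<And>(G :: ('p, 'a) rep_universe hilbert) \<sigma> W. right_covariant_rep \<alpha> G \<sigma> W \<Longrightarrow>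
    matrix_op_norm G n (\<lambda>i j. c00_hom G \<sigma> W (f i j)) \<le> c"
  shows "crossed_seminorm \<alpha> n f \<le> c"
  unfolding crossed_seminorm_def
proof (rule cSup_least)
  obtain G :: "('p, 'a) rep_universe hilbert" and \<sigma> W where G: "right_covariant_rep \<alpha> G \<sigma> W"
    by (rule universe_rep)
  show "{matrix_op_norm H n (\<lambda>i j. c00_hom H \<pi> V (f i j)) |
      (H :: ('p, 'a) rep_universe hilbert) \<pi> V. isometric_right_covariant_rep \<alpha> H \<pi> V} \<noteq> {}"
    using right_covariant_rep.right_covariant[OF G] by auto
  fix v assume "v \<in> {matrix_op_norm H n (\<lambda>i j. c00_hom H \<pi> V (f i j)) |
      (H :: ('p, 'a) rep_universe hilbert) \<pi> V. isometric_right_covariant_rep \<alpha> H \<pi> V}"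
  then show "v \<le> c"
    using assms by (auto intro!: right_covariant_rep.intro right_covariant_rep_axioms.intro dynamical_system_axioms)
qed

lemma crossed_seminorm_nonneg: "0 \<le> crossed_seminorm \<alpha> n f"
proof -
  obtain G :: "('p, 'a) rep_universe hilbert" and \<sigma> W where G: "right_covariant_rep \<alpha> G \<sigma> W"
    by (rule universe_rep)
  then interpret G: right_covariant_rep \<alpha> G \<sigma> W .
  have "0 \<le> matrix_op_norm G n (\<lambda>i j. c00_hom G \<sigma> W (f i j))"
    by (rule matrix_op_norm_nonneg[OF G.hilbert_space G.hom_bounded])
  also have "\<dots> \<le> crossed_seminorm \<alpha> n f"
    by (rule crossed_seminorm_upper[OF G])
  finally show ?thesis .
qed

text \<open>Finitely many vectors lie in a cyclic subspace, which is isomorphic to a space of the universe.\<close>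

theorem L2_hom_le_crossed_seminorm:
  assumes x: "\<And>i. i < n \<Longrightarrow> x i \<in> carrier H"
  shows "L2_set (\<lambda>i. hnorm H (\<Oplus>j\<in>{..<n}. \<Phi> (f i j) (x j))) {..<n}
    \<le> crossed_seminorm \<alpha> n f * L2_set (\<lambda>i. hnorm H (x i)) {..<n}"
proof -
  interpret C: cyclic_subspace \<alpha> H \<pi> V n x
    by unfold_locales (rule x)
  interpret E: hilbert_embedding H C.coded C.decode by (rule C.embedding)
  obtain \<pi>' V' where G: "right_covariant_rep \<alpha> C.coded \<pi>' V'"
    and dec: "\<forall>f. \<forall>x\<in>carrier C.coded. C.decode (c00_hom C.coded \<pi>' V' f x) = \<Phi> f (C.decode x)"
    by (rule C.coded_rep)
  interpret G: right_covariant_rep \<alpha> C.coded \<pi>' V' by (rule G)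
  define y where "y i = C.code (x i)" for i
  have y: "y i \<in> carrier C.coded" "C.decode (y i) = x i" if "i < n" for i
    using C.span_vec[OF that] by (auto simp: y_def C.coded_def)
  have eq: "hnorm C.coded (\<Oplus>\<^bsub>C.coded\<^esub>j\<in>{..<n}. c00_hom C.coded \<pi>' V' (f i j) (y j))
      = hnorm H (\<Oplus>j\<in>{..<n}. \<Phi> (f i j) (x j))" for i
  proof -
    have cl: "(\<Oplus>\<^bsub>C.coded\<^esub>j\<in>{..<n}. c00_hom C.coded \<pi>' V' (f i j) (y j)) \<in> carrier C.coded"
      using y by (intro E.G.M.finsum_closed) auto
    have "C.decode (\<Oplus>\<^bsub>C.coded\<^esub>j\<in>{..<n}. c00_hom C.coded \<pi>' V' (f i j) (y j))
        = (\<Oplus>j\<in>{..<n}. C.decode (c00_hom C.coded \<pi>' V' (f i j) (y j)))"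
      using y by (intro E.emb_finsum) auto
    also have "\<dots> = (\<Oplus>j\<in>{..<n}. \<Phi> (f i j) (x j))"
      using y x by (intro M.finsum_cong') (auto simp: dec)
    finally show ?thesis
      using E.hnorm_emb[OF cl] by simp
  qed
  have "L2_set (\<lambda>i. hnorm H (\<Oplus>j\<in>{..<n}. \<Phi> (f i j) (x j))) {..<n} =
      L2_set (\<lambda>i. hnorm C.coded (\<Oplus>\<^bsub>C.coded\<^esub>j\<in>{..<n}. c00_hom C.coded \<pi>' V' (f i j) (y j))) {..<n}"
    by (simp add: eq)
  also have "\<dots> \<le> matrix_op_norm C.coded n (\<lambda>i j. c00_hom C.coded \<pi>' V' (f i j)) * L2_set (\<lambda>i. hnorm C.coded (y i)) {..<n}"
    by (rule matrix_op_norm_bound[OF G.hilbert_space G.hom_bounded y(1)])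
  also have "\<dots> \<le> crossed_seminorm \<alpha> n f * L2_set (\<lambda>i. hnorm C.coded (y i)) {..<n}"
    by (rule mult_right_mono[OF crossed_seminorm_upper[OF G]]) simp
  also have "L2_set (\<lambda>i. hnorm C.coded (y i)) {..<n} = L2_set (\<lambda>i. hnorm H (x i)) {..<n}"
    by (rule L2_set_cong) (simp_all add: y E.hnorm_emb[symmetric])
  finally show ?thesis .
qed

lemma hom_le_crossed_seminorm1:
  assumes x: "x \<in> carrier H"
  shows "hnorm H (\<Phi> f x) \<le> crossed_seminorm1 \<alpha> f * hnorm H x"
  using L2_hom_le_crossed_seminorm[of 1 "\<lambda>_. x" "\<lambda>_ _. f"] x
  by (simp add: lessThan_1 M.finsum_insert)

lemma crossed_seminorm1_le:
  assumes "c \<ge> 0"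
    and "\<And>(G :: ('p, 'a) rep_universe hilbert) \<sigma> W x. right_covariant_rep \<alpha> G \<sigma> W \<Longrightarrow> x \<in> carrier G \<Longrightarrow>
      hnorm G (c00_hom G \<sigma> W f x) \<le> c * hnorm G x"
  shows "crossed_seminorm1 \<alpha> f \<le> c"
proof (rule crossed_seminorm_le)
  fix G :: "('p, 'a) rep_universe hilbert" and \<sigma> W
  assume G: "right_covariant_rep \<alpha> G \<sigma> W"
  then interpret G: right_covariant_rep \<alpha> G \<sigma> W .
  show "matrix_op_norm G 1 (\<lambda>_ _. c00_hom G \<sigma> W f) \<le> c"
    by (rule matrix_norm1_le[OF G.hilbert_space G.hom_bounded assms(1) assms(2)[OF G]])
qed

lemma crossed_seminorm1_zero [simp]: "crossed_seminorm1 \<alpha> 0 = 0"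
proof (rule antisym[OF crossed_seminorm1_le crossed_seminorm_nonneg])
  fix G :: "('p, 'a) rep_universe hilbert" and \<sigma> W x
  assume "right_covariant_rep \<alpha> G \<sigma> W" and x: "x \<in> carrier G"
  then interpret G: right_covariant_rep \<alpha> G \<sigma> W by simp
  show "hnorm G (c00_hom G \<sigma> W 0 x) \<le> 0 * hnorm G x" using x by simp
qed simp

lemma crossed_seminorm1_add:
  "crossed_seminorm1 \<alpha> (f + g) \<le> crossed_seminorm1 \<alpha> f + crossed_seminorm1 \<alpha> g"
proof (rule crossed_seminorm1_le)
  fix G :: "('p, 'a) rep_universe hilbert" and \<sigma> W x
  assume "right_covariant_rep \<alpha> G \<sigma> W" and x: "x \<in> carrier G"
  then interpret G: right_covariant_rep \<alpha> G \<sigma> W by simp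
  show "hnorm G (c00_hom G \<sigma> W (f + g) x) \<le> (crossed_seminorm1 \<alpha> f + crossed_seminorm1 \<alpha> g) * hnorm G x"
    using G.hnorm_triangle[of "c00_hom G \<sigma> W f x" "c00_hom G \<sigma> W g x"]
      G.hom_le_crossed_seminorm1[OF x, of f] G.hom_le_crossed_seminorm1[OF x, of g] x
    by (simp add: G.hom_add distrib_right)
qed (simp add: crossed_seminorm_nonneg)

lemma crossed_seminorm1_scale: "crossed_seminorm1 \<alpha> (c00_scale c f) \<le> cmod c * crossed_seminorm1 \<alpha> f"
proof (rule crossed_seminorm1_le)
  fix G :: "('p, 'a) rep_universe hilbert" and \<sigma> W x
  assume "right_covariant_rep \<alpha> G \<sigma> W" and x: "x \<in> carrier G"
  then interpret G: right_covariant_rep \<alpha> G \<sigma> W by simp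
  show "hnorm G (c00_hom G \<sigma> W (c00_scale c f) x) \<le> cmod c * crossed_seminorm1 \<alpha> f * hnorm G x"
    using mult_left_mono[OF G.hom_le_crossed_seminorm1[OF x, of f], of "cmod c"] x
    by (simp add: G.hom_scale G.hnorm_smult mult.assoc)
qed (simp add: crossed_seminorm_nonneg)

lemma crossed_seminorm1_uminus: "crossed_seminorm1 \<alpha> (- f) = crossed_seminorm1 \<alpha> f"
  using crossed_seminorm1_scale[of "-1" f] crossed_seminorm1_scale[of "-1" "- f"]
  by (simp add: c00_scale_minus_one)

lemma crossed_seminorm1_diff_commute: "crossed_seminorm1 \<alpha> (f - g) = crossed_seminorm1 \<alpha> (g - f)"
  using crossed_seminorm1_uminus[of "f - g"] by simp

lemma crossed_seminorm1_triangle: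
  "crossed_seminorm1 \<alpha> (f - h) \<le> crossed_seminorm1 \<alpha> (f - g) + crossed_seminorm1 \<alpha> (g - h)"
  using crossed_seminorm1_add[of "f - g" "g - h"] by simp

text \<open>From f g - f' g' = f (g - g') + (f - f') g'. In this form submultiplicativity yields
  both that products of Cauchy sequences are Cauchy and that the product respects null
  sequences.\<close>

lemma crossed_seminorm1_mult_diff:
  "crossed_seminorm1 \<alpha> (c00_mult \<alpha> f g - c00_mult \<alpha> f' g')
    \<le> crossed_seminorm1 \<alpha> f * crossed_seminorm1 \<alpha> (g - g') + crossed_seminorm1 \<alpha> (f - f') * crossed_seminorm1 \<alpha> g'"
proof (rule crossed_seminorm1_le)
  fix G :: "('p, 'a) rep_universe hilbert" and \<sigma> W x
  assume "right_covariant_rep \<alpha> G \<sigma> W" and x: "x \<in> carrier G"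
  then interpret G: right_covariant_rep \<alpha> G \<sigma> W by simp
  let ?F = "c00_hom G \<sigma> W"
  have "?F (c00_mult \<alpha> f g - c00_mult \<alpha> f' g') x = ?F f (?F (g - g') x) \<oplus>\<^bsub>G\<^esub> ?F (f - f') (?F g' x)"
    by (rule G.vec_eqI)
      (use x in \<open>simp_all add: G.hom_diff G.hom_mult G.cinner_simps
        bounded_operators_diff[OF G.hilbert_space G.hilbert_space G.hom_bounded]\<close>)
  then have "hnorm G (?F (c00_mult \<alpha> f g - c00_mult \<alpha> f' g') x)
      \<le> hnorm G (?F f (?F (g - g') x)) + hnorm G (?F (f - f') (?F g' x))"
    using x by (simp add: G.hnorm_triangle)
  also have "\<dots> \<le> crossed_seminorm1 \<alpha> f * hnorm G (?F (g - g') x) + crossed_seminorm1 \<alpha> (f - f') * hnorm G (?F g' x)"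
    using x by (intro add_mono G.hom_le_crossed_seminorm1) auto
  also have "\<dots> \<le> crossed_seminorm1 \<alpha> f * (crossed_seminorm1 \<alpha> (g - g') * hnorm G x)
      + crossed_seminorm1 \<alpha> (f - f') * (crossed_seminorm1 \<alpha> g' * hnorm G x)"
    using x by (intro add_mono mult_left_mono G.hom_le_crossed_seminorm1 crossed_seminorm_nonneg)
  finally show "hnorm G (?F (c00_mult \<alpha> f g - c00_mult \<alpha> f' g') x) \<le>
      (crossed_seminorm1 \<alpha> f * crossed_seminorm1 \<alpha> (g - g') + crossed_seminorm1 \<alpha> (f - f') * crossed_seminorm1 \<alpha> g') * hnorm G x"
    by (simp add: algebra_simps)
qed (simp add: crossed_seminorm_nonneg)

lemma crossed_seminorm1_single: "crossed_seminorm1 \<alpha> (Poly_Mapping.single p a) \<le> norm a"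
proof (rule crossed_seminorm1_le)
  fix G :: "('p, 'a) rep_universe hilbert" and \<sigma> W x
  assume "right_covariant_rep \<alpha> G \<sigma> W" and x: "x \<in> carrier G"
  then interpret G: right_covariant_rep \<alpha> G \<sigma> W by simp
  show "hnorm G (c00_hom G \<sigma> W (Poly_Mapping.single p a) x) \<le> norm a * hnorm G x"
    using G.rep_contractive[of "W p x" a] x by (simp add: G.hom_single)
qed simp

text \<open>Covariance with the unit gives \<open>V\<^sub>p = \<pi>(\<alpha>\<^sub>p(1))V\<^sub>p\<close>.\<close>

lemma crossed_seminorm1_defect: "crossed_seminorm1 \<alpha> (Poly_Mapping.single p (1 - \<alpha> p 1)) = 0"
proof (rule antisym[OF crossed_seminorm1_le crossed_seminorm_nonneg])
  fix G :: "('p, 'a) rep_universe hilbert" and \<sigma> W x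
  assume "right_covariant_rep \<alpha> G \<sigma> W" and x: "x \<in> carrier G"
  then interpret G: right_covariant_rep \<alpha> G \<sigma> W by simp
  show "hnorm G (c00_hom G \<sigma> W (Poly_Mapping.single p (1 - \<alpha> p 1)) x) \<le> 0 * hnorm G x"
    using G.covariance[OF x, of p 1] x by (simp add: G.hom_single G.rep_diff)
qed simp

text \<open>The triangle inequality for f = g + (f - g), with the last matrix estimated entry by
  entry. Consequently convergence of the entries controls the seminorms of all matrix sizes, so that
  a single completion carries all of them.\<close>

lemma crossed_seminorm_diff:
  "crossed_seminorm \<alpha> n f \<le> crossed_seminorm \<alpha> n g + (\<Sum>i<n. \<Sum>j<n. crossed_seminorm1 \<alpha> (f i j - g i j))"
proof (rule crossed_seminorm_le)
  fix G :: "('p, 'a) rep_universe hilbert" and \<sigma> W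
  assume G: "right_covariant_rep \<alpha> G \<sigma> W"
  then interpret G: right_covariant_rep \<alpha> G \<sigma> W .
  let ?F = "c00_hom G \<sigma> W" and ?d = "\<Sum>i<n. \<Sum>j<n. crossed_seminorm1 \<alpha> (f i j - g i j)"
  show "matrix_op_norm G n (\<lambda>i j. ?F (f i j)) \<le> crossed_seminorm \<alpha> n g + ?d"
  proof (rule matrix_op_norm_le[OF G.hilbert_space G.hom_bounded])
    show "0 \<le> crossed_seminorm \<alpha> n g + ?d"
      by (intro add_nonneg_nonneg sum_nonneg crossed_seminorm_nonneg)
    fix x assume x: "\<And>i. i < n \<Longrightarrow> x i \<in> carrier G"
    have cl: "(\<Oplus>\<^bsub>G\<^esub>j\<in>{..<n}. ?F (h i j) (x j)) \<in> carrier G" for h :: "nat \<Rightarrow> nat \<Rightarrow> 'p \<Rightarrow>\<^sub>0 'a" and i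
      using x by (intro G.M.finsum_closed) auto
    have split: "(\<Oplus>\<^bsub>G\<^esub>j\<in>{..<n}. ?F (f i j) (x j)) =
        (\<Oplus>\<^bsub>G\<^esub>j\<in>{..<n}. ?F (g i j) (x j)) \<oplus>\<^bsub>G\<^esub> (\<Oplus>\<^bsub>G\<^esub>j\<in>{..<n}. ?F (f i j - g i j) (x j))" for i
    proof -
      have "(\<Oplus>\<^bsub>G\<^esub>j\<in>{..<n}. ?F (f i j) (x j)) = (\<Oplus>\<^bsub>G\<^esub>j\<in>{..<n}. ?F (g i j) (x j) \<oplus>\<^bsub>G\<^esub> ?F (f i j - g i j) (x j))"
      proof (rule G.M.finsum_cong')
        fix j assume "j \<in> {..<n}"
        then show "?F (f i j) (x j) = ?F (g i j) (x j) \<oplus>\<^bsub>G\<^esub> ?F (f i j - g i j) (x j)"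
          using x G.hom_add[of "x j" "g i j" "f i j - g i j"] by simp
      qed (use x in auto)
      also have "\<dots> = (\<Oplus>\<^bsub>G\<^esub>j\<in>{..<n}. ?F (g i j) (x j)) \<oplus>\<^bsub>G\<^esub> (\<Oplus>\<^bsub>G\<^esub>j\<in>{..<n}. ?F (f i j - g i j) (x j))"
        using x by (intro G.M.finsum_addf) auto
      finally show ?thesis .
    qed
    have "L2_set (\<lambda>i. hnorm G (\<Oplus>\<^bsub>G\<^esub>j\<in>{..<n}. ?F (f i j) (x j))) {..<n} \<le>
        L2_set (\<lambda>i. hnorm G (\<Oplus>\<^bsub>G\<^esub>j\<in>{..<n}. ?F (g i j) (x j)) + hnorm G (\<Oplus>\<^bsub>G\<^esub>j\<in>{..<n}. ?F (f i j - g i j) (x j))) {..<n}"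
    proof (rule L2_set_mono)
      fix i
      show "hnorm G (\<Oplus>\<^bsub>G\<^esub>j\<in>{..<n}. ?F (f i j) (x j)) \<le>
          hnorm G (\<Oplus>\<^bsub>G\<^esub>j\<in>{..<n}. ?F (g i j) (x j)) + hnorm G (\<Oplus>\<^bsub>G\<^esub>j\<in>{..<n}. ?F (f i j - g i j) (x j))"
        unfolding split[of i] using cl[of g i] cl[of "\<lambda>i j. f i j - g i j" i] by (rule G.hnorm_triangle)
      show "0 \<le> hnorm G (\<Oplus>\<^bsub>G\<^esub>j\<in>{..<n}. ?F (f i j) (x j))"
        using cl[of f i] by simp
    qed
    also have "\<dots> \<le> L2_set (\<lambda>i. hnorm G (\<Oplus>\<^bsub>G\<^esub>j\<in>{..<n}. ?F (g i j) (x j))) {..<n}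
        + L2_set (\<lambda>i. hnorm G (\<Oplus>\<^bsub>G\<^esub>j\<in>{..<n}. ?F (f i j - g i j) (x j))) {..<n}"
      by (rule L2_set_triangle_ineq)
    also have "\<dots> \<le> crossed_seminorm \<alpha> n g * L2_set (\<lambda>i. hnorm G (x i)) {..<n} + ?d * L2_set (\<lambda>i. hnorm G (x i)) {..<n}"
    proof (rule add_mono)
      show "L2_set (\<lambda>i. hnorm G (\<Oplus>\<^bsub>G\<^esub>j\<in>{..<n}. ?F (g i j) (x j))) {..<n}
          \<le> crossed_seminorm \<alpha> n g * L2_set (\<lambda>i. hnorm G (x i)) {..<n}"
        by (rule G.L2_hom_le_crossed_seminorm[OF x])
      show "L2_set (\<lambda>i. hnorm G (\<Oplus>\<^bsub>G\<^esub>j\<in>{..<n}. ?F (f i j - g i j) (x j))) {..<n}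
          \<le> ?d * L2_set (\<lambda>i. hnorm G (x i)) {..<n}"
        by (rule L2_set_operator_sum[OF G.hilbert_space])
          (use x crossed_seminorm_nonneg G.hom_le_crossed_seminorm1 in auto)
    qed
    finally show "L2_set (\<lambda>i. hnorm G (\<Oplus>\<^bsub>G\<^esub>j\<in>{..<n}. ?F (f i j) (x j))) {..<n}
        \<le> (crossed_seminorm \<alpha> n g + ?d) * L2_set (\<lambda>i. hnorm G (x i)) {..<n}"
      by (simp add: distrib_right)
  qed
qed

end

section \<open>The completion\<close>

text \<open>The seminorm \<^const>\<open>crossed_seminorm\<close> is mostly used with the matrix size \<open>1\<close>, which the simplifier
  would turn into \<open>Suc 0\<close>.\<close>

declare One_nat_def [simp del]

context right_covariant_rep
begin

lemma Cauchy_transfer: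
  assumes x: "x \<in> crossed_Cauchy \<alpha>" and y: "y \<in> crossed_Cauchy \<alpha>" and C: "C \<ge> 0"
    and le: "\<And>k l. crossed_seminorm1 \<alpha> (z k - z l) \<le> C * (crossed_seminorm1 \<alpha> (x k - x l) + crossed_seminorm1 \<alpha> (y k - y l))"
  shows "z \<in> crossed_Cauchy \<alpha>"
  unfolding crossed_Cauchy_def
proof (intro CollectI allI impI)
  fix e :: real assume "e > 0"
  \<comment> \<open>The 2 stands for the two Cauchy sequences; C + 1 in place of C allows C = 0 and
    makes the final inequality strict.\<close>
  define d where "d = e / (2 * (C + 1))"
  have d: "d > 0" using \<open>e > 0\<close> C by (simp add: d_def)
  obtain N where N: "\<forall>k\<ge>N. \<forall>l\<ge>N. crossed_seminorm1 \<alpha> (x k - x l) < d"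
    using x d unfolding crossed_Cauchy_def by blast
  obtain M where M: "\<forall>k\<ge>M. \<forall>l\<ge>M. crossed_seminorm1 \<alpha> (y k - y l) < d"
    using y d unfolding crossed_Cauchy_def by blast
  have "crossed_seminorm1 \<alpha> (z k - z l) < e" if "k \<ge> max N M" "l \<ge> max N M" for k l
  proof -
    have "crossed_seminorm1 \<alpha> (x k - x l) + crossed_seminorm1 \<alpha> (y k - y l) \<le> d + d"
      using N M that by (intro add_mono less_imp_le) auto
    then have "crossed_seminorm1 \<alpha> (z k - z l) \<le> C * (d + d)"
      using C by (intro order_trans[OF le mult_left_mono])
    also have "\<dots> < (C + 1) * (d + d)"
      using d by (intro mult_strict_right_mono) auto
    also have "\<dots> = d * (2 * (C + 1))"
      by (simp add: algebra_simps)
    also have "\<dots> = e"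
      using C by (simp add: d_def)
    finally show ?thesis .
  qed
  then show "\<exists>N. \<forall>k\<ge>N. \<forall>l\<ge>N. crossed_seminorm1 \<alpha> (z k - z l) < e" by blast
qed

lemma Cauchy_const: "(\<lambda>_. f) \<in> crossed_Cauchy \<alpha>"
  by (simp add: crossed_Cauchy_def)

lemma Cauchy_add:
  assumes "x \<in> crossed_Cauchy \<alpha>" "y \<in> crossed_Cauchy \<alpha>"
  shows "(\<lambda>k. x k + y k) \<in> crossed_Cauchy \<alpha>"
proof (rule Cauchy_transfer[OF assms, of 1])
  show "crossed_seminorm1 \<alpha> (x k + y k - (x l + y l)) \<le>
      1 * (crossed_seminorm1 \<alpha> (x k - x l) + crossed_seminorm1 \<alpha> (y k - y l))" for k l
    using crossed_seminorm1_add[of "x k - x l" "y k - y l"] by (simp add: algebra_simps)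
qed simp

lemma c00_scale_diff: "c00_scale c (f - g) = c00_scale c f - c00_scale c g"
proof (rule poly_mapping_eqI)
  fix p
  show "Poly_Mapping.lookup (c00_scale c (f - g)) p = Poly_Mapping.lookup (c00_scale c f - c00_scale c g) p"
    using scaleC_add_right[of c "Poly_Mapping.lookup f p - Poly_Mapping.lookup g p" "Poly_Mapping.lookup g p"]
    by (simp add: lookup_c00_scale lookup_minus algebra_simps)
qed

lemma Cauchy_scale:
  assumes "x \<in> crossed_Cauchy \<alpha>"
  shows "(\<lambda>k. c00_scale c (x k)) \<in> crossed_Cauchy \<alpha>"
proof (rule Cauchy_transfer[OF assms Cauchy_const[of 0], of "cmod c"])
  show "crossed_seminorm1 \<alpha> (c00_scale c (x k) - c00_scale c (x l)) \<le>
      cmod c * (crossed_seminorm1 \<alpha> (x k - x l) + crossed_seminorm1 \<alpha> (0 - 0))" for k l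
    using crossed_seminorm1_scale[of c "x k - x l"] by (simp add: c00_scale_diff)
qed simp

lemma Cauchy_bounded:
  assumes "x \<in> crossed_Cauchy \<alpha>"
  obtains C where "C \<ge> 0" "\<And>k. crossed_seminorm1 \<alpha> (x k) \<le> C"
proof -
  obtain N where N: "\<forall>k\<ge>N. \<forall>l\<ge>N. crossed_seminorm1 \<alpha> (x k - x l) < 1"
    using assms unfolding crossed_Cauchy_def by (auto dest: spec[of _ "1::real"])
  \<comment> \<open>The sum dominates the seminorms of the terms up to N, and the added 1 pays for
    the distance of every later term from the N-th.\<close>
  define C where "C = (\<Sum>k\<le>N. crossed_seminorm1 \<alpha> (x k)) + 1"
  have le: "crossed_seminorm1 \<alpha> (x k) \<le> C - 1" if "k \<le> N" for k
  proof -
    have "crossed_seminorm1 \<alpha> (x k) \<le> (\<Sum>k\<le>N. crossed_seminorm1 \<alpha> (x k))"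
      by (rule member_le_sum) (use that crossed_seminorm_nonneg in auto)
    then show ?thesis by (simp add: C_def)
  qed
  have "crossed_seminorm1 \<alpha> (x k) \<le> C" for k
  proof (cases "k \<le> N")
    case False
    then have "crossed_seminorm1 \<alpha> (x k - x N) < 1" using N by simp
    then show ?thesis
      using crossed_seminorm1_add[of "x k - x N" "x N"] le[of N] by simp
  qed (use le in force)
  moreover have "C \<ge> 0" unfolding C_def by (intro add_nonneg_nonneg sum_nonneg crossed_seminorm_nonneg) simp
  ultimately show thesis using that by blast
qed

lemma Cauchy_mult:
  assumes x: "x \<in> crossed_Cauchy \<alpha>" and y: "y \<in> crossed_Cauchy \<alpha>"
  shows "(\<lambda>k. c00_mult \<alpha> (x k) (y k)) \<in> crossed_Cauchy \<alpha>"
proof -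
  obtain C where C: "C \<ge> 0" "\<And>k. crossed_seminorm1 \<alpha> (x k) \<le> C"
    by (rule Cauchy_bounded[OF x]) blast
  obtain D where D: "D \<ge> 0" "\<And>k. crossed_seminorm1 \<alpha> (y k) \<le> D"
    by (rule Cauchy_bounded[OF y]) blast
  show ?thesis
  proof (rule Cauchy_transfer[OF x y, of "C + D"])
    fix k l
    let ?a = "crossed_seminorm1 \<alpha> (x k - x l)" and ?b = "crossed_seminorm1 \<alpha> (y k - y l)"
    have ab: "?a \<ge> 0" "?b \<ge> 0" by (rule crossed_seminorm_nonneg)+
    have "crossed_seminorm1 \<alpha> (c00_mult \<alpha> (x k) (y k) - c00_mult \<alpha> (x l) (y l))
        \<le> crossed_seminorm1 \<alpha> (x k) * ?b + ?a * crossed_seminorm1 \<alpha> (y l)"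
      by (rule crossed_seminorm1_mult_diff)
    also have "\<dots> \<le> C * ?b + ?a * D"
      using C D ab by (intro add_mono mult_right_mono mult_left_mono)
    also have "\<dots> \<le> (C + D) * (?a + ?b)"
      using C D ab by (simp add: algebra_simps)
    finally show "crossed_seminorm1 \<alpha> (c00_mult \<alpha> (x k) (y k) - c00_mult \<alpha> (x l) (y l)) \<le> (C + D) * (?a + ?b)" .
  qed (use C D in simp)
qed

lemma crossed_relD:
  assumes "(x, y) \<in> crossed_rel \<alpha>"
  shows "x \<in> crossed_Cauchy \<alpha>" "y \<in> crossed_Cauchy \<alpha>" "(\<lambda>k. crossed_seminorm1 \<alpha> (x k - y k)) \<longlonglongrightarrow> 0"
  using assms by (auto simp: crossed_rel_def)

lemma crossed_relI:
  assumes "x \<in> crossed_Cauchy \<alpha>" "y \<in> crossed_Cauchy \<alpha>" "e \<longlonglongrightarrow> 0"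
    and le: "\<And>k. crossed_seminorm1 \<alpha> (x k - y k) \<le> e k"
  shows "(x, y) \<in> crossed_rel \<alpha>"
proof -
  have "(\<lambda>k. crossed_seminorm1 \<alpha> (x k - y k)) \<longlonglongrightarrow> 0"
  proof (rule tendsto_sandwich[OF _ _ tendsto_const \<open>e \<longlonglongrightarrow> 0\<close>])
    show "\<forall>\<^sub>F k in sequentially. 0 \<le> crossed_seminorm1 \<alpha> (x k - y k)"
      by (rule always_eventually) (simp add: crossed_seminorm_nonneg)
    show "\<forall>\<^sub>F k in sequentially. crossed_seminorm1 \<alpha> (x k - y k) \<le> e k"
      by (rule always_eventually) (simp add: le)
  qed
  then show ?thesis
    using assms by (simp add: crossed_rel_def)
qed

lemma equiv_crossed_rel: "equiv (crossed_Cauchy \<alpha>) (crossed_rel \<alpha>)"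
proof (rule equivI)
  show "crossed_rel \<alpha> \<subseteq> crossed_Cauchy \<alpha> \<times> crossed_Cauchy \<alpha>"
    by (auto simp: crossed_rel_def)
  show "refl_on (crossed_Cauchy \<alpha>) (crossed_rel \<alpha>)"
    by (rule refl_onI) (rule crossed_relI[OF _ _ tendsto_const], simp_all)
  show "sym (crossed_rel \<alpha>)"
  proof (rule symI)
    fix x y assume xy: "(x, y) \<in> crossed_rel \<alpha>"
    show "(y, x) \<in> crossed_rel \<alpha>"
      by (rule crossed_relI[OF crossed_relD(2)[OF xy] crossed_relD(1)[OF xy] crossed_relD(3)[OF xy]])
        (rule order_eq_refl[OF crossed_seminorm1_diff_commute])
  qed
  show "trans (crossed_rel \<alpha>)"
  proof (rule transI)
    fix x y z assume xy: "(x, y) \<in> crossed_rel \<alpha>" and yz: "(y, z) \<in> crossed_rel \<alpha>"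
    show "(x, z) \<in> crossed_rel \<alpha>"
      by (rule crossed_relI[OF crossed_relD(1)[OF xy] crossed_relD(2)[OF yz]
          tendsto_add_zero[OF crossed_relD(3)[OF xy] crossed_relD(3)[OF yz]]])
        (rule crossed_seminorm1_triangle)
  qed
qed

abbreviation "B \<equiv> iso_crossed_product \<alpha>"
abbreviation "cls x \<equiv> crossed_rel \<alpha> `` {x}"

lemma crossed_rel_refl: "x \<in> crossed_Cauchy \<alpha> \<Longrightarrow> (x, x) \<in> crossed_rel \<alpha>"
  using equiv_crossed_rel by (simp add: equiv_def refl_on_def)

lemma cls_eqI: "(x, y) \<in> crossed_rel \<alpha> \<Longrightarrow> cls x = cls y"
  using equiv_crossed_rel by (rule equiv_class_eq)

lemma carrier_B: "carrier B = cls ` crossed_Cauchy \<alpha>"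
  by (auto simp: iso_crossed_product_def quotient_def)

lemma cls_closed: "x \<in> crossed_Cauchy \<alpha> \<Longrightarrow> cls x \<in> carrier B"
  by (simp add: carrier_B)

lemma embed_eq: "crossed_embed \<alpha> f = cls (\<lambda>_. f)"
  by (simp add: crossed_embed_def)

lemma embed_closed: "crossed_embed \<alpha> f \<in> carrier B"
  unfolding embed_eq by (rule cls_closed[OF Cauchy_const])

text \<open>The sum of classes is a union over all pairs of representatives; it collapses to a
  single class because adding null sequences does not change the class of the result.\<close>

lemma add_cls:
  assumes "x \<in> crossed_Cauchy \<alpha>" "y \<in> crossed_Cauchy \<alpha>"
  shows "cls x \<oplus>\<^bsub>B\<^esub> cls y = cls (\<lambda>k. x k + y k)"
proof -
  have c: "congruent2 (crossed_rel \<alpha>) (crossed_rel \<alpha>) (\<lambda>x y. cls (\<lambda>k. x k + y k))"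
  proof (rule congruent2I', rule cls_eqI)
    fix x x' y y' assume x: "(x, x') \<in> crossed_rel \<alpha>" and y: "(y, y') \<in> crossed_rel \<alpha>"
    show "(\<lambda>k. x k + y k, \<lambda>k. x' k + y' k) \<in> crossed_rel \<alpha>"
    proof (rule crossed_relI[OF Cauchy_add Cauchy_add tendsto_add_zero[OF crossed_relD(3)[OF x] crossed_relD(3)[OF y]]])
      show "crossed_seminorm1 \<alpha> (x k + y k - (x' k + y' k)) \<le>
          crossed_seminorm1 \<alpha> (x k - x' k) + crossed_seminorm1 \<alpha> (y k - y' k)" for k
        using crossed_seminorm1_add[of "x k - x' k" "y k - y' k"] by (simp add: algebra_simps)
    qed (use crossed_relD[OF x] crossed_relD[OF y] in auto)
  qed
  have "cls x \<oplus>\<^bsub>B\<^esub> cls y = (\<Union>x\<in>cls x. \<Union>y\<in>cls y. cls (\<lambda>k. x k + y k))"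
    by (simp add: iso_crossed_product_def)
  also have "\<dots> = cls (\<lambda>k. x k + y k)"
    by (rule UN_equiv_class2[OF equiv_crossed_rel equiv_crossed_rel c assms])
  finally show ?thesis .
qed

lemma mult_cls:
  assumes "x \<in> crossed_Cauchy \<alpha>" "y \<in> crossed_Cauchy \<alpha>"
  shows "cls x \<otimes>\<^bsub>B\<^esub> cls y = cls (\<lambda>k. c00_mult \<alpha> (x k) (y k))"
proof -
  have c: "congruent2 (crossed_rel \<alpha>) (crossed_rel \<alpha>) (\<lambda>x y. cls (\<lambda>k. c00_mult \<alpha> (x k) (y k)))"
  proof (rule congruent2I', rule cls_eqI)
    fix x x' y y' assume x: "(x, x') \<in> crossed_rel \<alpha>" and y: "(y, y') \<in> crossed_rel \<alpha>"
    \<comment> \<open>The product estimate is asymmetric: it needs a bound for the left factor of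
      the first product and for the right factor of the second.\<close>
    obtain C where C: "C \<ge> 0" "\<And>k. crossed_seminorm1 \<alpha> (x k) \<le> C"
      by (rule Cauchy_bounded[OF crossed_relD(1)[OF x]]) blast
    obtain D where D: "D \<ge> 0" "\<And>k. crossed_seminorm1 \<alpha> (y' k) \<le> D"
      by (rule Cauchy_bounded[OF crossed_relD(2)[OF y]]) blast
    show "(\<lambda>k. c00_mult \<alpha> (x k) (y k), \<lambda>k. c00_mult \<alpha> (x' k) (y' k)) \<in> crossed_rel \<alpha>"
    proof (rule crossed_relI[OF Cauchy_mult Cauchy_mult tendsto_add_zero[OF
            tendsto_mult_right_zero[OF crossed_relD(3)[OF y], of C] tendsto_mult_left_zero[OF crossed_relD(3)[OF x], of D]]])
      show "crossed_seminorm1 \<alpha> (c00_mult \<alpha> (x k) (y k) - c00_mult \<alpha> (x' k) (y' k)) \<le>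
          C * crossed_seminorm1 \<alpha> (y k - y' k) + crossed_seminorm1 \<alpha> (x k - x' k) * D" for k
        using C D by (intro order_trans[OF crossed_seminorm1_mult_diff] add_mono mult_right_mono mult_left_mono
          crossed_seminorm_nonneg) 
    qed (use crossed_relD[OF x] crossed_relD[OF y] in auto)
  qed
  have "cls x \<otimes>\<^bsub>B\<^esub> cls y = (\<Union>x\<in>cls x. \<Union>y\<in>cls y. cls (\<lambda>k. c00_mult \<alpha> (x k) (y k)))"
    by (simp add: iso_crossed_product_def)
  also have "\<dots> = cls (\<lambda>k. c00_mult \<alpha> (x k) (y k))"
    by (rule UN_equiv_class2[OF equiv_crossed_rel equiv_crossed_rel c assms])
  finally show ?thesis .
qed

lemma smult_cls:
  assumes "x \<in> crossed_Cauchy \<alpha>"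
  shows "c \<odot>\<^bsub>B\<^esub> cls x = cls (\<lambda>k. c00_scale c (x k))"
proof -
  have c: "congruent (crossed_rel \<alpha>) (\<lambda>x. cls (\<lambda>k. c00_scale c (x k)))"
  proof (rule congruentI, rule cls_eqI)
    fix x x' assume x: "(x, x') \<in> crossed_rel \<alpha>"
    show "(\<lambda>k. c00_scale c (x k), \<lambda>k. c00_scale c (x' k)) \<in> crossed_rel \<alpha>"
    proof (rule crossed_relI[OF Cauchy_scale Cauchy_scale tendsto_mult_right_zero[OF crossed_relD(3)[OF x], of "cmod c"]])
      show "crossed_seminorm1 \<alpha> (c00_scale c (x k) - c00_scale c (x' k)) \<le> cmod c * crossed_seminorm1 \<alpha> (x k - x' k)" for k
        using crossed_seminorm1_scale[of c "x k - x' k"] by (simp add: c00_scale_diff)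
    qed (use crossed_relD[OF x] in auto)
  qed
  have "c \<odot>\<^bsub>B\<^esub> cls x = (\<Union>x\<in>cls x. cls (\<lambda>k. c00_scale c (x k)))"
    by (simp add: iso_crossed_product_def)
  also have "\<dots> = cls (\<lambda>k. c00_scale c (x k))"
    by (rule UN_equiv_class[OF equiv_crossed_rel c assms])
  finally show ?thesis .
qed

lemma add_embed: "crossed_embed \<alpha> f \<oplus>\<^bsub>B\<^esub> crossed_embed \<alpha> g = crossed_embed \<alpha> (f + g)"
  unfolding embed_eq by (rule add_cls[OF Cauchy_const Cauchy_const])

lemma mult_embed: "crossed_embed \<alpha> f \<otimes>\<^bsub>B\<^esub> crossed_embed \<alpha> g = crossed_embed \<alpha> (c00_mult \<alpha> f g)"
  unfolding embed_eq by (rule mult_cls[OF Cauchy_const Cauchy_const])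

lemma smult_embed: "c \<odot>\<^bsub>B\<^esub> crossed_embed \<alpha> f = crossed_embed \<alpha> (c00_scale c f)"
  unfolding embed_eq by (rule smult_cls[OF Cauchy_const])

lemma crossed_seminorm_abs_diff:
  "\<bar>crossed_seminorm \<alpha> n f - crossed_seminorm \<alpha> n g\<bar> \<le> (\<Sum>i<n. \<Sum>j<n. crossed_seminorm1 \<alpha> (f i j - g i j))"
  using crossed_seminorm_diff[of n f g] crossed_seminorm_diff[of n g f]
  by (simp add: crossed_seminorm1_diff_commute[of "f i j" for i j] abs_le_iff)

lemma crossed_seminorm_Cauchy:
  assumes x: "\<And>i j. i < n \<Longrightarrow> j < n \<Longrightarrow> x i j \<in> crossed_Cauchy \<alpha>"
  shows "convergent (\<lambda>k. crossed_seminorm \<alpha> n (\<lambda>i j. x i j k))"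
proof (rule Cauchy_convergent, rule CauchyI)
  fix e :: real assume e: "e > 0"
  \<comment> \<open>There are n * n entries, each contributing less than d; the extra 1 covers n = 0
    and leaves strict room below e.\<close>
  define d where "d = e / (real (n * n) + 1)"
  have d: "d > 0" using e by (simp add: d_def add_nonneg_pos)
  have "\<exists>N. \<forall>k\<ge>N. \<forall>l\<ge>N. crossed_seminorm1 \<alpha> (x i j k - x i j l) < d" if "i < n" "j < n" for i j
    using x[OF that] d unfolding crossed_Cauchy_def by blast
  then obtain N where N: "\<And>i j. i < n \<Longrightarrow> j < n \<Longrightarrow> \<forall>k\<ge>N i j. \<forall>l\<ge>N i j. crossed_seminorm1 \<alpha> (x i j k - x i j l) < d"
    by metis
  \<comment> \<open>The sum of the thresholds is used as a convenient upper bound of all of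
    them.\<close>
  define M where "M = (\<Sum>i<n. \<Sum>j<n. N i j)"
  have NM: "N i j \<le> M" if "i < n" "j < n" for i j
  proof -
    have "N i j \<le> (\<Sum>j<n. N i j)" using that by (intro member_le_sum) auto
    also have "\<dots> \<le> M" unfolding M_def using that by (intro member_le_sum) auto
    finally show ?thesis .
  qed
  have "norm (crossed_seminorm \<alpha> n (\<lambda>i j. x i j k) - crossed_seminorm \<alpha> n (\<lambda>i j. x i j l)) < e"
    if "k \<ge> M" "l \<ge> M" for k l
  proof -
    have "norm (crossed_seminorm \<alpha> n (\<lambda>i j. x i j k) - crossed_seminorm \<alpha> n (\<lambda>i j. x i j l))
        \<le> (\<Sum>i<n. \<Sum>j<n. crossed_seminorm1 \<alpha> (x i j k - x i j l))"
      unfolding real_norm_def by (rule crossed_seminorm_abs_diff)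
    also have "\<dots> \<le> (\<Sum>i<n. \<Sum>j<n. d)"
    proof (intro sum_mono less_imp_le)
      fix i j assume "i \<in> {..<n}" "j \<in> {..<n}"
      then show "crossed_seminorm1 \<alpha> (x i j k - x i j l) < d"
        using N[of i j] NM[of i j] that by simp
    qed
    also have "\<dots> = real (n * n) * d" by simp
    also have "\<dots> < (real (n * n) + 1) * d" using d by (intro mult_strict_right_mono) auto
    also have "\<dots> = e" unfolding d_def by (simp add: add_nonneg_pos less_imp_neq[symmetric])
    finally show ?thesis .
  qed
  then show "\<exists>M. \<forall>k\<ge>M. \<forall>l\<ge>M. norm (crossed_seminorm \<alpha> n (\<lambda>i j. x i j k) - crossed_seminorm \<alpha> n (\<lambda>i j. x i j l)) < e"
    by blast
qed

text \<open>The norm of the completion is a \<open>lim\<close> along representatives picked by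
  \<open>SOME\<close>. Convergence makes that \<open>lim\<close> meaningful, and continuity in the
  entries makes it independent of the representatives, so that any chosen ones may be used.\<close>

lemma matrix_norm_tendsto:
  assumes x: "\<And>i j. i < n \<Longrightarrow> j < n \<Longrightarrow> x i j \<in> crossed_Cauchy \<alpha>"
  shows "(\<lambda>k. crossed_seminorm \<alpha> n (\<lambda>i j. x i j k)) \<longlonglongrightarrow> matrix_norm B n (\<lambda>i j. cls (x i j))"
proof -
  define y where "y i j = (SOME y. y \<in> cls (x i j))" for i j
  have xy: "(x i j, y i j) \<in> crossed_rel \<alpha>" if "i < n" "j < n" for i j
    using someI[of "\<lambda>y. y \<in> cls (x i j)" "x i j"] crossed_rel_refl[OF x[OF that]] by (simp add: y_def)
  have "convergent (\<lambda>k. crossed_seminorm \<alpha> n (\<lambda>i j. y i j k))"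
    by (rule crossed_seminorm_Cauchy) (rule crossed_relD(2)[OF xy])
  then have "(\<lambda>k. crossed_seminorm \<alpha> n (\<lambda>i j. y i j k)) \<longlonglongrightarrow> lim (\<lambda>k. crossed_seminorm \<alpha> n (\<lambda>i j. y i j k))"
    by (simp add: convergent_LIMSEQ_iff)
  moreover have "matrix_norm B n (\<lambda>i j. cls (x i j)) = lim (\<lambda>k. crossed_seminorm \<alpha> n (\<lambda>i j. y i j k))"
    by (simp add: iso_crossed_product_def y_def)
  moreover have "(\<lambda>k. crossed_seminorm \<alpha> n (\<lambda>i j. x i j k) - crossed_seminorm \<alpha> n (\<lambda>i j. y i j k)) \<longlonglongrightarrow> 0"
  proof (rule metric_tendsto_imp_tendsto)
    show "\<forall>\<^sub>F k in sequentially. dist (crossed_seminorm \<alpha> n (\<lambda>i j. x i j k) - crossed_seminorm \<alpha> n (\<lambda>i j. y i j k)) 0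
        \<le> dist (\<Sum>i<n. \<Sum>j<n. crossed_seminorm1 \<alpha> (x i j k - y i j k)) 0"
      using crossed_seminorm_abs_diff[of n "\<lambda>i j. x i j k" "\<lambda>i j. y i j k" for k]
      by (intro always_eventually) (auto intro: order_trans[OF _ abs_ge_self])
    show "(\<lambda>k. \<Sum>i<n. \<Sum>j<n. crossed_seminorm1 \<alpha> (x i j k - y i j k)) \<longlonglongrightarrow> 0"
      by (intro tendsto_null_sum) (use xy crossed_relD(3) in auto)
  qed
  ultimately show ?thesis
    using tendsto_add[of "\<lambda>k. crossed_seminorm \<alpha> n (\<lambda>i j. x i j k) - crossed_seminorm \<alpha> n (\<lambda>i j. y i j k)"
        0 sequentially "\<lambda>k. crossed_seminorm \<alpha> n (\<lambda>i j. y i j k)"] by simp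
qed

lemma matrix_norm1_tendsto:
  "x \<in> crossed_Cauchy \<alpha> \<Longrightarrow> (\<lambda>k. crossed_seminorm1 \<alpha> (x k)) \<longlonglongrightarrow> matrix_norm B 1 (\<lambda>_ _. cls x)"
  by (rule matrix_norm_tendsto)

lemma matrix_norm1_embed: "matrix_norm B 1 (\<lambda>_ _. crossed_embed \<alpha> f) = crossed_seminorm1 \<alpha> f"
  unfolding embed_eq using matrix_norm1_tendsto[OF Cauchy_const[of f]]
  by (simp add: LIMSEQ_const_iff)

end

section \<open>Completely contractive homomorphisms of the completion\<close>

lemma cc_homomorphismD:
  assumes "cc_homomorphism A K \<rho>"
  shows cc_hilbert_space: "complex_hilbert_space K"
    and cc_extensional: "\<rho> \<in> carrier A \<rightarrow>\<^sub>E bounded_operators K K"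
    and cc_bounded: "\<And>b. b \<in> carrier A \<Longrightarrow> \<rho> b \<in> bounded_operators K K"
    and cc_add: "\<And>b c x. \<lbrakk>b \<in> carrier A; c \<in> carrier A; x \<in> carrier K\<rbrakk> \<Longrightarrow> \<rho> (b \<oplus>\<^bsub>A\<^esub> c) x = \<rho> b x \<oplus>\<^bsub>K\<^esub> \<rho> c x"
    and cc_smult: "\<And>z b x. \<lbrakk>b \<in> carrier A; x \<in> carrier K\<rbrakk> \<Longrightarrow> \<rho> (z \<odot>\<^bsub>A\<^esub> b) x = z \<odot>\<^bsub>K\<^esub> \<rho> b x"
    and cc_compose: "\<And>b c. \<lbrakk>b \<in> carrier A; c \<in> carrier A\<rbrakk> \<Longrightarrow> \<rho> (b \<otimes>\<^bsub>A\<^esub> c) = compose (carrier K) (\<rho> b) (\<rho> c)"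
  using assms unfolding cc_homomorphism_def by (blast, blast, blast, blast, blast, blast)

lemma cc_contractive:
  assumes cc: "cc_homomorphism A K \<rho>" and X: "\<And>i j. i < n \<Longrightarrow> j < n \<Longrightarrow> X i j \<in> carrier A"
  shows "matrix_op_norm K n (\<lambda>i j. \<rho> (X i j)) \<le> matrix_norm A n X"
proof -
  have "\<forall>n X. (\<forall>i<n. \<forall>j<n. X i j \<in> carrier A) \<longrightarrow> matrix_op_norm K n (\<lambda>i j. \<rho> (X i j)) \<le> matrix_norm A n X"
    using cc unfolding cc_homomorphism_def by (elim conjE)
  then show ?thesis using X by simp
qed

lemma (in complex_hilbert_space) converges_to_finsum:
  assumes "finite A" "\<And>i. i \<in> A \<Longrightarrow> converges_to (f i) (x i)"
  shows "converges_to (\<lambda>k. \<Oplus>i\<in>A. f i k) (\<Oplus>i\<in>A. x i)"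
  using assms
proof (induction A rule: finite_induct)
  case empty
  show ?case by (simp add: converges_to_const)
next
  case (insert i A)
  have cl: "f j k \<in> carrier H" "x j \<in> carrier H" if "j \<in> insert i A" for j k
    using insert.prems[OF that] by (auto simp: converges_to_def)
  have "(\<Oplus>j\<in>insert i A. f j k) = f i k \<oplus> (\<Oplus>j\<in>A. f j k)" for k
    using insert.hyps cl by (intro M.finsum_insert) auto
  moreover have "(\<Oplus>j\<in>insert i A. x j) = x i \<oplus> (\<Oplus>j\<in>A. x j)"
    using insert.hyps cl by (intro M.finsum_insert) auto
  moreover have "converges_to (\<lambda>k. f i k \<oplus> (\<Oplus>j\<in>A. f j k)) (x i \<oplus> (\<Oplus>j\<in>A. x j))"
    using insert by (intro converges_to_add) auto
  ultimately show ?case by simp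
qed

context right_covariant_rep
begin

lemma matrix_norm_cong:
  assumes "\<And>i j. i < n \<Longrightarrow> j < n \<Longrightarrow> X i j = Y i j"
  shows "matrix_norm B n X = matrix_norm B n Y"
proof -
  have "crossed_seminorm \<alpha> n (\<lambda>i j. (SOME x. x \<in> X i j) k) = crossed_seminorm \<alpha> n (\<lambda>i j. (SOME x. x \<in> Y i j) k)" for k
    by (rule crossed_seminorm_cong) (simp add: assms)
  then show ?thesis by (simp add: iso_crossed_product_def)
qed

lemma cc_norm_bound:
  assumes cc: "cc_homomorphism B K \<rho>" and X: "X \<in> carrier B" and x: "x \<in> carrier K"
  shows "hnorm K (\<rho> X x) \<le> matrix_norm B 1 (\<lambda>_ _. X) * hnorm K x"
proof -
  interpret K: complex_hilbert_space K by (rule cc_hilbert_space[OF cc])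
  have "hnorm K (\<rho> X x) \<le> matrix_op_norm K 1 (\<lambda>_ _. \<rho> X) * hnorm K x"
    by (rule op_bound_matrix_norm1[OF cc_hilbert_space[OF cc] cc_bounded[OF cc X] x])
  also have "\<dots> \<le> matrix_norm B 1 (\<lambda>_ _. X) * hnorm K x"
    using cc_contractive[OF cc, of 1 "\<lambda>_ _. X"] X x by (intro mult_right_mono) auto
  finally show ?thesis .
qed

lemma cc_embed_bound:
  assumes cc: "cc_homomorphism B K \<rho>" and x: "x \<in> carrier K"
  shows "hnorm K (\<rho> (crossed_embed \<alpha> f) x) \<le> crossed_seminorm1 \<alpha> f * hnorm K x"
  using cc_norm_bound[OF cc embed_closed x] unfolding matrix_norm1_embed .

text \<open>Expresses that the embedded terms \<open>x k\<close> converge in the completion to the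
  class of x. The norm in question is the limit over l of the seminorms of x l - x k; as limits
  preserve only weak inequalities, the Cauchy condition is taken with e/2.\<close>

lemma matrix_norm1_diff_tendsto:
  assumes x: "x \<in> crossed_Cauchy \<alpha>"
  shows "(\<lambda>k. matrix_norm B 1 (\<lambda>_ _. cls (\<lambda>l. x l - x k))) \<longlonglongrightarrow> 0"
proof (rule LIMSEQ_I)
  fix e :: real assume "e > 0"
  then obtain N where N: "\<forall>k\<ge>N. \<forall>l\<ge>N. crossed_seminorm1 \<alpha> (x k - x l) < e / 2"
    using x unfolding crossed_Cauchy_def by (auto dest: spec[of _ "e / 2"])
  have "norm (matrix_norm B 1 (\<lambda>_ _. cls (\<lambda>l. x l - x k)) - 0) < e" if k: "k \<ge> N" for k
  proof -
    have "(\<lambda>l. x l - x k) \<in> crossed_Cauchy \<alpha>"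
      using Cauchy_add[OF x Cauchy_const[of "- x k"]] by simp
    then have lim: "(\<lambda>l. crossed_seminorm1 \<alpha> (x l - x k)) \<longlonglongrightarrow> matrix_norm B 1 (\<lambda>_ _. cls (\<lambda>l. x l - x k))"
      by (rule matrix_norm1_tendsto)
    have "matrix_norm B 1 (\<lambda>_ _. cls (\<lambda>l. x l - x k)) \<le> e / 2"
      by (rule LIMSEQ_le_const2[OF lim]) (use N k in \<open>auto intro!: exI[of _ N] less_imp_le\<close>)
    moreover have "0 \<le> matrix_norm B 1 (\<lambda>_ _. cls (\<lambda>l. x l - x k))"
      by (rule LIMSEQ_le_const[OF lim]) (simp add: crossed_seminorm_nonneg)
    ultimately show ?thesis using \<open>e > 0\<close> by simp
  qed
  then show "\<exists>N. \<forall>k\<ge>N. norm (matrix_norm B 1 (\<lambda>_ _. cls (\<lambda>l. x l - x k)) - 0) < e" by blast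
qed

text \<open>A completely contractive homomorphism is continuous and a class is the limit of its
  embedded terms, so pointwise values on the completion are limits of values on the convolution
  algebra. Uniqueness of extensions and the passage from that algebra to the whole dilation both
  rest on this.\<close>

lemma cc_converges_to:
  assumes cc: "cc_homomorphism B K \<rho>" and x: "x \<in> crossed_Cauchy \<alpha>" and v: "v \<in> carrier K"
  shows "complex_hilbert_space.converges_to K (\<lambda>k. \<rho> (crossed_embed \<alpha> (x k)) v) (\<rho> (cls x) v)"
proof -
  interpret K: complex_hilbert_space K by (rule cc_hilbert_space[OF cc])
  note cl = bounded_operators_closed[OF cc_bounded[OF cc] v]
  show ?thesis
  proof (rule K.converges_toI)
    show "(\<lambda>k. matrix_norm B 1 (\<lambda>_ _. cls (\<lambda>l. x l - x k)) * hnorm K v) \<longlonglongrightarrow> 0"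
      by (rule tendsto_mult_left_zero[OF matrix_norm1_diff_tendsto[OF x]])
    fix k
    have d: "(\<lambda>l. x l - x k) \<in> crossed_Cauchy \<alpha>"
      using Cauchy_add[OF x Cauchy_const[of "- x k"]] by simp
    have "cls x = crossed_embed \<alpha> (x k) \<oplus>\<^bsub>B\<^esub> cls (\<lambda>l. x l - x k)"
      unfolding embed_eq add_cls[OF Cauchy_const d] by simp
    then have eq: "\<rho> (cls x) v = \<rho> (crossed_embed \<alpha> (x k)) v \<oplus>\<^bsub>K\<^esub> \<rho> (cls (\<lambda>l. x l - x k)) v"
      using cc_add[OF cc embed_closed cls_closed[OF d] v] by simp
    have "hnorm K (\<rho> (crossed_embed \<alpha> (x k)) v \<ominus>\<^bsub>K\<^esub> \<rho> (cls x) v) = hnorm K (\<ominus>\<^bsub>K\<^esub> \<rho> (cls (\<lambda>l. x l - x k)) v)"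
      unfolding eq by (rule arg_cong[where f = "hnorm K"], rule K.vec_eqI)
        (use cl[OF embed_closed] cl[OF cls_closed[OF d]] in \<open>simp_all add: K.cinner_simps\<close>)
    also have "\<dots> \<le> matrix_norm B 1 (\<lambda>_ _. cls (\<lambda>l. x l - x k)) * hnorm K v"
      using cc_norm_bound[OF cc cls_closed[OF d] v] cl[OF cls_closed[OF d]] by (simp add: K.hnorm_minus)
    finally show "hnorm K (\<rho> (crossed_embed \<alpha> (x k)) v \<ominus>\<^bsub>K\<^esub> \<rho> (cls x) v)
        \<le> matrix_norm B 1 (\<lambda>_ _. cls (\<lambda>l. x l - x k)) * hnorm K v" .
  qed (use cl embed_closed cls_closed[OF x] in auto)
qed

lemma cc_unique:
  assumes cc: "cc_homomorphism B K \<rho>" "cc_homomorphism B K \<rho>'"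
    and eq: "\<And>f. \<rho> (crossed_embed \<alpha> f) = \<rho>' (crossed_embed \<alpha> f)"
  shows "\<rho> = \<rho>'"
proof (rule PiE_ext[OF cc_extensional[OF cc(1)] cc_extensional[OF cc(2)]])
  interpret K: complex_hilbert_space K by (rule cc_hilbert_space[OF cc(1)])
  fix X assume X: "X \<in> carrier B"
  then obtain x where x: "x \<in> crossed_Cauchy \<alpha>" "X = cls x" by (auto simp: carrier_B)
  show "\<rho> X = \<rho>' X"
  proof (rule bounded_operators_eqI[OF cc_bounded[OF cc(1) X] cc_bounded[OF cc(2) X]])
    fix v assume v: "v \<in> carrier K"
    show "\<rho> X v = \<rho>' X v"
      unfolding x(2)
      by (rule K.converges_to_unique[OF cc_converges_to[OF cc(1) x(1) v] cc_converges_to[OF cc(2) x(1) v, folded eq]])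
  qed
qed

section \<open>The extension of a right covariant representation to the completion\<close>

definition extension :: "(nat \<Rightarrow> 'p \<Rightarrow>\<^sub>0 'a) set \<Rightarrow> 'h \<Rightarrow> 'h" where
  "extension = (\<lambda>X\<in>carrier B. \<lambda>v\<in>carrier H. THE w. converges_to (\<lambda>k. \<Phi> ((SOME x. x \<in> X) k) v) w)"

lemma hom_Cauchy:
  assumes x: "x \<in> crossed_Cauchy \<alpha>" and v: "v \<in> carrier H"
  obtains w where "converges_to (\<lambda>k. \<Phi> (x k) v) w"
proof (rule Cauchy_converges_to[of "\<lambda>k. \<Phi> (x k) v"])
  fix e :: real assume "e > 0"
  define d where "d = e / (hnorm H v + 1)"
  have hv: "hnorm H v + 1 > 0" using v by (simp add: add_nonneg_pos)
  then have "d > 0" using \<open>e > 0\<close> by (simp add: d_def)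
  then obtain N where N: "\<forall>k\<ge>N. \<forall>l\<ge>N. crossed_seminorm1 \<alpha> (x k - x l) < d"
    using x unfolding crossed_Cauchy_def by blast
  have "hnorm H (\<Phi> (x k) v \<ominus> \<Phi> (x l) v) < e" if "k \<ge> N" "l \<ge> N" for k l
  proof -
    have "hnorm H (\<Phi> (x k) v \<ominus> \<Phi> (x l) v) \<le> crossed_seminorm1 \<alpha> (x k - x l) * hnorm H v"
      using hom_le_crossed_seminorm1[OF v, of "x k - x l"] v by (simp add: hom_diff)
    also have "\<dots> \<le> d * hnorm H v"
      using N that v by (intro mult_right_mono) (auto intro: less_imp_le)
    also have "\<dots> < d * (hnorm H v + 1)"
      using \<open>d > 0\<close> by (intro mult_strict_left_mono) auto
    also have "\<dots> = e" using hv by (simp add: d_def)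
    finally show ?thesis .
  qed
  then show "\<exists>N. \<forall>k\<ge>N. \<forall>l\<ge>N. hnorm H (\<Phi> (x k) v \<ominus> \<Phi> (x l) v) < e" by blast
qed (use v that in auto)

text \<open>Independence of the representative y picked by \<open>SOME\<close>: at v the images of x
  k and y k differ by at most the seminorm of x k - y k times ||v||, which tends to 0.\<close>

lemma extension_converges_to:
  assumes x: "x \<in> crossed_Cauchy \<alpha>" and v: "v \<in> carrier H"
  shows "converges_to (\<lambda>k. \<Phi> (x k) v) (extension (cls x) v)"
proof -
  define y where "y = (SOME y. y \<in> cls x)"
  have xy: "(x, y) \<in> crossed_rel \<alpha>"
    using someI[of "\<lambda>y. y \<in> cls x" x] crossed_rel_refl[OF x] by (simp add: y_def)
  obtain w where w: "converges_to (\<lambda>k. \<Phi> (y k) v) w"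
    by (rule hom_Cauchy[OF crossed_relD(2)[OF xy] v])
  have "extension (cls x) v = (THE w. converges_to (\<lambda>k. \<Phi> (y k) v) w)"
    unfolding extension_def y_def using cls_closed[OF x] v by simp
  also have "\<dots> = w"
    using w by (rule the_equality[where P = "\<lambda>w. converges_to (\<lambda>k. \<Phi> (y k) v) w"])
      (rule converges_to_unique[OF _ w])
  finally have eq: "extension (cls x) v = w" .
  have wc: "w \<in> carrier H" using w by (simp add: converges_to_def)
  show ?thesis
    unfolding eq
  proof (rule converges_toI)
    show "(\<lambda>k. crossed_seminorm1 \<alpha> (x k - y k) * hnorm H v + hnorm H (\<Phi> (y k) v \<ominus> w)) \<longlonglongrightarrow> 0"
      using w by (intro tendsto_add_zero tendsto_mult_left_zero crossed_relD(3)[OF xy]) (simp add: converges_to_def)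
    show "hnorm H (\<Phi> (x k) v \<ominus> w) \<le> crossed_seminorm1 \<alpha> (x k - y k) * hnorm H v + hnorm H (\<Phi> (y k) v \<ominus> w)" for k
      using hnorm_diff_triangle[of "\<Phi> (x k) v" "\<Phi> (y k) v" w] v wc
        hom_le_crossed_seminorm1[OF v, of "x k - y k"] by (simp add: hom_diff)
  qed (use v wc in auto)
qed

lemma extension_closed: "x \<in> crossed_Cauchy \<alpha> \<Longrightarrow> v \<in> carrier H \<Longrightarrow> extension (cls x) v \<in> carrier H"
  using extension_converges_to by (simp add: converges_to_def)

lemma extension_eqI:
  assumes "x \<in> crossed_Cauchy \<alpha>" "v \<in> carrier H" "converges_to (\<lambda>k. \<Phi> (x k) v) w"
  shows "extension (cls x) v = w"
  using converges_to_unique[OF extension_converges_to[OF assms(1,2)] assms(3)] .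

lemma extension_bounded:
  assumes x: "x \<in> crossed_Cauchy \<alpha>"
  shows "extension (cls x) \<in> bounded_operators H H"
proof -
  obtain C where C: "C \<ge> 0" "\<And>k. crossed_seminorm1 \<alpha> (x k) \<le> C"
    by (rule Cauchy_bounded[OF x]) blast
  note lim = extension_converges_to[OF x]
  show ?thesis
  proof (rule bounded_operatorsI[where C = C])
    show "extension (cls x) \<in> extensional (carrier H)"
      using cls_closed[OF x] by (simp add: extension_def)
    show "extension (cls x) (v \<oplus> w) = extension (cls x) v \<oplus> extension (cls x) w"
      if "v \<in> carrier H" "w \<in> carrier H" for v w
      by (rule extension_eqI[OF x]) (use that converges_to_add[OF lim lim] in \<open>auto simp: hom_add_vec\<close>)
    show "extension (cls x) (c \<odot> v) = c \<odot> extension (cls x) v" if "v \<in> carrier H" for c v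
      by (rule extension_eqI[OF x]) (use that converges_to_smult[OF lim] in \<open>auto simp: hom_smult_vec\<close>)
    show "hnorm H (extension (cls x) v) \<le> C * hnorm H v" if v: "v \<in> carrier H" for v
    proof (rule LIMSEQ_le_const2[OF converges_to_hnorm[OF lim[OF v]]], intro exI allI impI)
      show "hnorm H (\<Phi> (x k) v) \<le> C * hnorm H v" for k
        using hom_le_crossed_seminorm1[OF v, of "x k"] C(2)[of k] v
        by (meson hnorm_ge_zero mult_right_mono order_trans)
    qed
  qed (rule extension_closed[OF x])
qed

lemma extension_embed: "extension (crossed_embed \<alpha> f) = \<Phi> f"
  unfolding embed_eq
  by (rule bounded_operators_eqI[OF extension_bounded[OF Cauchy_const] hom_bounded])
    (rule extension_eqI[OF Cauchy_const], auto intro: converges_to_const)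

text \<open>With w the limit of \<open>\<Phi> (y k) v\<close>, the error splits into
  \<open>\<Phi> (x k)\<close> applied to \<open>\<Phi> (y k) v \<ominus> w\<close>, which is small
  because Cauchy sequences are bounded, and the error of \<open>\<Phi> (x k) w\<close>, where the
  vector no longer depends on k.\<close>

lemma extension_mult:
  assumes x: "x \<in> crossed_Cauchy \<alpha>" and y: "y \<in> crossed_Cauchy \<alpha>"
  shows "extension (cls x \<otimes>\<^bsub>B\<^esub> cls y) = compose (carrier H) (extension (cls x)) (extension (cls y))"
  unfolding mult_cls[OF x y]
proof (rule bounded_operators_eqI[OF extension_bounded[OF Cauchy_mult[OF x y]]
      bounded_operators_compose[OF hilbert_space hilbert_space hilbert_space extension_bounded[OF x] extension_bounded[OF y]]])
  fix v assume v: "v \<in> carrier H"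
  obtain C where C: "C \<ge> 0" "\<And>k. crossed_seminorm1 \<alpha> (x k) \<le> C"
    by (rule Cauchy_bounded[OF x]) blast
  define w where "w = extension (cls y) v"
  have w: "w \<in> carrier H" unfolding w_def by (rule extension_closed[OF y v])
  have xw: "extension (cls x) w \<in> carrier H" by (rule extension_closed[OF x w])
  have "converges_to (\<lambda>k. \<Phi> (c00_mult \<alpha> (x k) (y k)) v) (extension (cls x) w)"
  proof (rule converges_toI)
    show "(\<lambda>k. C * hnorm H (\<Phi> (y k) v \<ominus> w) + hnorm H (\<Phi> (x k) w \<ominus> extension (cls x) w)) \<longlonglongrightarrow> 0"
      using extension_converges_to[OF y v] extension_converges_to[OF x w]
      by (intro tendsto_add_zero tendsto_mult_right_zero) (simp_all add: converges_to_def w_def)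
    fix k
    have "hnorm H (\<Phi> (x k) (\<Phi> (y k) v) \<ominus> \<Phi> (x k) w) = hnorm H (\<Phi> (x k) (\<Phi> (y k) v \<ominus> w))"
      using v w by (simp add: bounded_operators_diff[OF hilbert_space hilbert_space hom_bounded])
    also have "\<dots> \<le> crossed_seminorm1 \<alpha> (x k) * hnorm H (\<Phi> (y k) v \<ominus> w)"
      using v w by (intro hom_le_crossed_seminorm1) auto
    also have "\<dots> \<le> C * hnorm H (\<Phi> (y k) v \<ominus> w)"
      using C(2)[of k] v w by (intro mult_right_mono) auto
    finally show "hnorm H (\<Phi> (c00_mult \<alpha> (x k) (y k)) v \<ominus> extension (cls x) w)
        \<le> C * hnorm H (\<Phi> (y k) v \<ominus> w) + hnorm H (\<Phi> (x k) w \<ominus> extension (cls x) w)"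
      using hnorm_diff_triangle[of "\<Phi> (x k) (\<Phi> (y k) v)" "\<Phi> (x k) w" "extension (cls x) w"] v w xw
      by (simp add: hom_mult)
  qed (use v xw in auto)
  then show "extension (cls (\<lambda>k. c00_mult \<alpha> (x k) (y k))) v =
      compose (carrier H) (extension (cls x)) (extension (cls y)) v"
    using extension_eqI[OF Cauchy_mult[OF x y] v] v by (simp add: compose_eq w_def)
qed

text \<open>Algebraic identities pass to the limit. For complete contractivity a tuple of vectors is
  fixed, the estimate \<open>L2_hom_le_crossed_seminorm\<close> is used for each k, and both sides
  converge; the supremum over tuples comes last.\<close>

theorem extension_cc: "cc_homomorphism B H extension"
  unfolding cc_homomorphism_def
proof (intro conjI allI ballI impI hilbert_space)
  show "extension \<in> carrier B \<rightarrow>\<^sub>E bounded_operators H H"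
  proof (rule PiE_I)
    show "extension X \<in> bounded_operators H H" if "X \<in> carrier B" for X
      using that extension_bounded by (auto simp: carrier_B)
  qed (simp add: extension_def)
  fix X assume "X \<in> carrier B"
  then obtain x where x: "x \<in> crossed_Cauchy \<alpha>" "X = cls x" by (auto simp: carrier_B)
  show "extension (z \<odot>\<^bsub>B\<^esub> X) v = z \<odot> extension X v" if v: "v \<in> carrier H" for z v
    unfolding x(2) smult_cls[OF x(1)]
    by (rule extension_eqI[OF Cauchy_scale[OF x(1)] v])
      (use converges_to_smult[OF extension_converges_to[OF x(1) v], of z] v in \<open>simp add: hom_scale\<close>)
  fix Y assume "Y \<in> carrier B"
  then obtain y where y: "y \<in> crossed_Cauchy \<alpha>" "Y = cls y" by (auto simp: carrier_B)
  show "extension (X \<oplus>\<^bsub>B\<^esub> Y) v = extension X v \<oplus> extension Y v" if v: "v \<in> carrier H" for v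
    unfolding x(2) y(2) add_cls[OF x(1) y(1)]
    by (rule extension_eqI[OF Cauchy_add[OF x(1) y(1)] v])
      (use converges_to_add[OF extension_converges_to[OF x(1) v] extension_converges_to[OF y(1) v]] v in \<open>simp add: hom_add\<close>)
  show "extension (X \<otimes>\<^bsub>B\<^esub> Y) = compose (carrier H) (extension X) (extension Y)"
    unfolding x(2) y(2) by (rule extension_mult[OF x(1) y(1)])
next
  fix n and X :: "nat \<Rightarrow> nat \<Rightarrow> (nat \<Rightarrow> 'p \<Rightarrow>\<^sub>0 'a) set"
  assume X: "\<forall>i<n. \<forall>j<n. X i j \<in> carrier B"
  define x where "x i j = (SOME x. x \<in> crossed_Cauchy \<alpha> \<and> X i j = cls x)" for i j
  have x: "x i j \<in> crossed_Cauchy \<alpha>" "X i j = cls (x i j)" if "i < n" "j < n" for i j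
  proof -
    have "\<exists>x. x \<in> crossed_Cauchy \<alpha> \<and> X i j = cls x"
      using X[rule_format, OF that] by (auto simp: carrier_B)
    from someI_ex[OF this] show "x i j \<in> crossed_Cauchy \<alpha>" "X i j = cls (x i j)"
      by (auto simp: x_def)
  qed
  have norm: "matrix_norm B n X = matrix_norm B n (\<lambda>i j. cls (x i j))"
    by (rule matrix_norm_cong) (rule x(2))
  have lim: "(\<lambda>k. crossed_seminorm \<alpha> n (\<lambda>i j. x i j k)) \<longlonglongrightarrow> matrix_norm B n X"
    unfolding norm by (rule matrix_norm_tendsto[OF x(1)])
  show "matrix_op_norm H n (\<lambda>i j. extension (X i j)) \<le> matrix_norm B n X"
  proof (rule matrix_op_norm_le[OF hilbert_space])
    show "extension (X i j) \<in> bounded_operators H H" if "i < n" "j < n" for i j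
      using x[OF that] extension_bounded by simp
    show "0 \<le> matrix_norm B n X"
      by (rule LIMSEQ_le_const[OF lim]) (simp add: crossed_seminorm_nonneg)
    fix v assume v: "\<And>i. i < n \<Longrightarrow> v i \<in> carrier H"
    have "(\<lambda>k. hnorm H (\<Oplus>j\<in>{..<n}. \<Phi> (x i j k) (v j))) \<longlonglongrightarrow> hnorm H (\<Oplus>j\<in>{..<n}. extension (X i j) (v j))"
      if "i < n" for i
      by (intro converges_to_hnorm converges_to_finsum) (use extension_converges_to x that v in auto)
    then have L: "(\<lambda>k. L2_set (\<lambda>i. hnorm H (\<Oplus>j\<in>{..<n}. \<Phi> (x i j k) (v j))) {..<n}) \<longlonglongrightarrow>
        L2_set (\<lambda>i. hnorm H (\<Oplus>j\<in>{..<n}. extension (X i j) (v j))) {..<n}"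
      unfolding L2_set_def by (intro tendsto_intros) auto
    have R: "(\<lambda>k. crossed_seminorm \<alpha> n (\<lambda>i j. x i j k) * L2_set (\<lambda>i. hnorm H (v i)) {..<n}) \<longlonglongrightarrow>
        matrix_norm B n X * L2_set (\<lambda>i. hnorm H (v i)) {..<n}"
      by (intro tendsto_intros lim)
    show "L2_set (\<lambda>i. hnorm H (\<Oplus>j\<in>{..<n}. extension (X i j) (v j))) {..<n}
        \<le> matrix_norm B n X * L2_set (\<lambda>i. hnorm H (v i)) {..<n}"
      by (rule LIMSEQ_le[OF L R], intro exI allI impI, rule L2_hom_le_crossed_seminorm[OF v])
  qed
qed

text \<open>Existence is \<open>extension_cc\<close>, and uniqueness is the density of the embedded
  convolution algebra.\<close>

lemma induced_hom_eq: "induced_hom \<alpha> H \<pi> V = extension"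
  unfolding induced_hom_def
proof (rule the_equality)
  show "cc_homomorphism B H extension \<and> (\<forall>f. extension (crossed_embed \<alpha> f) = \<Phi> f)"
    using extension_cc extension_embed by blast
  show "\<phi> = extension" if "cc_homomorphism B H \<phi> \<and> (\<forall>f. \<phi> (crossed_embed \<alpha> f) = \<Phi> f)" for \<phi>
    using that by (intro cc_unique[OF _ extension_cc]) (auto simp: extension_embed)
qed

end

section \<open>Isometries and contractions\<close>

text \<open>Polarisation: expanding ||x + y||^2 gives the real parts, and replacing x by \<i> x
  gives the imaginary parts.\<close>

lemma isometry_cinner:
  assumes "complex_hilbert_space H" "complex_hilbert_space K" and T: "isometry H K T"
    and x: "x \<in> carrier H" and y: "y \<in> carrier H"
  shows "cinner K (T x) (T y) = cinner H x y"
proof -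
  interpret H: complex_hilbert_space H by fact
  interpret K: complex_hilbert_space K by fact
  have Tb: "T \<in> bounded_operators H K" and norm: "\<And>x. x \<in> carrier H \<Longrightarrow> hnorm K (T x) = hnorm H x"
    using T by (auto simp: isometry_def)
  note cl = bounded_operators_closed[OF Tb]
  have re: "Re (cinner K (T x) (T y)) = Re (cinner H x y)" if "x \<in> carrier H" "y \<in> carrier H" for x y
    using that norm[of "x \<oplus>\<^bsub>H\<^esub> y"] norm[of x] norm[of y] H.hnorm_add_square[of x y] K.hnorm_add_square[of "T x" "T y"] cl
    by (simp add: bounded_operators_add[OF Tb])
  have "Re (cinner K (T (\<i> \<odot>\<^bsub>H\<^esub> x)) (T y)) = Re (cinner H (\<i> \<odot>\<^bsub>H\<^esub> x) y)"
    using x y by (intro re) auto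
  then have "Im (cinner K (T x) (T y)) = Im (cinner H x y)"
    using x y cl by (simp add: bounded_operators_smult[OF Tb] H.cinner_smult_left K.cinner_smult_left)
  then show ?thesis
    using re[OF x y] by (simp add: complex_eq_iff)
qed

lemma isometry_adjoint:
  assumes "complex_hilbert_space H" "complex_hilbert_space K" and T: "isometry H K T"
    and x: "x \<in> carrier H"
  shows "adjoint H K T (T x) = x"
proof -
  interpret H: complex_hilbert_space H by fact
  have Tb: "T \<in> bounded_operators H K" using T by (simp add: isometry_def)
  note adj = adjoint_bounded[OF assms(1,2) Tb] cinner_adjoint[OF assms(1,2) Tb]
  have c: "T x \<in> carrier K" "adjoint H K T (T x) \<in> carrier H"
    using bounded_operators_closed[OF Tb x] bounded_operators_closed[OF adj(1)] by auto
  show ?thesis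
  proof (rule H.vec_eqI)
    fix z assume z: "z \<in> carrier H"
    have "cinner H z (adjoint H K T (T x)) = cinner H z x"
      using adj(2)[OF z c(1)] isometry_cinner[OF assms(1-3) z x] by simp
    then show "cinner H (adjoint H K T (T x)) z = cinner H x z"
      using H.cinner_commute[OF z c(2)] H.cinner_commute[OF z x] by simp
  qed (use c x in auto)
qed

text \<open>In ||T(x + cy)||^2 \<le> ||x + cy||^2 the terms of order zero cancel since T preserves
  the norm of x, and the right side has no linear term since y is orthogonal to x. Hence the linear
  term on the left vanishes. T may shrink every other vector.\<close>

lemma contraction_orthogonal:
  assumes "complex_hilbert_space H" and T: "T \<in> bounded_operators H H"
    and contr: "\<And>v. v \<in> carrier H \<Longrightarrow> hnorm H (T v) \<le> hnorm H v"
    and x: "x \<in> carrier H" "hnorm H (T x) = hnorm H x"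
    and y: "y \<in> carrier H" "cinner H y x = 0"
  shows "cinner H (T y) (T x) = 0"
proof -
  interpret complex_hilbert_space H by fact
  note cl = bounded_operators_closed[OF T]
  have "- cinner H (T y) (T x) = 0"
  proof (rule quadratic_form_zero)
    show "0 \<le> (hnorm H y)\<^sup>2" by simp
    fix c
    have "(hnorm H (T (x \<oplus>\<^bsub>H\<^esub> c \<odot>\<^bsub>H\<^esub> y)))\<^sup>2 \<le> (hnorm H (x \<oplus>\<^bsub>H\<^esub> c \<odot>\<^bsub>H\<^esub> y))\<^sup>2"
      using x y cl by (intro power_mono contr) auto
    also have "\<dots> = (hnorm H x)\<^sup>2 + (cmod c)\<^sup>2 * (hnorm H y)\<^sup>2"
      using x y by (simp add: hnorm_add_smult_square)
    finally have "(hnorm H (T x \<oplus>\<^bsub>H\<^esub> c \<odot>\<^bsub>H\<^esub> T y))\<^sup>2 \<le> (hnorm H x)\<^sup>2 + (cmod c)\<^sup>2 * (hnorm H y)\<^sup>2"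
      using x y by (simp add: bounded_operators_add[OF T] bounded_operators_smult[OF T])
    then have "2 * Re (c * cinner H (T y) (T x)) + (cmod c)\<^sup>2 * (hnorm H (T y))\<^sup>2 \<le> (cmod c)\<^sup>2 * (hnorm H y)\<^sup>2"
      unfolding hnorm_add_smult_square[OF cl[OF x(1)] cl[OF y(1)]] x(2) by linarith
    moreover have "0 \<le> (cmod c)\<^sup>2 * (hnorm H (T y))\<^sup>2" by simp
    ultimately have "0 \<le> 2 * - Re (c * cinner H (T y) (T x)) + (cmod c)\<^sup>2 * (hnorm H y)\<^sup>2"
      by linarith
    then show "0 \<le> 2 * Re (c * - cinner H (T y) (T x)) + (cmod c)\<^sup>2 * (hnorm H y)\<^sup>2"
      by (simp only: mult_minus_right uminus_complex.sel)
  qed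
  then show ?thesis by simp
qed

section \<open>Unitaries\<close>

text \<open>With c the inverse of 1 - x, the unitary is u = (1 + x)c. As x is skew, the star of 1 -
  x is 1 + x, so star u is the inverse of u. The form u + 1 = 2c exhibits c as the mean of two
  unitaries; norm below 1 allows c to be found by the Neumann series.\<close>

lemma Cayley_transform:
  fixes x :: "'a::unital_cstar_algebra"
  assumes skew: "star x = - x" and x: "norm x < 1"
  obtains c u where "c - 1 = x * c" "u + 1 = c + c" "star u * u = 1" "u * star u = 1"
proof -
  obtain c where c: "(1 - x) * c = 1" "c * (1 - x) = 1"
    by (rule Neumann_inverse[OF x])
  have "c - (1 - x) * c = x * c" "c - c * (1 - x) = c * x"
    by (simp_all add: left_diff_distrib right_diff_distrib)
  then have c1: "c - 1 = x * c" "c - 1 = c * x"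
    unfolding c by simp_all
  have cs: "star c * (1 + x) = 1" "(1 + x) * star c = 1"
    using arg_cong[OF c(1), of star] arg_cong[OF c(2), of star] skew by (simp_all add: star_mult star_diff)
  define u where "u = (1 + x) * c"
  \<comment> \<open>Since c commutes with x, u factors in the other order too; the relation for u *
    star u uses this factorisation.\<close>
  have u2: "u = c * (1 + x)"
    unfolding u_def distrib_left distrib_right c1(1)[symmetric] c1(2)[symmetric] by simp
  have us: "star u = star c * (1 - x)"
    using skew by (simp add: u_def star_mult star_add)
  have "star u * u = star c * ((1 - x) * (1 + x)) * c"
    unfolding us unfolding u_def by (simp only: mult.assoc)
  also have "(1 - x) * (1 + x) = (1 + x) * (1 - x)"
    by (simp add: left_diff_distrib right_diff_distrib distrib_left distrib_right)
  also have "star c * ((1 + x) * (1 - x)) * c = (star c * (1 + x)) * ((1 - x) * c)"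
    by (simp add: mult.assoc)
  finally have "star u * u = 1" by (simp add: c cs)
  moreover have "u * star u = c * ((1 + x) * star c) * (1 - x)"
    unfolding us unfolding u2 by (simp only: mult.assoc)
  then have "u * star u = 1" by (simp add: c cs)
  moreover have "u + 1 = c + c"
    unfolding u_def distrib_right c1(1)[symmetric] by simp
  ultimately show thesis using that c1(1) by blast
qed

section \<open>Dilations\<close>

context dynamical_system
begin

lemma c00_mult_single:
  "c00_mult \<alpha> (Poly_Mapping.single p a) (Poly_Mapping.single q b) = Poly_Mapping.single (p * q) (a * \<alpha> p b)"
  by (cases "a = 0"; cases "b = 0") (simp_all add: c00_mult_def)

end

lemma sum_single_keys:
  "f = (\<Sum>p\<in>Poly_Mapping.keys f. Poly_Mapping.single p (Poly_Mapping.lookup f p))"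
proof (rule poly_mapping_eqI)
  fix q
  have "(\<Sum>p\<in>Poly_Mapping.keys f. Poly_Mapping.lookup (Poly_Mapping.single p (Poly_Mapping.lookup f p)) q)
      = (\<Sum>p\<in>Poly_Mapping.keys f. if p = q then Poly_Mapping.lookup f p else 0)"
    by (rule sum.cong) (simp_all add: lookup_single when_def)
  also have "\<dots> = Poly_Mapping.lookup f q"
    by (simp add: in_keys_iff)
  finally show "Poly_Mapping.lookup f q =
      Poly_Mapping.lookup (\<Sum>p\<in>Poly_Mapping.keys f. Poly_Mapping.single p (Poly_Mapping.lookup f p)) q"
    by (simp add: lookup_sum)
qed

locale covariant_dilation = right_covariant_rep \<alpha> H \<pi> V
  for \<alpha> :: "'p::monoid_mult \<Rightarrow> 'a::unital_cstar_algebra \<Rightarrow> 'a"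
    and H :: "'h hilbert" (structure) and \<pi> :: "'a \<Rightarrow> 'h \<Rightarrow> 'h" and V :: "'p \<Rightarrow> 'h \<Rightarrow> 'h" +
  fixes K :: "'k hilbert" and J :: "'h \<Rightarrow> 'k" and \<rho> :: "(nat \<Rightarrow> ('p \<Rightarrow>\<^sub>0 'a)) set \<Rightarrow> 'k \<Rightarrow> 'k"
  assumes covariant: "isometric_covariant_rep \<alpha> H \<pi> V"
    and dilation: "is_dilation B H extension K J \<rho>"
begin

lemma cc: "cc_homomorphism B K \<rho>"
  using dilation unfolding is_dilation_def by blast

lemma J_isometry: "isometry H K J"
  using dilation unfolding is_dilation_def by blast

lemma hilbert_space_K: "complex_hilbert_space K"
  by (rule cc_hilbert_space[OF cc])

sublocale K: complex_hilbert_space K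
  by (rule hilbert_space_K)

abbreviation "A \<equiv> adjoint H K J"

lemma J_bounded: "J \<in> bounded_operators H K"
  using J_isometry by (simp add: isometry_def)

lemma J_closed [simp]: "x \<in> carrier H \<Longrightarrow> J x \<in> carrier K"
  using J_bounded by (rule bounded_operators_closed)

lemma J_norm [simp]: "x \<in> carrier H \<Longrightarrow> hnorm K (J x) = hnorm H x"
  using J_isometry by (simp add: isometry_def)

lemma A_bounded: "A \<in> bounded_operators K H"
  by (rule adjoint_bounded[OF hilbert_space hilbert_space_K J_bounded])

lemma A_closed [simp]: "v \<in> carrier K \<Longrightarrow> A v \<in> carrier H"
  using A_bounded by (rule bounded_operators_closed)

lemma cinner_A: "x \<in> carrier H \<Longrightarrow> v \<in> carrier K \<Longrightarrow> cinner K (J x) v = cinner H x (A v)"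
  by (rule cinner_adjoint[OF hilbert_space hilbert_space_K J_bounded])

lemma A_J [simp]: "x \<in> carrier H \<Longrightarrow> A (J x) = x"
  by (rule isometry_adjoint[OF hilbert_space hilbert_space_K J_isometry])

lemma A_zero [simp]: "A \<zero>\<^bsub>K\<^esub> = \<zero>"
  by (rule bounded_operators_zero[OF hilbert_space_K hilbert_space A_bounded])

lemma A_diff_J: "v \<in> carrier K \<Longrightarrow> A (v \<ominus>\<^bsub>K\<^esub> J (A v)) = \<zero>"
  by (simp add: bounded_operators_diff[OF hilbert_space_K hilbert_space A_bounded])

lemma split_vec: "v \<in> carrier K \<Longrightarrow> v = J (A v) \<oplus>\<^bsub>K\<^esub> (v \<ominus>\<^bsub>K\<^esub> J (A v))"
  by (rule K.vec_eqI) (simp_all add: K.cinner_simps)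

text \<open>By Pythagoras, ||v||^2 is the sum of ||A v||^2 and the square norm of the component
  orthogonal to the range of \<open>J\<close>. A vector that loses no norm under compression has no
  such component.\<close>

lemma range_J_eqI:
  assumes v: "v \<in> carrier K" and le: "hnorm K v \<le> hnorm H (A v)"
  shows "v = J (A v)"
proof -
  let ?z = "v \<ominus>\<^bsub>K\<^esub> J (A v)"
  have "cinner K (J (A v)) ?z = 0"
    using v cinner_A[of "A v" ?z] by (simp add: A_diff_J)
  then have "(hnorm K v)\<^sup>2 = (hnorm H (A v))\<^sup>2 + (hnorm K ?z)\<^sup>2"
    using K.hnorm_add_square[of "J (A v)" ?z] split_vec[OF v] v by simp
  moreover have "(hnorm K v)\<^sup>2 \<le> (hnorm H (A v))\<^sup>2"
    using v le by (intro power_mono) auto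
  ultimately have "hnorm K ?z = 0" by simp
  then show ?thesis using v by (simp add: K.diff_eq_zero_iff)
qed

text \<open>\<open>J\<close> after \<open>A\<close> is the projection onto the range of
  \<open>J\<close>, and the kernel of \<open>A\<close> is its orthogonal complement. The two clauses
  are the invariance of these subspaces; phrasing both through \<open>A\<close> avoids the adjoint
  of T, about which \<open>\<rho>\<close> gives no information.\<close>

definition reduces :: "('k \<Rightarrow> 'k) \<Rightarrow> bool" where
  "reduces T \<longleftrightarrow> (\<forall>x\<in>carrier H. T (J x) = J (A (T (J x)))) \<and> (\<forall>y\<in>carrier K. A y = \<zero> \<longrightarrow> A (T y) = \<zero>)"

abbreviation "E f \<equiv> \<rho> (crossed_embed \<alpha> f)"

lemma E_bounded: "E f \<in> bounded_operators K K"
  by (rule cc_bounded[OF cc embed_closed])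

lemma E_closed [simp]: "v \<in> carrier K \<Longrightarrow> E f v \<in> carrier K"
  using E_bounded by (rule bounded_operators_closed)

lemma E_norm: "v \<in> carrier K \<Longrightarrow> hnorm K (E f v) \<le> crossed_seminorm1 \<alpha> f * hnorm K v"
  by (rule cc_embed_bound[OF cc])

lemma E_add: "v \<in> carrier K \<Longrightarrow> E (f + g) v = E f v \<oplus>\<^bsub>K\<^esub> E g v"
  using cc_add[OF cc embed_closed embed_closed] by (simp add: add_embed)

lemma E_scale: "v \<in> carrier K \<Longrightarrow> E (c00_scale c f) v = c \<odot>\<^bsub>K\<^esub> E f v"
  using cc_smult[OF cc embed_closed] by (simp add: smult_embed)

lemma E_mult: "v \<in> carrier K \<Longrightarrow> E (c00_mult \<alpha> f g) v = E f (E g v)"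
  using cc_compose[OF cc embed_closed embed_closed, of f g] by (simp add: mult_embed compose_eq)

lemma dilation_eq: "X \<in> carrier B \<Longrightarrow> x \<in> carrier H \<Longrightarrow> A (\<rho> X (J x)) = extension X x"
  using dilation unfolding is_dilation_def by (auto simp: compose_eq)

lemma A_E_J: "x \<in> carrier H \<Longrightarrow> A (E f (J x)) = \<Phi> f x"
  by (simp add: dilation_eq[OF embed_closed] extension_embed)

lemma reduces_E_J: "reduces (E f) \<Longrightarrow> x \<in> carrier H \<Longrightarrow> E f (J x) = J (\<Phi> f x)"
  unfolding reduces_def using A_E_J[of x f] by metis

lemma reduces_add: 
  assumes "reduces (E f)" "reduces (E g)"
  shows "reduces (E (f + g))"
  unfolding reduces_def
proof (intro conjI ballI impI)
  show "E (f + g) (J x) = J (A (E (f + g) (J x)))" if "x \<in> carrier H" for x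
    using that assms by (simp add: A_E_J E_add reduces_E_J bounded_operators_add[OF A_bounded] bounded_operators_add[OF J_bounded])
  show "A (E (f + g) y) = \<zero>" if "y \<in> carrier K" "A y = \<zero>" for y
    using that assms by (simp add: E_add bounded_operators_add[OF A_bounded] reduces_def)
qed

lemma reduces_scale: 
  assumes "reduces (E f)"
  shows "reduces (E (c00_scale c f))"
  unfolding reduces_def
proof (intro conjI ballI impI)
  show "E (c00_scale c f) (J x) = J (A (E (c00_scale c f) (J x)))" if "x \<in> carrier H" for x
    using that assms by (simp add: A_E_J E_scale reduces_E_J bounded_operators_smult[OF A_bounded] bounded_operators_smult[OF J_bounded])
  show "A (E (c00_scale c f) y) = \<zero>" if "y \<in> carrier K" "A y = \<zero>" for y
    using that assms by (simp add: E_scale bounded_operators_smult[OF A_bounded] reduces_def)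
qed

lemma reduces_mult:
  assumes "reduces (E f)" "reduces (E g)"
  shows "reduces (E (c00_mult \<alpha> f g))"
  unfolding reduces_def
proof (intro conjI ballI impI)
  show "E (c00_mult \<alpha> f g) (J x) = J (A (E (c00_mult \<alpha> f g) (J x)))" if "x \<in> carrier H" for x
    using that assms by (simp add: A_E_J E_mult reduces_E_J hom_mult)
  show "A (E (c00_mult \<alpha> f g) y) = \<zero>" if "y \<in> carrier K" "A y = \<zero>" for y
    using that assms by (simp add: E_mult reduces_def)
qed

text \<open>Both invariance conditions are equations between continuous expressions in T v, hence
  stable under pointwise limits.\<close>

lemma reduces_limit:
  assumes red: "\<And>k. reduces (T k)" and lim: "\<And>v. v \<in> carrier K \<Longrightarrow> K.converges_to (\<lambda>k. T k v) (S v)"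
  shows "reduces S"
  unfolding reduces_def
proof (intro conjI ballI impI)
  note A_lim = bounded_operators_converges_to[OF hilbert_space_K hilbert_space A_bounded]
  note J_lim = bounded_operators_converges_to[OF hilbert_space hilbert_space_K J_bounded]
  show "S (J x) = J (A (S (J x)))" if x: "x \<in> carrier H" for x
  proof (rule K.converges_to_unique)
    show "K.converges_to (\<lambda>k. T k (J x)) (S (J x))"
      using x by (intro lim) simp
    from J_lim[OF A_lim[OF this]] show "K.converges_to (\<lambda>k. T k (J x)) (J (A (S (J x))))"
      using red x by (simp add: reduces_def)
  qed
  show "A (S y) = \<zero>" if y: "y \<in> carrier K" "A y = \<zero>" for y
  proof (rule converges_to_unique[OF A_lim[OF lim[OF y(1)]]])
    have "A (T k y) = \<zero>" for k
      using red[of k] y by (simp add: reduces_def)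
    then show "converges_to (\<lambda>k. A (T k y)) \<zero>"
      by (simp add: converges_to_const)
  qed
qed

lemma reduces_seminorm_limit:
  assumes red: "\<And>k. reduces (E (g k))" and lim: "(\<lambda>k. crossed_seminorm1 \<alpha> (g k - f)) \<longlonglongrightarrow> 0"
  shows "reduces (E f)"
proof (rule reduces_limit[OF red])
  fix v assume v: "v \<in> carrier K"
  show "K.converges_to (\<lambda>k. E (g k) v) (E f v)"
  proof (rule K.converges_toI)
    show "(\<lambda>k. crossed_seminorm1 \<alpha> (g k - f) * hnorm K v) \<longlonglongrightarrow> 0"
      by (rule tendsto_mult_left_zero[OF lim])
    fix k
    have "E (g k) v = E (g k - f) v \<oplus>\<^bsub>K\<^esub> E f v"
      using E_add[OF v, of "g k - f" f] by simp
    then have "E (g k) v \<ominus>\<^bsub>K\<^esub> E f v = E (g k - f) v"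
      by (intro K.vec_eqI) (use v in \<open>simp_all add: K.cinner_simps\<close>)
    then show "hnorm K (E (g k) v \<ominus>\<^bsub>K\<^esub> E f v) \<le> crossed_seminorm1 \<alpha> (g k - f) * hnorm K v"
      using E_norm[OF v] by simp
  qed (use v in auto)
qed

section \<open>Contractions whose compression to H is isometric\<close>

lemma contraction_E:
  assumes "crossed_seminorm1 \<alpha> f \<le> 1" "v \<in> carrier K"
  shows "hnorm K (E f v) \<le> hnorm K v"
  using E_norm[OF assms(2), of f] mult_right_mono[OF assms(1), of "hnorm K v"] assms(2) by simp

text \<open>The norms form a chain: the image of \<open>J x\<close> has norm at most ||x||, while
  its compression \<open>\<Phi> f x\<close> already has norm ||x||. Nothing is left for the
  complement.\<close>

lemma isometric_E_J:
  assumes f: "crossed_seminorm1 \<alpha> f \<le> 1" and iso: "\<And>x. x \<in> carrier H \<Longrightarrow> hnorm H (\<Phi> f x) = hnorm H x"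
    and x: "x \<in> carrier H"
  shows "E f (J x) = J (\<Phi> f x)"
proof -
  have "E f (J x) = J (A (E f (J x)))"
    using contraction_E[OF f, of "J x"] x by (intro range_J_eqI) (simp_all add: A_E_J iso)
  then show ?thesis using x by (simp add: A_E_J)
qed

text \<open>\<open>contraction_orthogonal\<close> applied in K to \<open>J x\<close> and y, read
  back in H through \<open>A\<close>: the H-component of the image of y is orthogonal to the range
  of \<open>\<Phi> f\<close>.\<close>

lemma isometric_E_orthogonal:
  assumes f: "crossed_seminorm1 \<alpha> f \<le> 1" and iso: "\<And>x. x \<in> carrier H \<Longrightarrow> hnorm H (\<Phi> f x) = hnorm H x"
    and x: "x \<in> carrier H" and y: "y \<in> carrier K" "A y = \<zero>"
  shows "cinner H (\<Phi> f x) (A (E f y)) = 0"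
proof -
  have "cinner K (J x) y = 0"
    using cinner_A[OF x y(1)] y x by simp
  then have "cinner K y (J x) = 0"
    using K.cinner_commute[of "J x" y] x y by simp
  then have "cinner K (E f y) (E f (J x)) = 0"
    using x y isometric_E_J[OF f iso x]
    by (intro contraction_orthogonal[OF hilbert_space_K E_bounded contraction_E[OF f]]) (simp_all add: iso)
  then have "cinner K (J (\<Phi> f x)) (E f y) = 0"
    using K.cinner_commute[of "E f y" "E f (J x)"] x y isometric_E_J[OF f iso x] by simp
  then show ?thesis
    using x y by (simp add: cinner_A)
qed

text \<open>A unitary compresses to a surjective isometry, so the H-component w of the image of y is
  itself in the range, as the image of \<open>\<pi> (star u) w\<close>. Being orthogonal to that
  range, w is orthogonal to itself.\<close>

lemma reduces_unitary:
  assumes u: "star u * u = 1" "u * star u = 1"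
  shows "reduces (E (Poly_Mapping.single 1 u))"
proof -
  let ?f = "Poly_Mapping.single 1 u"
  have f: "crossed_seminorm1 \<alpha> ?f \<le> 1"
    using crossed_seminorm1_single isometric_norm_le[OF u(1)] by (rule order_trans)
  have iso: "hnorm H (\<Phi> ?f x) = hnorm H x" if x: "x \<in> carrier H" for x
    using rep_star[of x "\<pi> u x" u] x u by (simp add: hom_single hnorm_def rep_mult[symmetric])
  show ?thesis
    unfolding reduces_def
  proof (intro conjI ballI impI)
    show "E ?f (J x) = J (A (E ?f (J x)))" if x: "x \<in> carrier H" for x
      using isometric_E_J[OF f iso x] x by (simp add: A_E_J)
    show "A (E ?f y) = \<zero>" if y: "y \<in> carrier K" "A y = \<zero>" for y
    proof -
      define w where "w = A (E ?f y)"
      have w: "w \<in> carrier H" using y by (simp add: w_def)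
      have "\<Phi> ?f (\<pi> (star u) w) = w"
        using w u by (simp add: hom_single rep_mult[symmetric])
      then have "cinner H w w = 0"
        using isometric_E_orthogonal[OF f iso, of "\<pi> (star u) w" y] y w by (simp add: w_def)
      then show ?thesis using cinner_eq_zero[OF w] by (simp add: w_def)
    qed
  qed
qed

lemma scale_single: "c00_scale c (Poly_Mapping.single p a) = Poly_Mapping.single p (c *\<^sub>C a)"
  by (rule poly_mapping_eqI) (simp add: lookup_c00_scale lookup_single when_def)

text \<open>With the Cayley transform \<open>u\<close> of \<open>x = ith\<close> and \<open>c = (1 + u)/2 = (1 - x)\<^sup>-\<^sup>1\<close>, the element
  \<open>hc = (c - 1)/(it)\<close> tends to \<open>h\<close> as \<open>t\<close> tends to \<open>0\<close>.\<close>

lemma reduces_self_adjoint: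
  assumes h: "star h = h"
  shows "reduces (E (Poly_Mapping.single 1 h))"
proof -
  \<comment> \<open>The factor \<open>inverse (norm h + 1)\<close> keeps the norm of \<i> t h below
    1 for every k, as the Cayley transform requires; the other factor sends t to 0.\<close>
  define t where "t k = inverse (norm h + 1) * inverse (real (Suc k))" for k
  have nh: "norm h + 1 > 0" by (simp add: add_nonneg_pos)
  then have t: "t k > 0" for k by (simp add: t_def)
  have tlim: "t \<longlonglongrightarrow> 0"
    unfolding t_def by (intro tendsto_mult_right_zero LIMSEQ_inverse_real_of_nat)
  define x where "x k = (\<i> * complex_of_real (t k)) *\<^sub>C h" for k
  have skew: "star (x k) = - x k" for k
    by (simp add: x_def star_scaleC h scaleC_minus_left)
  have nx: "norm (x k) = t k * norm h" for k
    using t[of k] by (simp add: x_def norm_scaleC norm_mult)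
  have "norm (x k) < 1" for k
  proof -
    have "t k \<le> inverse (norm h + 1)"
      using nh unfolding t_def by (intro mult_right_le_one_le) (auto simp: inverse_le_1_iff)
    then have "norm (x k) \<le> inverse (norm h + 1) * norm h"
      unfolding nx by (intro mult_right_mono) auto
    also have "\<dots> < 1" using nh by (simp add: field_simps)
    finally show ?thesis .
  qed
  then have "\<exists>c u. c - 1 = x k * c \<and> u + 1 = c + c \<and> star u * u = 1 \<and> u * star u = 1" for k
    using Cayley_transform[OF skew[of k]] by metis
  then obtain c u where cu: "\<And>k. c k - 1 = x k * c k" "\<And>k. u k + 1 = c k + c k"
    "\<And>k. star (u k) * u k = 1" "\<And>k. u k * star (u k) = 1"
    by metis
  have c_eq: "c k = (1/2) *\<^sub>C (u k + 1)" for k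
    unfolding cu(2) by (simp add: scaleC_add_right scaleC_add_left[symmetric])
  have one: "reduces (E (Poly_Mapping.single 1 1))"
    by (rule reduces_unitary) simp_all
  \<comment> \<open>Solving c - 1 = x c for h c, where x = \<i> t h. As c is the mean of u and 1,
    this writes h c as a linear combination of unitaries.\<close>
  have hc: "h * c k = (1 / (\<i> * complex_of_real (t k))) *\<^sub>C (c k + (-1) *\<^sub>C 1)" for k
    using t[of k] cu(1)[of k] by (simp add: x_def mult_scaleC_left scaleC_scaleC scaleC_minus_one)
  have "reduces (E (Poly_Mapping.single 1 (h * c k)))" for k
    unfolding hc unfolding c_eq scale_single[symmetric] Poly_Mapping.single_add
    by (intro reduces_scale reduces_add one reduces_unitary cu)
  moreover have "(\<lambda>k. crossed_seminorm1 \<alpha> (Poly_Mapping.single 1 (h * c k) - Poly_Mapping.single 1 h)) \<longlonglongrightarrow> 0"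
  proof (rule tendsto_sandwich[OF _ _ tendsto_const])
    show "(\<lambda>k. norm h * (t k * norm h)) \<longlonglongrightarrow> 0"
      by (intro tendsto_mult_right_zero tendsto_mult_left_zero tlim)
    show "\<forall>\<^sub>F k in sequentially. 0 \<le> crossed_seminorm1 \<alpha> (Poly_Mapping.single 1 (h * c k) - Poly_Mapping.single 1 h)"
      by (rule always_eventually) (simp add: crossed_seminorm_nonneg)
    have "crossed_seminorm1 \<alpha> (Poly_Mapping.single 1 (h * c k) - Poly_Mapping.single 1 h) \<le> norm h * (t k * norm h)" for k
    proof -
      have "crossed_seminorm1 \<alpha> (Poly_Mapping.single 1 (h * c k) - Poly_Mapping.single 1 h) \<le> norm (h * c k - h)"
        using crossed_seminorm1_single[of 1 "h * c k - h"] by (simp add: single_diff)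
      \<comment> \<open>The error is of order t: x is of size t * norm h, and c stays in the unit
        ball for all k, being the mean of u and 1.\<close>
      also have "h * c k - h = h * (x k * c k)"
        by (simp add: cu(1)[symmetric] right_diff_distrib)
      also have "norm \<dots> \<le> norm h * (norm (x k) * norm (c k))"
        by (intro order_trans[OF norm_mult_ineq] mult_left_mono norm_mult_ineq) simp
      also have "\<dots> \<le> norm h * (norm (x k) * 1)"
      proof (intro mult_left_mono)
        have "norm (c k) \<le> (1/2) * (norm (u k) + norm (1::'a))"
          unfolding c_eq norm_scaleC using norm_triangle_ineq[of "u k" 1] by simp
        also have "\<dots> \<le> 1"
          using isometric_norm_le[OF cu(3)[of k]] norm_one_le[where 'a='a] by simp
        finally show "norm (c k) \<le> 1" .
      qed simp_all
      finally show ?thesis by (simp add: nx)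
    qed
    then show "\<forall>\<^sub>F k in sequentially. crossed_seminorm1 \<alpha> (Poly_Mapping.single 1 (h * c k) - Poly_Mapping.single 1 h)
        \<le> norm h * (t k * norm h)"
      by (intro always_eventually allI)
  qed
  ultimately show ?thesis
    by (rule reduces_seminorm_limit)
qed

text \<open>The decomposition of a into self-adjoint real and imaginary parts h and g reduces the
  claim to self-adjoint elements.\<close>

lemma reduces_algebra: "reduces (E (Poly_Mapping.single 1 a))"
proof -
  define h where "h = (1/2) *\<^sub>C (a + star a)"
  define g where "g = (- \<i> / 2) *\<^sub>C (a - star a)"
  have hg: "star h = h" "star g = g"
  proof -
    show "star h = h" by (simp add: h_def star_scaleC star_add star_star add.commute)
    have "star g = (\<i> / 2) *\<^sub>C (- (a - star a))"
      by (simp add: g_def star_scaleC star_diff star_star)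
    also have "\<dots> = g"
      unfolding g_def scaleC_minus_one[of "a - star a", symmetric] scaleC_scaleC by simp
    finally show "star g = g" .
  qed
  have "a = h + \<i> *\<^sub>C g"
  proof -
    have "h + \<i> *\<^sub>C g = (1/2) *\<^sub>C ((a + star a) + (a - star a))"
      unfolding h_def g_def scaleC_scaleC scaleC_add_right[of "1/2"] by simp
    also have "\<dots> = a"
      by (simp add: scaleC_add_right scaleC_add_left[symmetric])
    finally show ?thesis by simp
  qed
  then show ?thesis
    by (metis reduces_self_adjoint hg reduces_add reduces_scale Poly_Mapping.single_add scale_single)
qed

text \<open>Covariance at the unit: \<open>\<pi> (\<alpha> p 1)\<close> is the range projection of
  V_p. Right covariance would only give that it fixes the range of V_p.\<close>

lemma V_adjoint: "x \<in> carrier H \<Longrightarrow> \<pi> (\<alpha> p 1) x = V p (adjoint H H (V p) x)"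
proof -
  assume x: "x \<in> carrier H"
  have "compose (carrier H) (V p) (compose (carrier H) (\<pi> 1) (adjoint H H (V p))) = \<pi> (\<alpha> p 1)"
    using covariant unfolding isometric_covariant_rep_def by blast
  moreover have "adjoint H H (V p) x \<in> carrier H"
    by (rule bounded_operators_closed[OF adjoint_bounded[OF hilbert_space hilbert_space V_bounded] x])
  ultimately show ?thesis
    using x by (metis compose_eq rep_one)
qed

text \<open>For \<open>w = \<rho>(1 \<otimes> \<delta>\<^sub>p)y\<close> with \<open>y\<close> orthogonal to \<open>H\<close>, the component of \<open>w\<close> in \<open>H\<close> lies in the range of
  \<open>\<pi>(\<alpha>\<^sub>p(1)) = V\<^sub>p V\<^sub>p\<^sup>*\<close> because \<open>(1 - \<alpha>\<^sub>p(1)) \<otimes> \<delta>\<^sub>p\<close> has seminorm zero. But \<open>w\<close> is orthogonal to the range of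
  \<open>V\<^sub>p\<close>, since \<open>\<rho>(1 \<otimes> \<delta>\<^sub>p)\<close> is a contraction extending the isometry \<open>V\<^sub>p\<close>.\<close>

lemma reduces_V: "reduces (E (Poly_Mapping.single p 1))"
proof -
  let ?f = "Poly_Mapping.single p (1::'a)" and ?q = "Poly_Mapping.single (1::'p) (1 - \<alpha> p 1)"
  have f: "crossed_seminorm1 \<alpha> ?f \<le> 1"
    using crossed_seminorm1_single norm_one_le by (rule order_trans)
  have iso: "hnorm H (\<Phi> ?f x) = hnorm H x" if x: "x \<in> carrier H" for x
    using x by (simp add: hom_single)
  show ?thesis
    unfolding reduces_def
  proof (intro conjI ballI impI)
    show "E ?f (J x) = J (A (E ?f (J x)))" if x: "x \<in> carrier H" for x
      using isometric_E_J[OF f iso x] x by (simp add: A_E_J)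
    show "A (E ?f y) = \<zero>" if y: "y \<in> carrier K" "A y = \<zero>" for y
    proof -
      define w where "w = E ?f y"
      have w: "w \<in> carrier K" using y by (simp add: w_def)
      let ?z = "w \<ominus>\<^bsub>K\<^esub> J (A w)"
      \<comment> \<open>Applying \<open>?q\<close> after \<open>?f\<close> multiplies out to (1 -
        \<alpha>_p(1)) \<otimes> \<delta>_p, since the action of the identity fixes the
        unit.\<close>
      have "E ?q w = E (Poly_Mapping.single p (1 - \<alpha> p 1)) y"
        using E_mult[OF y(1), of ?q ?f] by (simp add: w_def c00_mult_single)
      then have "hnorm K (E ?q w) \<le> 0"
        using E_norm[OF y(1), of "Poly_Mapping.single p (1 - \<alpha> p 1)"] by (simp add: crossed_seminorm1_defect)
      then have qw: "E ?q w = \<zero>\<^bsub>K\<^esub>"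
        using w K.hnorm_ge_zero[of "E ?q w"] by (metis E_closed K.hnorm_eq_zero antisym)
      have "E ?q w = E ?q (J (A w) \<oplus>\<^bsub>K\<^esub> ?z)"
        using split_vec[OF w] by simp
      also have "\<dots> = E ?q (J (A w)) \<oplus>\<^bsub>K\<^esub> E ?q ?z"
        using w by (intro bounded_operators_add[OF E_bounded]) auto
      finally have "A (E ?q w) = A (E ?q (J (A w))) \<oplus> A (E ?q ?z)"
        using w by (simp add: bounded_operators_add[OF A_bounded])
      \<comment> \<open>The part of w orthogonal to H contributes nothing to the H-component,
        because \<open>?q\<close> comes from the algebra, for which the complement of H is already
        known to be invariant.\<close>
      moreover have "A (E ?q ?z) = \<zero>"
        using reduces_algebra[of "1 - \<alpha> p 1"] A_diff_J[OF w] w by (simp add: reduces_def)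
      ultimately have "\<pi> (1 - \<alpha> p 1) (A w) = \<zero>"
        using qw w by (simp add: A_E_J hom_single)
      then have "A w \<ominus> V p (adjoint H H (V p) (A w)) = \<zero>"
        using w V_adjoint[of "A w" p] by (simp add: rep_diff)
      moreover have c: "adjoint H H (V p) (A w) \<in> carrier H"
        using w bounded_operators_closed[OF adjoint_bounded[OF hilbert_space hilbert_space V_bounded]] by simp
      ultimately have Aw: "A w = V p (adjoint H H (V p) (A w))"
        using w diff_eq_zero_iff[OF A_closed[OF w] V_closed[OF c]] by blast
      \<comment> \<open>Orthogonality to the range of V_p, tested at the preimage of
        \<open>A w\<close> just found, makes \<open>A w\<close> orthogonal to itself.\<close>
      have "cinner H (V p (adjoint H H (V p) (A w))) (A w) = 0"
        using isometric_E_orthogonal[OF f iso c y] c by (simp add: hom_single w_def)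
      then have "cinner H (A w) (A w) = 0"
        using Aw by simp
      then show ?thesis using cinner_eq_zero[of "A w"] w by (simp add: w_def)
    qed
  qed
qed

text \<open>Each symbol a \<otimes> \<delta>_p is the product of a \<otimes> \<delta>_1 and 1
  \<otimes> \<delta>_p, and reducing operators are closed under products and sums.\<close>

lemma reduces_c00: "reduces (E f)"
proof -
  have zero: "reduces (E 0)"
    using reduces_algebra[of 0] by simp
  have single: "reduces (E (Poly_Mapping.single p a))" for p a
    using reduces_mult[OF reduces_algebra[of a] reduces_V[of p]] by (simp add: c00_mult_single)
  have "reduces (E (\<Sum>p\<in>S. Poly_Mapping.single p (g p)))" if "finite S" for S g
    using that by (induction S rule: finite_induct) (simp_all add: zero reduces_add single)
  from this[of "Poly_Mapping.keys f" "Poly_Mapping.lookup f"] show ?thesis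
    by (simp add: sum_single_keys[symmetric])
qed

lemma reduces_all:
  assumes X: "X \<in> carrier B"
  shows "reduces (\<rho> X)"
proof -
  obtain x where x: "x \<in> crossed_Cauchy \<alpha>" "X = cls x" using X by (auto simp: carrier_B)
  show ?thesis
    unfolding x(2) by (rule reduces_limit[OF reduces_c00 cc_converges_to[OF cc x(1)]])
qed

section \<open>The complementary summand\<close>

definition \<psi> :: "(nat \<Rightarrow> ('p \<Rightarrow>\<^sub>0 'a)) set \<Rightarrow> 'k \<Rightarrow> 'k" where
  "\<psi> = (\<lambda>X\<in>carrier B. \<lambda>y\<in>carrier (orthogonal_complement K (J ` carrier H)). \<rho> X y)"

lemma carrier_complement: "carrier (orthogonal_complement K (J ` carrier H)) = {y \<in> carrier K. A y = \<zero>}"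
proof -
  have "(\<forall>x\<in>carrier H. cinner K (J x) y = 0) \<longleftrightarrow> A y = \<zero>" if "y \<in> carrier K" for y
    using that cinner_eq_zero[of "A y"] by (auto simp: cinner_A)
  then show ?thesis by (auto simp: orthogonal_complement_def)
qed

text \<open>Both summands are invariant under every value of \<open>\<rho>\<close>. On the
  complement \<open>\<psi>\<close> inherits multiplicativity and complete contractivity as a
  restriction to an invariant subspace; on H the restriction coincides with the compression, which
  is \<open>extension\<close>.\<close>

theorem direct_sum:
  "cc_homomorphism B (orthogonal_complement K (J ` carrier H)) \<psi>"
  "is_direct_sum B H extension K J \<psi> \<rho>"
proof -
  let ?G = "orthogonal_complement K (J ` carrier H)"
  interpret G: hilbert_embedding K ?G "\<lambda>x. x"
    by (rule hilbert_embedding_complement[OF hilbert_space_K]) auto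
  have inv: "\<rho> X y \<in> carrier ?G" if "X \<in> carrier B" "y \<in> carrier ?G" for X y
    using reduces_all[OF that(1)] that bounded_operators_closed[OF cc_bounded[OF cc that(1)]]
    by (auto simp: carrier_complement reduces_def)
  \<comment> \<open>For an inclusion \<open>inv_into\<close> is the identity on the subspace, so the
    general facts about restrictions apply to \<open>\<psi>\<close>.\<close>
  have psi: "\<psi> X = G.pull (\<rho> X)" if "X \<in> carrier B" for X
  proof -
    have "inv_into (carrier ?G) (\<lambda>x. x) (\<rho> X y) = \<rho> X y" if "y \<in> carrier ?G" for y
      using inv_into_f_f[OF G.emb_inj inv[OF \<open>X \<in> carrier B\<close> that]] .
    then show ?thesis
      unfolding \<psi>_def G.pull_def using that by (simp cong: restrict_cong)
  qed
  have psi_eq: "\<psi> X y = \<rho> X y" if "X \<in> carrier B" "y \<in> carrier ?G" for X y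
    using that by (simp add: \<psi>_def)
  have ops: "add ?G = add K" "smult ?G = smult K"
    by (simp_all add: orthogonal_complement_def)
  have GK: "y \<in> carrier K" if "y \<in> carrier ?G" for y
    using that by (simp add: carrier_complement)
  have bounded: "\<psi> X \<in> bounded_operators ?G ?G" if "X \<in> carrier B" for X
    unfolding psi[OF that] by (rule G.pull_bounded[OF cc_bounded[OF cc that]]) (use inv[OF that] in auto)
  have closed_B: "X \<oplus>\<^bsub>B\<^esub> Y \<in> carrier B" "X \<otimes>\<^bsub>B\<^esub> Y \<in> carrier B" "z \<odot>\<^bsub>B\<^esub> X \<in> carrier B"
    if "X \<in> carrier B" "Y \<in> carrier B" for X Y z
  proof -
    note XY = that
    obtain x where x: "x \<in> crossed_Cauchy \<alpha>" "X = cls x"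
      using XY(1) by (auto simp: carrier_B)
    obtain y where y: "y \<in> crossed_Cauchy \<alpha>" "Y = cls y"
      using XY(2) by (auto simp: carrier_B)
    show "X \<oplus>\<^bsub>B\<^esub> Y \<in> carrier B" "X \<otimes>\<^bsub>B\<^esub> Y \<in> carrier B" "z \<odot>\<^bsub>B\<^esub> X \<in> carrier B"
      unfolding x(2) y(2) add_cls[OF x(1) y(1)] mult_cls[OF x(1) y(1)] smult_cls[OF x(1)]
      by (rule cls_closed Cauchy_add Cauchy_mult Cauchy_scale x(1) y(1))+
  qed
  show "cc_homomorphism B ?G \<psi>"
    unfolding cc_homomorphism_def
  proof (intro conjI allI ballI impI G.hilbert_space_G)
    show "\<psi> \<in> carrier B \<rightarrow>\<^sub>E bounded_operators ?G ?G"
      by (rule PiE_I) (simp_all add: bounded, simp add: \<psi>_def)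
    show "\<psi> (X \<oplus>\<^bsub>B\<^esub> Y) y = \<psi> X y \<oplus>\<^bsub>?G\<^esub> \<psi> Y y" if "X \<in> carrier B" "Y \<in> carrier B" "y \<in> carrier ?G" for X Y y
      using that by (simp add: psi_eq closed_B ops cc_add[OF cc] GK)
    show "\<psi> (z \<odot>\<^bsub>B\<^esub> X) y = z \<odot>\<^bsub>?G\<^esub> \<psi> X y" if "X \<in> carrier B" "y \<in> carrier ?G" for z X y
      using that by (simp add: psi_eq closed_B(3)[OF that(1,1)] ops cc_smult[OF cc] GK)
    show "\<psi> (X \<otimes>\<^bsub>B\<^esub> Y) = compose (carrier ?G) (\<psi> X) (\<psi> Y)" if "X \<in> carrier B" "Y \<in> carrier B" for X Y
    proof (rule extensionalityI[of _ "carrier ?G"])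
      show "\<psi> (X \<otimes>\<^bsub>B\<^esub> Y) \<in> extensional (carrier ?G)"
        by (rule bounded_operators_extensional[OF bounded[OF closed_B(2)[OF that]]])
      show "\<psi> (X \<otimes>\<^bsub>B\<^esub> Y) y = compose (carrier ?G) (\<psi> X) (\<psi> Y) y" if y: "y \<in> carrier ?G" for y
        using \<open>X \<in> carrier B\<close> \<open>Y \<in> carrier B\<close> y
        by (simp add: compose_eq psi_eq inv closed_B cc_compose[OF cc] GK)
    qed simp
    fix n :: nat and X assume X: "\<forall>i<n. \<forall>j<n. X i j \<in> carrier B"
    have "matrix_op_norm ?G n (\<lambda>i j. \<psi> (X i j)) = matrix_op_norm ?G n (\<lambda>i j. G.pull (\<rho> (X i j)))"
      by (rule matrix_op_norm_cong[OF G.hilbert_space_G])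
        (use X bounded in \<open>auto simp: psi[symmetric]\<close>)
    also have "\<dots> \<le> matrix_op_norm K n (\<lambda>i j. \<rho> (X i j))"
      by (rule G.pull_matrix_op_norm) (use X inv cc_bounded[OF cc] in auto)
    also have "\<dots> \<le> matrix_norm B n X"
      by (rule cc_contractive[OF cc]) (use X in simp)
    finally show "matrix_op_norm ?G n (\<lambda>i j. \<psi> (X i j)) \<le> matrix_norm B n X" .
  qed
  show "is_direct_sum B H extension K J \<psi> \<rho>"
    unfolding is_direct_sum_def
  proof (intro ballI)
    fix X x y assume X: "X \<in> carrier B" and x: "x \<in> carrier H" and y: "y \<in> carrier ?G"
    have "\<rho> X (J x) = J (extension X x)"
      using reduces_all[OF X] x dilation_eq[OF X x] unfolding reduces_def by metis
    then show "\<rho> X (J x \<oplus>\<^bsub>K\<^esub> y) = J (extension X x) \<oplus>\<^bsub>K\<^esub> \<psi> X y"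
      using x GK[OF y] by (simp add: bounded_operators_add[OF cc_bounded[OF cc X]] psi_eq[OF X y])
  qed
qed

end

text \<open>The covariance relation is evaluated at V_p x, where the adjoint of the isometry V_p
  cancels V_p.\<close>

lemma isometric_covariant_imp_right_covariant:
  assumes cov: "isometric_covariant_rep \<alpha> H \<pi> V"
  shows "isometric_right_covariant_rep \<alpha> H \<pi> V"
proof -
  have H: "complex_hilbert_space H" and rep: "unital_star_representation H \<pi>" and iso: "isometric_representation H V"
    using cov unfolding isometric_covariant_rep_def by (blast, blast, blast)
  have c: "compose (carrier H) (V p) (compose (carrier H) (\<pi> a) (adjoint H H (V p))) = \<pi> (\<alpha> p a)" for p a
    using cov unfolding isometric_covariant_rep_def by blast
  have V: "isometry H H (V p)" for p
    using iso unfolding isometric_representation_def by blast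
  have "compose (carrier H) (V p) (\<pi> a) = compose (carrier H) (\<pi> (\<alpha> p a)) (V p)" for p a
  proof (rule extensionalityI[of _ "carrier H"])
    fix x assume x: "x \<in> carrier H"
    have "V p \<in> bounded_operators H H"
      using V unfolding isometry_def by blast
    then have "V p x \<in> carrier H"
      using x by (rule bounded_operators_closed)
    then show "compose (carrier H) (V p) (\<pi> a) x = compose (carrier H) (\<pi> (\<alpha> p a)) (V p) x"
      using x isometry_adjoint[OF H H V x] fun_cong[OF c[of p a], of "V p x"] by (simp add: compose_eq)
  qed (rule compose_extensional)+
  then show ?thesis
    unfolding isometric_right_covariant_rep_def by (intro conjI allI H rep iso)
qed

theorem proposition4p1:
  fixes \<alpha> :: "'p::comm_monoid_mult \<Rightarrow> 'a::unital_cstar_algebra \<Rightarrow> 'a"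
    and H :: "'h hilbert"
    and \<pi> :: "'a \<Rightarrow> 'h \<Rightarrow> 'h"
    and V :: "'p \<Rightarrow> 'h \<Rightarrow> 'h"
  assumes left_cancellative: "\<And>p q r :: 'p. p * q = p * r \<Longrightarrow> q = r"
    and system: "semigroup_dynamical_system \<alpha>"
    and injective: "injective_system \<alpha>"
    and aligned: "aligned_projections \<alpha>"
    and hereditary_ranges: "\<And>p. hereditary (range (\<alpha> p))"
    and covariant: "isometric_covariant_rep \<alpha> H \<pi> V"
  shows "isometric_right_covariant_rep \<alpha> H \<pi> V \<and>
         maximal_rep TYPE('k) (iso_crossed_product \<alpha>) H (induced_hom \<alpha> H \<pi> V)"
proof
  show right: "isometric_right_covariant_rep \<alpha> H \<pi> V"
    by (rule isometric_covariant_imp_right_covariant[OF covariant])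
  interpret right_covariant_rep \<alpha> H \<pi> V
    by unfold_locales (rule system, rule right)
  show "maximal_rep TYPE('k) (iso_crossed_product \<alpha>) H (induced_hom \<alpha> H \<pi> V)"
    unfolding maximal_rep_def induced_hom_eq
  proof (rule conjI[OF extension_cc], intro allI impI)
    fix K :: "'k hilbert" and J \<rho>
    assume dilation: "is_dilation (iso_crossed_product \<alpha>) H extension K J \<rho>"
    interpret covariant_dilation \<alpha> H \<pi> V K J \<rho>
      by unfold_locales (rule covariant, rule dilation)
    show "\<exists>\<psi>. cc_homomorphism (iso_crossed_product \<alpha>) (orthogonal_complement K (J ` carrier H)) \<psi> \<and>
        is_direct_sum (iso_crossed_product \<alpha>) H extension K J \<psi> \<rho>"
      using direct_sum by blast
  qed
qed

end
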